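(* Let $G$ be a red-blue colouring of $K_n$, let $u \in V(G)$, and let $H = G \setminus \{u\}$. If $H \in \mathcal{C}$, then either $\mathrm{pack}(G) > n(n-1)/4$ or $G \in \mathcal{C}$.
   Context: A red-blue colouring $G$ of $K_n$ assigns red or blue to each edge of the complete graph on the $n$-vertex set $V(G)$; $G_R, G_B$ are the spanning subgraphs of red and blue edges, and $G\setminus\{u\}$ is the colouring induced on $V(G)\setminus\{u\}$. For a graph $F$, a fractional triangle packing is a function $\omega$ from the triangles of $F$ to $[0,1]$ with $\sum_{T \ni e}\omega(T) \le 1$ for every edge $e$; $\nu^*(F)$ is the maximum of $\sum_T\omega(T)$; $\mathrm{pack}(G) = 3(\nu^*(G_R)+\nu^*(G_B))$. $G$ is a pentagon blow-up with blobs $A_1,\dots,A_5$ if $\{A_1,\dots,A_5\}$ is a partition of $V(G)$ into non-empty sets such that all edges between $A_i$ and $A_{i+1}$ are red and all edges between $A_i$ and $A_{i+2}$ are blue for $i \in [5]$ (indices modulo 5; edges inside a blob are coloured arbitrarily); its blob sizes are $|A_1|,\dots,|A_5|$. $G$ is one edge-flip away from a pentagon blow-up with given blob sizes if changing the colour of a single edge of $G$ yields a pentagon blow-up with those blob sizes. Let $\mathcal{B}_1 = \{(3,3,3,4,4), (2,3,4,4,4), (3,3,3,3,5), (3,3,4,4,4), (2,4,4,4,4), (3,3,3,4,5), (3,4,4,4,4), (3,3,4,4,5), (4,4,4,4,4), (3,4,4,4,5), (4,4,4,4,5), (3,4,4,5,5), (4,4,4,5,5), (4,4,5,5,5), (4,5,5,5,5),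 (5,5,5,5,5)\}$ and $\mathcal{B}_2 = \{(3,3,3,4,4), (3,3,4,4,4), (3,4,4,4,4), (4,4,4,4,4), (4,4,4,4,5)\}$. Let $\mathcal{C}_1$ be the family of pentagon blow-ups whose blob sizes, in some order, form a tuple in $\mathcal{B}_1$; let $\mathcal{C}_2$ be the family of red-blue colourings of complete graphs that are one edge-flip away from a pentagon blow-up whose blob sizes, in some order, form a tuple in $\mathcal{B}_2$; and $\mathcal{C} = \mathcal{C}_1 \cup \mathcal{C}_2$. *)

theory Defs
  imports Complex_Main "HOL-Library.Multiset"
begin

text \<open>A red-blue colouring of the complete graph on a finite vertex set V is represented
by the pair (V, R), where R is the set of red edges (2-element subsets of V);
all other 2-subsets of V are blue.\<close>

definition pairs :: "'a set \<Rightarrow> 'a set set" where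
  "pairs V = {e. \<exists>x y. x \<in> V \<and> y \<in> V \<and> x \<noteq> y \<and> e = {x, y}}"

definition colouring :: "'a set \<Rightarrow> 'a set set \<Rightarrow> bool" where
  "colouring V R \<longleftrightarrow> finite V \<and> R \<subseteq> pairs V"

definition red_edges :: "'a set \<Rightarrow> 'a set set \<Rightarrow> 'a set set" where
  "red_edges V R = R"

definition blue_edges :: "'a set \<Rightarrow> 'a set set \<Rightarrow> 'a set set" where
  "blue_edges V R = pairs V - R"

definition delete_vertex_red :: "'a set set \<Rightarrow> 'a \<Rightarrow> 'a set set" where
  "delete_vertex_red R u = {e \<in> R. u \<notin> e}"

definition triangles :: "'a set set \<Rightarrow> 'a set set" where
  "triangles E = {T. card T = 3 \<and> (\<forall>x\<in>T. \<forall>y\<in>T. x \<noteq> y \<longrightarrow> {x, y} \<in> E)}"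

definition frac_triangle_packing :: "'a set set \<Rightarrow> ('a set \<Rightarrow> real) \<Rightarrow> bool" where
  "frac_triangle_packing E \<omega> \<longleftrightarrow>
     (\<forall>T \<in> triangles E. 0 \<le> \<omega> T \<and> \<omega> T \<le> 1) \<and>
     (\<forall>e \<in> E. (\<Sum>T \<in> {T \<in> triangles E. e \<subseteq> T}. \<omega> T) \<le> 1)"

definition nu_star :: "'a set set \<Rightarrow> real" where
  "nu_star E = Sup {(\<Sum>T \<in> triangles E. \<omega> T) | \<omega>. frac_triangle_packing E \<omega>}"

definition pack :: "'a set \<Rightarrow> 'a set set \<Rightarrow> real" where
  "pack V R = 3 * (nu_star (red_edges V R) + nu_star (blue_edges V R))"

definition pentagon_blowup :: "'a set \<Rightarrow> 'a set set \<Rightarrow> (nat \<Rightarrow> 'a set) \<Rightarrow> bool" where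
  "pentagon_blowup V R A \<longleftrightarrow>
     (\<forall>i<5. A i \<noteq> {}) \<and> (\<Union>i<5. A i) = V \<and>
     (\<forall>i<5. \<forall>j<5. i \<noteq> j \<longrightarrow> A i \<inter> A j = {}) \<and>
     (\<forall>i<5. \<forall>x\<in>A i. \<forall>y\<in>A ((i + 1) mod 5). {x, y} \<in> R) \<and>
     (\<forall>i<5. \<forall>x\<in>A i. \<forall>y\<in>A ((i + 2) mod 5). {x, y} \<notin> R)"

definition blob_sizes_in :: "(nat \<Rightarrow> 'a set) \<Rightarrow> nat list set \<Rightarrow> bool" where
  "blob_sizes_in A B \<longleftrightarrow> (\<exists>t \<in> B. mset (map (\<lambda>i. card (A i)) [0..<5]) = mset t)"

definition B1 :: "nat list set" where
  "B1 = {[3,3,3,4,4], [2,3,4,4,4], [3,3,3,3,5], [3,3,4,4,4], [2,4,4,4,4], [3,3,3,4,5],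
         [3,4,4,4,4], [3,3,4,4,5], [4,4,4,4,4], [3,4,4,4,5], [4,4,4,4,5], [3,4,4,5,5],
         [4,4,4,5,5], [4,4,5,5,5], [4,5,5,5,5], [5,5,5,5,5]}"

definition B2 :: "nat list set" where
  "B2 = {[3,3,3,4,4], [3,3,4,4,4], [3,4,4,4,4], [4,4,4,4,4], [4,4,4,4,5]}"

definition in_C1 :: "'a set \<Rightarrow> 'a set set \<Rightarrow> bool" where
  "in_C1 V R \<longleftrightarrow> (\<exists>A. pentagon_blowup V R A \<and> blob_sizes_in A B1)"

definition flip_edge :: "'a set set \<Rightarrow> 'a set \<Rightarrow> 'a set set" where
  "flip_edge R e = (if e \<in> R then R - {e} else insert e R)"

definition in_C2 :: "'a set \<Rightarrow> 'a set set \<Rightarrow> bool" where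
  "in_C2 V R \<longleftrightarrow> (\<exists>e \<in> pairs V. \<exists>A. pentagon_blowup V (flip_edge R e) A \<and> blob_sizes_in A B2)"

definition in_C :: "'a set \<Rightarrow> 'a set set \<Rightarrow> bool" where
  "in_C V R \<longleftrightarrow> in_C1 V R \<or> in_C2 V R"

end

theory Submission
  imports Defs
begin

text \<open>
In a pentagon blow-up every edge inside a blob can be packed completely: a red edge inside
\<open>A\<^sub>i\<close> is completed by apexes in \<open>A\<^sub>i\<^sub>-\<^sub>1 \<union> A\<^sub>i\<^sub>+\<^sub>1\<close>, a blue one by apexes in
\<open>A\<^sub>i\<^sub>-\<^sub>2 \<union> A\<^sub>i\<^sub>+\<^sub>2\<close>. If the apex weights \<open>w\<^sub>i(z)\<close> depend only on the blob and the apex, then an edge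
\<open>xz\<close> between \<open>A\<^sub>i\<close> and \<open>A\<^sub>j\<close> carries at most \<open>(|A\<^sub>i| - 1) w\<^sub>i(z) + (|A\<^sub>j| - 1) w\<^sub>j(x)\<close>, whatever the
colours inside the blobs are. The remaining capacity of the edges between blobs accommodates
triangles through the new vertex \<open>u\<close> (a fractional matching between the neighbours of \<open>u\<close> of one
colour) and, if \<open>H\<close> has a flipped edge, triangles through that edge. The total weight obtained
in this way is bounded below in terms of the numbers of red and blue neighbours of \<open>u\<close> in each
blob only, and the bound is monotone in both. So finitely many boxes of such numbers have to be
examined, and in each of them either the bound exceeds \<open>n(n-1)/4\<close> or \<open>u\<close> can be added to a
blob with at most one wrongly coloured edge.
\<close>

section \<open>Lower bounds for fractional triangle packings\<close>

text \<open>The obstacle is that the colours inside the blobs are arbitrary. Bounding the two colour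
  classes separately removes it: a vertex of a blob of size a has at most a - 1 inner edges of
  either colour, which bounds the load on the edges between blobs, and the inner edges of both
  colours together are all pairs inside blobs. So the target n(n-1)/4 becomes a requirement on the
  triangles through \<open>u\<close>, and through a flipped edge, alone. For each size tuple the
  apex weights and the spare capacities are fixed once for all neighbourhoods of \<open>u\<close>.
  Only the matching varies, and as every feasible one gives a lower bound, a greedy one suffices. A
  matching computed for few neighbours stays feasible for more, because its weight can be spread
  evenly over the additional vertices; this makes a single evaluation valid in a whole box.
  Multiplying by a common denominator turns all checks into integer arithmetic.\<close>

lemma pairs_iff: "{x, y} \<in> pairs V \<longleftrightarrow> x \<in> V \<and> y \<in> V \<and> x \<noteq> y"
  by (auto simp: pairs_def doubleton_eq_iff)

lemma triangle_triple_iff: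
  assumes "E \<subseteq> pairs V"
  shows "{x, y, z} \<in> triangles E \<longleftrightarrow> {x, y} \<in> E \<and> {x, z} \<in> E \<and> {y, z} \<in> E"
proof -
  have ne: "{a, a} \<notin> E" for a
    using assms pairs_iff[of a a V] by blast
  show ?thesis
  proof
    assume T: "{x, y, z} \<in> triangles E"
    then have "card {x, y, z} = 3" by (simp add: triangles_def)
    then have "x \<noteq> y" "x \<noteq> z" "y \<noteq> z" by (auto simp: card_insert_if split: if_splits)
    then show "{x, y} \<in> E \<and> {x, z} \<in> E \<and> {y, z} \<in> E"
      using T by (auto simp: triangles_def)
  next
    assume "{x, y} \<in> E \<and> {x, z} \<in> E \<and> {y, z} \<in> E"
    moreover from this have "x \<noteq> y" "x \<noteq> z" "y \<noteq> z" using ne by auto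
    ultimately show "{x, y, z} \<in> triangles E"
      by (auto simp: triangles_def insert_commute)
  qed
qed

lemma triangles_subset:
  assumes "E \<subseteq> pairs V" "T \<in> triangles E"
  shows "T \<subseteq> V"
proof -
  obtain x y z where T: "T = {x, y, z}"
    using assms(2) by (auto simp: triangles_def card_3_iff)
  have "{x, y} \<in> pairs V" "{x, z} \<in> pairs V"
    using assms unfolding T triangle_triple_iff[OF assms(1)] by auto
  then show ?thesis unfolding T by (auto simp: pairs_iff)
qed

lemma finite_triangles:
  assumes "finite V" "E \<subseteq> pairs V"
  shows "finite (triangles E)"
  using triangles_subset[OF assms(2)] assms(1)
  by (intro finite_subset[of "triangles E" "Pow V"]) auto

lemma nu_star_ge_packing:
  assumes "finite V" "E \<subseteq> pairs V" "frac_triangle_packing E \<omega>"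
  shows "(\<Sum>T\<in>triangles E. \<omega> T) \<le> nu_star E"
  unfolding nu_star_def
proof (rule cSup_upper)
  show "bdd_above {sum \<omega> (triangles E) |\<omega>. frac_triangle_packing E \<omega>}"
  \<comment> \<open>\<open>Sup\<close> on the reals is an upper bound only for a bounded set; as
    every weight is at most 1, the number of triangles bounds each total.\<close>
  proof (rule bdd_aboveI[of _ "real (card (triangles E))"])
    fix r assume "r \<in> {sum \<omega> (triangles E) |\<omega>. frac_triangle_packing E \<omega>}"
    then obtain \<omega> where "r = sum \<omega> (triangles E)" "\<forall>T\<in>triangles E. \<omega> T \<le> 1"
      by (auto simp: frac_triangle_packing_def)
    then show "r \<le> real (card (triangles E))"
      using sum_bounded_above[of "triangles E" \<omega> 1] by auto
  qed
qed (use assms in blast)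

text \<open>A weight \<open>W x y z\<close> stands for the triangle with base \<open>{x, y}\<close> and apex \<open>z\<close>.\<close>

lemma nu_star_ge_base_apex_weights:
  fixes W :: "'a \<Rightarrow> 'a \<Rightarrow> 'a \<Rightarrow> real"
  assumes fin: "finite V" and EV: "E \<subseteq> pairs V"
    and W0: "\<And>x y z. 0 \<le> W x y z"
    and sym: "\<And>x y z. W x y z = W y x z"
    and supp: "\<And>x y z. W x y z \<noteq> 0 \<Longrightarrow> {x, y} \<in> E \<and> {x, z} \<in> E \<and> {y, z} \<in> E"
    and load: "\<And>p q. {p, q} \<in> E \<Longrightarrow>
      (\<Sum>z\<in>V. W p q z) + (\<Sum>y\<in>V. W p y q) + (\<Sum>y\<in>V. W q y p) \<le> 1"
  shows "(\<Sum>x\<in>V. \<Sum>y\<in>V. \<Sum>z\<in>V. W x y z) / 2 \<le> nu_star E"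
proof -
  define U where "U = V \<times> V \<times> V"
  define w where "w = (\<lambda>(x, y, z). W x y z)"
  define t :: "'a \<times> 'a \<times> 'a \<Rightarrow> 'a set" where "t = (\<lambda>(x, y, z). {x, y, z})"
  \<comment> \<open>The triples \<open>(x, y, z)\<close> and \<open>(y, x, z)\<close> stand for the
    same base and apex, hence the division by 2; the sum also merges the up to three choices of an
    apex in \<open>T\<close>.\<close>
  define \<omega> where "\<omega> T = (\<Sum>i\<in>{i \<in> U. t i = T}. w i) / 2" for T
  have finU: "finite U" using fin by (simp add: U_def)
  have finT: "finite (triangles E)" by (rule finite_triangles[OF fin EV])
  have w0: "0 \<le> w i" for i using W0 by (cases i) (auto simp: w_def)
  have wT: "t i \<in> triangles E" if "w i \<noteq> 0" for i
    using supp that by (cases i) (auto simp: w_def t_def triangle_triple_iff[OF EV])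
  have tot: "(\<Sum>T\<in>{T \<in> triangles E. P T}. \<omega> T) = (\<Sum>i\<in>{i \<in> U. P (t i)}. w i) / 2" for P
  proof -
    have "(\<Sum>T\<in>{T \<in> triangles E. P T}. \<Sum>i\<in>{i \<in> U. t i = T}. w i)
        = (\<Sum>T\<in>{T \<in> triangles E. P T}. \<Sum>i\<in>{i \<in> {i \<in> U. t i \<in> triangles E \<and> P (t i)}. t i = T}. w i)"
      by (intro sum.cong) auto
    also have "\<dots> = (\<Sum>i\<in>{i \<in> U. t i \<in> triangles E \<and> P (t i)}. w i)"
      by (rule sum.group) (use finU finT in auto)
    also have "\<dots> = (\<Sum>i\<in>{i \<in> U. P (t i)}. w i)"
      by (rule sum.mono_neutral_left) (use finU wT in auto)
    finally show ?thesis by (simp add: \<omega>_def flip: sum_divide_distrib)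
  qed
  have cap: "(\<Sum>T\<in>{T \<in> triangles E. e \<subseteq> T}. \<omega> T) \<le> 1" if eE: "e \<in> E" for e
  proof -
    obtain p q where e: "e = {p, q}" and pq: "p \<in> V" "q \<in> V" "p \<noteq> q"
      using eE EV unfolding pairs_def by blast
    \<comment> \<open>The roles that \<open>{p, q}\<close> can play in an ordered triple: base, side
      with apex \<open>q\<close>, or side with apex \<open>p\<close>, each in two orders. The
      families may overlap, so only subadditivity of the sum is used below.\<close>
    define I where "I = {(p, q, z) | z. z \<in> V} \<union> {(q, p, z) | z. z \<in> V} \<union>
      ({(p, y, q) | y. y \<in> V} \<union> {(y, p, q) | y. y \<in> V}) \<union>
      ({(q, y, p) | y. y \<in> V} \<union> {(y, q, p) | y. y \<in> V})"
    have im: "{(p, q, z) | z. z \<in> V} = (\<lambda>z. (p, q, z)) ` V" "{(q, p, z) | z. z \<in> V} = (\<lambda>z. (q, p, z)) ` V"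
      "{(p, y, q) | y. y \<in> V} = (\<lambda>y. (p, y, q)) ` V" "{(y, p, q) | y. y \<in> V} = (\<lambda>y. (y, p, q)) ` V"
      "{(q, y, p) | y. y \<in> V} = (\<lambda>y. (q, y, p)) ` V" "{(y, q, p) | y. y \<in> V} = (\<lambda>y. (y, q, p)) ` V"
      by auto
    have "finite I" unfolding I_def im using fin by simp
    moreover have "{i \<in> U. e \<subseteq> t i} \<subseteq> I"
    proof
      fix i assume "i \<in> {i \<in> U. e \<subseteq> t i}"
      then obtain x y z where i: "i = (x, y, z)" and V: "x \<in> V" "y \<in> V" "z \<in> V" and "{p, q} \<subseteq> {x, y, z}"
        unfolding U_def t_def e by auto
      then consider "x = p" "y = q" | "x = q" "y = p" | "x = p" "z = q" | "y = p" "z = q"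
        | "x = q" "z = p" | "y = q" "z = p"
        using pq by auto
      then show "i \<in> I" unfolding I_def i using V by cases simp_all
    qed
    ultimately have "(\<Sum>i\<in>{i \<in> U. e \<subseteq> t i}. w i) \<le> (\<Sum>i\<in>I. w i)"
      by (intro sum_mono2 w0)
    also have "\<dots> \<le> (\<Sum>z\<in>V. W p q z) + (\<Sum>z\<in>V. W q p z) + ((\<Sum>y\<in>V. W p y q) + (\<Sum>y\<in>V. W y p q))
        + ((\<Sum>y\<in>V. W q y p) + (\<Sum>y\<in>V. W y q p))"
    proof -
      have un: "sum w (A \<union> B) \<le> sum w A + sum w B" if "finite A" "finite B" for A B
        using that w0 by (simp add: sum_Un sum_nonneg)
      have "sum w ((\<lambda>z. (p, q, z)) ` V) = (\<Sum>z\<in>V. W p q z)" "sum w ((\<lambda>z. (q, p, z)) ` V) = (\<Sum>z\<in>V. W q p z)"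
        "sum w ((\<lambda>y. (p, y, q)) ` V) = (\<Sum>y\<in>V. W p y q)" "sum w ((\<lambda>y. (y, p, q)) ` V) = (\<Sum>y\<in>V. W y p q)"
        "sum w ((\<lambda>y. (q, y, p)) ` V) = (\<Sum>y\<in>V. W q y p)" "sum w ((\<lambda>y. (y, q, p)) ` V) = (\<Sum>y\<in>V. W y q p)"
        by (subst sum.reindex; auto simp: inj_on_def w_def)+
      then show ?thesis unfolding I_def im
        using fin by (intro order_trans[OF un] add_mono) simp_all
    qed
    also have "\<dots> = 2 * ((\<Sum>z\<in>V. W p q z) + (\<Sum>y\<in>V. W p y q) + (\<Sum>y\<in>V. W q y p))"
    proof -
      have "(\<Sum>z\<in>V. W q p z) = (\<Sum>z\<in>V. W p q z)" "(\<Sum>y\<in>V. W y p q) = (\<Sum>y\<in>V. W p y q)"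
        "(\<Sum>y\<in>V. W y q p) = (\<Sum>y\<in>V. W q y p)"
        by (intro sum.cong refl sym)+
      then show ?thesis by simp
    qed
    also have "\<dots> \<le> 2" using load[of p q] eE e by simp
    finally show ?thesis by (simp add: tot[of "\<lambda>T. e \<subseteq> T"])
  qed
  have \<omega>0: "0 \<le> \<omega> T" for T by (simp add: \<omega>_def sum_nonneg w0)
  have \<omega>1: "\<omega> T \<le> 1" if T: "T \<in> triangles E" for T
  proof -
    obtain x y z where xyz: "T = {x, y, z}"
      using T by (auto simp: triangles_def card_3_iff)
    then have e: "{x, y} \<in> E" using T by (simp add: triangle_triple_iff[OF EV])
    have "\<omega> T \<le> (\<Sum>T\<in>{T \<in> triangles E. {x, y} \<subseteq> T}. \<omega> T)"
      by (rule member_le_sum) (use T xyz \<omega>0 finT in auto)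
    then show ?thesis using cap[OF e] by linarith
  qed
  have "frac_triangle_packing E \<omega>"
    using \<omega>0 \<omega>1 cap by (simp add: frac_triangle_packing_def)
  from nu_star_ge_packing[OF fin EV this]
  have "(\<Sum>i\<in>U. w i) / 2 \<le> nu_star E" using tot[of "\<lambda>_. True"] by simp
  then show ?thesis by (simp add: U_def w_def sum.cartesian_product)
qed

text \<open>Three kinds of triangles are combined: an edge inside blob \<open>i\<close> with apex
  \<open>z\<close> (weight \<open>\<alpha> i z\<close>), \<open>u\<close> with an edge between two
  blobs (\<open>\<xi> x y\<close>), and the edge \<open>{v\<^sub>1, v\<^sub>2}\<close> with apex
  \<open>w\<close> (\<open>\<zeta> w\<close>). By \<open>asum\<close> the first kind fills every
  inner edge of \<open>E\<close>, so it contributes exactly their number. The factors in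
  \<open>cap\<close> bound the number of inner edges of \<open>E\<close> at an endpoint, and the
  last term of \<open>fl\<close> is the load of \<open>{v\<^sub>1, v\<^sub>2}\<close> itself. Sums
  over ordered pairs are halved.\<close>

lemma nu_star_ge_blob_weights:
  fixes b :: "'a \<Rightarrow> nat" and \<alpha> :: "nat \<Rightarrow> 'a \<Rightarrow> real" and \<xi> :: "'a \<Rightarrow> 'a \<Rightarrow> real" and \<zeta> :: "'a \<Rightarrow> real"
  defines "fl \<equiv> \<lambda>v\<^sub>1 v\<^sub>2 X x y. (if x = v\<^sub>1 \<or> x = v\<^sub>2 then \<zeta> y else 0) + (if y = v\<^sub>1 \<or> y = v\<^sub>2 then \<zeta> x else 0)
      + (if {x, y} = {v\<^sub>1, v\<^sub>2} then \<Sum>w\<in>X. \<zeta> w else 0)"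
  assumes fin: "finite V" and EV: "E \<subseteq> pairs V" and u: "u \<in> V" and X: "X = V - {u}"
    and a0: "\<And>i z. 0 \<le> \<alpha> i z"
    and asupp: "\<And>i z. \<alpha> i z \<noteq> 0 \<Longrightarrow> z \<in> X \<and> b z \<noteq> i \<and> (\<forall>x\<in>X. b x = i \<longrightarrow> {x, z} \<in> E)"
    and asum: "\<And>x. x \<in> X \<Longrightarrow> (\<Sum>z\<in>X. \<alpha> (b x) z) = 1"
    and x0: "\<And>x y. 0 \<le> \<xi> x y" and xsym: "\<And>x y. \<xi> x y = \<xi> y x"
    and xsupp: "\<And>x y. \<xi> x y \<noteq> 0 \<Longrightarrow>
      x \<in> X \<and> y \<in> X \<and> b x \<noteq> b y \<and> {x, y} \<in> E \<and> {x, u} \<in> E \<and> {y, u} \<in> E"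
    and z0: "\<And>w. 0 \<le> \<zeta> w"
    and zsupp: "\<And>w. \<zeta> w \<noteq> 0 \<Longrightarrow>
      w \<in> X \<and> b w \<noteq> b v\<^sub>1 \<and> b w \<noteq> b v\<^sub>2 \<and> {v\<^sub>1, v\<^sub>2} \<in> E \<and> {v\<^sub>1, w} \<in> E \<and> {v\<^sub>2, w} \<in> E"
    and v: "v\<^sub>1 \<in> X" "v\<^sub>2 \<in> X" "b v\<^sub>1 \<noteq> b v\<^sub>2"
    and cap: "\<And>x y. \<lbrakk>x \<in> X; y \<in> X; b x \<noteq> b y; {x, y} \<in> E\<rbrakk> \<Longrightarrow>
      (real (card {x' \<in> X. b x' = b x}) - 1) * \<alpha> (b x) y + (real (card {x' \<in> X. b x' = b y}) - 1) * \<alpha> (b y) x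
        + \<xi> x y + fl v\<^sub>1 v\<^sub>2 X x y \<le> 1"
    and deg: "\<And>x. x \<in> X \<Longrightarrow> {x, u} \<in> E \<Longrightarrow> (\<Sum>y\<in>X. \<xi> x y) \<le> 1"
  shows "real (card {(x, y). x \<in> X \<and> y \<in> X \<and> b x = b y \<and> {x, y} \<in> E}) / 2
      + (\<Sum>x\<in>X. \<Sum>y\<in>X. \<xi> x y) / 2 + (\<Sum>w\<in>X. \<zeta> w) \<le> nu_star E"
proof -
  define inn where "inn x y \<longleftrightarrow> x \<in> X \<and> y \<in> X \<and> b x = b y \<and> {x, y} \<in> E" for x y
  define W1 where "W1 x y z = (if inn x y then \<alpha> (b x) z else 0)" for x y z
  define W2 where "W2 x y z = (if z = u then \<xi> x y else 0)" for x y z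
  define W3 where "W3 x y z = (if {x, y} = {v\<^sub>1, v\<^sub>2} then \<zeta> z else 0)" for x y z
  define W where "W x y z = W1 x y z + W2 x y z + W3 x y z" for x y z
  have finX: "finite X" and VX: "V = insert u X" and uX: "u \<notin> X" using fin u X by auto
  have v12: "v\<^sub>1 \<noteq> v\<^sub>2" using v by auto
  have ne: "x \<noteq> y" if "{x, y} \<in> E" for x y using that EV pairs_iff[of x y V] by blast
  have au: "\<alpha> i u = 0" for i using asupp uX by blast
  have xu: "\<xi> u y = 0" "\<xi> y u = 0" for y using xsupp uX by blast+
  have zu: "\<zeta> u = 0" using zsupp uX by blast
  have sV: "(\<Sum>z\<in>V. f z) = f u + (\<Sum>z\<in>X. f z)" for f :: "'a \<Rightarrow> real"
    using finX uX by (simp add: VX)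
  have inn_sym: "inn x y \<longleftrightarrow> inn y x" for x y by (auto simp: inn_def insert_commute)
  have other: "{x, y} = {v\<^sub>1, v\<^sub>2} \<longleftrightarrow> (x = v\<^sub>1 \<and> y = v\<^sub>2) \<or> (x = v\<^sub>2 \<and> y = v\<^sub>1)" for x y
    by (auto simp: doubleton_eq_iff)
  have base1: "(\<Sum>z\<in>V. W1 p q z) = (if inn p q then 1 else 0)" for p q
    by (cases "inn p q") (auto simp: W1_def sV au asum inn_def)
  have base2: "(\<Sum>z\<in>V. W2 p q z) = \<xi> p q" for p q
    using fin u by (simp add: W2_def)
  have base3: "(\<Sum>z\<in>V. W3 p q z) = (if {p, q} = {v\<^sub>1, v\<^sub>2} then \<Sum>w\<in>X. \<zeta> w else 0)" for p q
    by (simp add: W3_def sV zu)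
  have side1: "(\<Sum>y\<in>V. W1 p y q) \<le> (if p \<in> X then (real (card {x' \<in> X. b x' = b p}) - 1) * \<alpha> (b p) q else 0)" for p q
  proof -
    have "(\<Sum>y\<in>V. W1 p y q) = (\<Sum>y\<in>{y \<in> V. inn p y}. \<alpha> (b p) q)"
      unfolding W1_def by (rule sum.inter_filter[OF fin, symmetric])
    also have "\<dots> = real (card {y \<in> V. inn p y}) * \<alpha> (b p) q" by simp
    also have "\<dots> \<le> (if p \<in> X then (real (card {x' \<in> X. b x' = b p}) - 1) * \<alpha> (b p) q else 0)"
    proof (cases "p \<in> X")
      case True
      have "card {y \<in> V. inn p y} \<le> card ({x' \<in> X. b x' = b p} - {p})"
        by (rule card_mono) (use finX ne in \<open>auto simp: inn_def\<close>)
      also have "\<dots> = card {x' \<in> X. b x' = b p} - 1" using True finX by (subst card_Diff_singleton) auto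
      finally have *: "card {y \<in> V. inn p y} \<le> card {x' \<in> X. b x' = b p} - 1" .
      have "card {x' \<in> X. b x' = b p} \<noteq> 0" using True finX by auto
      then have "real (card {y \<in> V. inn p y}) \<le> real (card {x' \<in> X. b x' = b p}) - 1" using * by linarith
      then show ?thesis using True a0 by (simp add: mult_right_mono)
    qed (simp add: inn_def)
    finally show ?thesis .
  qed
  have side2: "(\<Sum>y\<in>V. W2 p y q) = (if q = u then \<Sum>y\<in>X. \<xi> p y else 0)" for p q
    by (simp add: W2_def sV xu)
  have flip_sum: "(\<Sum>y\<in>V. if {p, y} = {v\<^sub>1, v\<^sub>2} then C else 0) = (if p = v\<^sub>1 \<or> p = v\<^sub>2 then C else 0)" for p and C :: real
  proof -
    have "(\<Sum>y\<in>V. if {p, y} = {v\<^sub>1, v\<^sub>2} then C else 0)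
        = (\<Sum>y\<in>V. (if y = v\<^sub>2 then if p = v\<^sub>1 then C else 0 else 0) + (if y = v\<^sub>1 then if p = v\<^sub>2 then C else 0 else 0))"
      by (rule sum.cong) (use v12 in \<open>auto simp: other\<close>)
    also have "\<dots> = (if p = v\<^sub>1 then C else 0) + (if p = v\<^sub>2 then C else 0)"
      using fin v X by (simp add: sum.distrib)
    finally show ?thesis using v12 by simp
  qed
  have side3: "(\<Sum>y\<in>V. W3 p y q) = (if p = v\<^sub>1 \<or> p = v\<^sub>2 then \<zeta> q else 0)" for p q
    unfolding W3_def by (rule flip_sum)
  have W0: "0 \<le> W x y z" for x y z
    by (simp add: W_def W1_def W2_def W3_def a0 x0 z0)
  have sym: "W x y z = W y x z" for x y z
    using inn_sym[of x y] xsym[of x y]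
    by (auto simp: W_def W1_def W2_def W3_def insert_commute inn_def)
  have supp: "{x, y} \<in> E \<and> {x, z} \<in> E \<and> {y, z} \<in> E" if Wn: "W x y z \<noteq> 0" for x y z
  proof -
    consider "W1 x y z \<noteq> 0" | "W2 x y z \<noteq> 0" | "W3 x y z \<noteq> 0" using Wn unfolding W_def by fastforce
    then show ?thesis
    proof cases
      case 1
      then show ?thesis using asupp[of "b x" z] by (auto simp: W1_def inn_def split: if_splits)
    next
      case 2
      then show ?thesis using xsupp[of x y] by (auto simp: W2_def split: if_splits)
    next
      case 3
      then have "{x, y} = {v\<^sub>1, v\<^sub>2}" "\<zeta> z \<noteq> 0" by (auto simp: W3_def split: if_splits)
      then show ?thesis using zsupp[of z] unfolding other by (auto simp: insert_commute)
    qed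
  qed
  have load: "(\<Sum>z\<in>V. W p q z) + (\<Sum>y\<in>V. W p y q) + (\<Sum>y\<in>V. W q y p) \<le> 1" if e: "{p, q} \<in> E" for p q
  proof -
    have pqV: "p \<in> V" "q \<in> V" "p \<noteq> q" using e EV pairs_iff[of p q V] by auto
    define B where "B p q = (if inn p q then 1 else 0) + \<xi> p q + (if {p, q} = {v\<^sub>1, v\<^sub>2} then \<Sum>w\<in>X. \<zeta> w else 0)" for p q
    define S where "S p q = (if p \<in> X then (real (card {x' \<in> X. b x' = b p}) - 1) * \<alpha> (b p) q else 0)
      + (if q = u then \<Sum>y\<in>X. \<xi> p y else 0) + (if p = v\<^sub>1 \<or> p = v\<^sub>2 then \<zeta> q else 0)" for p q
    have le: "(\<Sum>z\<in>V. W p q z) + (\<Sum>y\<in>V. W p y q) + (\<Sum>y\<in>V. W q y p) \<le> B p q + S p q + S q p"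
      unfolding W_def sum.distrib base1 base2 base3 side2 side3 B_def S_def
      using side1[of p q] side1[of q p] by linarith
    \<comment> \<open>An edge at \<open>u\<close> occurs only as a side of triangles with apex
      \<open>u\<close>, so its load is the sum bounded by \<open>deg\<close>.\<close>
    have at_u: "B u q + S u q + S q u \<le> 1" "B q u + S q u + S u q \<le> 1" if "q \<in> X" "{q, u} \<in> E" for q
    proof -
      have [simp]: "\<not> inn u q" "\<not> inn q u" "{u, q} \<noteq> {v\<^sub>1, v\<^sub>2}" "{q, u} \<noteq> {v\<^sub>1, v\<^sub>2}" "u \<noteq> v\<^sub>1" "u \<noteq> v\<^sub>2" "q \<noteq> u"
        using uX v that by (auto simp: inn_def doubleton_eq_iff)
      show "B u q + S u q + S q u \<le> 1" "B q u + S q u + S u q \<le> 1"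
        using deg[OF that] by (auto simp: B_def S_def xu au zu uX)
    qed
    have "B p q + S p q + S q p \<le> 1"
    proof (cases "p = u \<or> q = u")
      case True
      then show ?thesis using at_u[of p] at_u[of q] pqV e VX by (auto simp: insert_commute)
    next
      case False
      then have XX: "p \<in> X" "q \<in> X" "p \<noteq> u" "q \<noteq> u" using pqV VX by auto
      show ?thesis
      proof (cases "b p = b q")
        \<comment> \<open>An edge inside a blob is a base only; every weight that would use it as a
          side vanishes.\<close>
        case True
        have "\<alpha> (b p) q = 0" "\<alpha> (b q) p = 0" "\<xi> p q = 0" using asupp xsupp True by fastforce+
        moreover have "{p, q} \<noteq> {v\<^sub>1, v\<^sub>2}" using True v by (auto simp: other)
        moreover have "(if p = v\<^sub>1 \<or> p = v\<^sub>2 then \<zeta> q else 0) = 0" "(if q = v\<^sub>1 \<or> q = v\<^sub>2 then \<zeta> p else 0) = 0"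
          using zsupp[of q] zsupp[of p] True by metis+
        ultimately show ?thesis using XX unfolding B_def S_def by simp
      next
        case ne: False
        then have "\<not> inn p q" by (simp add: inn_def)
        then show ?thesis using cap[OF XX(1,2) ne e] XX by (simp add: B_def S_def fl_def)
      qed
    qed
    with le show ?thesis by linarith
  qed
  have main: "(\<Sum>x\<in>V. \<Sum>y\<in>V. \<Sum>z\<in>V. W x y z) / 2 \<le> nu_star E"
    by (rule nu_star_ge_base_apex_weights[OF fin EV W0 sym supp load])
  have "(\<Sum>x\<in>V. \<Sum>y\<in>V. (if inn x y then 1 else 0)) = real (card {(x, y). x \<in> X \<and> y \<in> X \<and> b x = b y \<and> {x, y} \<in> E})"
  proof -
    have "(\<Sum>x\<in>V. \<Sum>y\<in>V. (if inn x y then 1 else 0)) = (\<Sum>i\<in>V \<times> V. if inn (fst i) (snd i) then 1 else (0::real))"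
      by (simp add: sum.cartesian_product case_prod_beta)
    also have "\<dots> = real (card {i \<in> V \<times> V. inn (fst i) (snd i)})"
      using fin by (simp add: sum.If_cases Int_def)
    also have "{i \<in> V \<times> V. inn (fst i) (snd i)} = {(x, y). x \<in> X \<and> y \<in> X \<and> b x = b y \<and> {x, y} \<in> E}"
      using VX by (auto simp: inn_def)
    finally show ?thesis .
  qed
  moreover have "(\<Sum>x\<in>V. \<Sum>y\<in>V. \<xi> x y) = (\<Sum>x\<in>X. \<Sum>y\<in>X. \<xi> x y)"
    by (simp add: sV xu)
  moreover have "(\<Sum>x\<in>V. \<Sum>y\<in>V. if {x, y} = {v\<^sub>1, v\<^sub>2} then \<Sum>w\<in>X. \<zeta> w else 0) = 2 * (\<Sum>w\<in>X. \<zeta> w)" (is "?L = _")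
  proof -
    have "?L = (\<Sum>x\<in>{x \<in> V. x = v\<^sub>1 \<or> x = v\<^sub>2}. \<Sum>w\<in>X. \<zeta> w)"
      unfolding flip_sum by (rule sum.inter_filter[OF fin, symmetric])
    also have "{x \<in> V. x = v\<^sub>1 \<or> x = v\<^sub>2} = {v\<^sub>1, v\<^sub>2}" using v X by auto
    finally show ?thesis using v12 by simp
  qed
  ultimately have "(\<Sum>x\<in>V. \<Sum>y\<in>V. \<Sum>z\<in>V. W x y z) =
      real (card {(x, y). x \<in> X \<and> y \<in> X \<and> b x = b y \<and> {x, y} \<in> E}) + (\<Sum>x\<in>X. \<Sum>y\<in>X. \<xi> x y) + 2 * (\<Sum>w\<in>X. \<zeta> w)"
    unfolding W_def sum.distrib base1 base2 base3 by simp
  with main show ?thesis by (simp add: add_divide_distrib)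
qed

lemma sum_over_fibres:
  fixes f :: "nat \<Rightarrow> real"
  assumes "finite X" "\<And>x. x \<in> X \<Longrightarrow> p x < m"
  shows "(\<Sum>x\<in>X. f (p x)) = (\<Sum>P<m. real (card {x \<in> X. p x = P}) * f P)"
proof -
  have "(\<Sum>x\<in>X. f (p x)) = (\<Sum>P<m. \<Sum>x\<in>{x \<in> X. p x = P}. f (p x))"
    by (rule sum.group[symmetric]) (use assms in auto)
  also have "\<dots> = (\<Sum>P<m. real (card {x \<in> X. p x = P}) * f P)"
    by (intro sum.cong) auto
  finally show ?thesis .
qed

text \<open>Here the weights are constant on parts, which refine the blobs (\<open>\<beta> P\<close>
  is the blob containing part \<open>P\<close>), so that the ends of a flipped edge can have weights
  of their own. \<open>M P Q\<close> is the total weight of the triangles formed by \<open>u\<close>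
  and neighbours in \<open>P\<close> and \<open>Q\<close>; it is spread evenly over these
  neighbours, so only their numbers \<open>d\<close> matter. \<open>F\<close> is the part that holds
  the apexes over \<open>{v\<^sub>1, v\<^sub>2}\<close>. A colouring without a flipped edge is the
  case \<open>z = 0\<close>, with any two vertices of different blobs as \<open>v\<^sub>1\<close>
  and \<open>v\<^sub>2\<close>.\<close>

lemma nu_star_ge_part_weights:
  fixes p :: "'a \<Rightarrow> nat" and \<beta> :: "nat \<Rightarrow> nat" and w M c :: "nat \<Rightarrow> nat \<Rightarrow> real" and z :: real
  assumes fin: "finite V" and EV: "E \<subseteq> pairs V" and u: "u \<in> V" and X: "X = V - {u}"
    and pm: "\<And>x. x \<in> X \<Longrightarrow> p x < m"
    and s: "\<And>P. s P = card {x \<in> X. p x = P}"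
    and d: "\<And>P. d P = card {x \<in> X. p x = P \<and> {x, u} \<in> E}"
    and a: "\<And>i. a i = card {x \<in> X. \<beta> (p x) = i}"
    and ok_sym: "\<And>P Q. ok P Q \<Longrightarrow> ok Q P"
    and ok_ne: "\<And>P Q. ok P Q \<Longrightarrow> \<beta> P \<noteq> \<beta> Q"
    and ok_E: "\<And>x y. x \<in> X \<Longrightarrow> y \<in> X \<Longrightarrow> ok (p x) (p y) \<Longrightarrow> {x, y} \<in> E"
    and not_ok: "\<And>x y. x \<in> X \<Longrightarrow> y \<in> X \<Longrightarrow> {x, y} \<in> E \<Longrightarrow> \<beta> (p x) \<noteq> \<beta> (p y) \<Longrightarrow>
      \<not> ok (p x) (p y) \<Longrightarrow> {x, y} = {v\<^sub>1, v\<^sub>2}"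
    and w0: "\<And>i P. 0 \<le> w i P"
    and wsupp: "\<And>i P Q. w i P \<noteq> 0 \<Longrightarrow> P < m \<Longrightarrow> Q < m \<Longrightarrow> \<beta> Q = i \<Longrightarrow> ok Q P"
    and wsum: "\<And>P. P < m \<Longrightarrow> 1 \<le> (\<Sum>Q<m. real (s Q) * w (\<beta> P) Q)"
    and M0: "\<And>P Q. 0 \<le> M P Q" and Msym: "\<And>P Q. M P Q = M Q P"
    and Msupp: "\<And>P Q. M P Q \<noteq> 0 \<Longrightarrow> ok P Q"
    and Mcap: "\<And>P Q. P < m \<Longrightarrow> Q < m \<Longrightarrow> M P Q \<le> c P Q * real (d P) * real (d Q)"
    and Mdeg: "\<And>P. P < m \<Longrightarrow> (\<Sum>Q<m. M P Q) \<le> real (d P)"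
    and v: "v\<^sub>1 \<in> X" "v\<^sub>2 \<in> X" "\<beta> (p v\<^sub>1) \<noteq> \<beta> (p v\<^sub>2)"
    and z0: "0 \<le> z" and zs: "z * real (s F) \<le> 1"
    and zsupp: "z \<noteq> 0 \<Longrightarrow> ok (p v\<^sub>1) F \<and> ok (p v\<^sub>2) F \<and> {v\<^sub>1, v\<^sub>2} \<in> E \<and> \<not> ok (p v\<^sub>1) (p v\<^sub>2)"
    and c0: "\<And>P Q. 0 \<le> c P Q"
    and cap: "\<And>P Q. P < m \<Longrightarrow> Q < m \<Longrightarrow> ok P Q \<Longrightarrow>
      (real (a (\<beta> P)) - 1) * w (\<beta> P) Q + (real (a (\<beta> Q)) - 1) * w (\<beta> Q) P + c P Q
        + (if (P = p v\<^sub>1 \<or> P = p v\<^sub>2) \<and> Q = F then z else 0)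
        + (if (Q = p v\<^sub>1 \<or> Q = p v\<^sub>2) \<and> P = F then z else 0) \<le> 1"
  shows "real (card {(x, y). x \<in> X \<and> y \<in> X \<and> \<beta> (p x) = \<beta> (p y) \<and> {x, y} \<in> E}) / 2
      + (\<Sum>P<m. \<Sum>Q<m. M P Q) / 2 + z * real (s F) \<le> nu_star E"
proof -
  have finX: "finite X" and uX: "u \<notin> X" using fin X by auto
  define b where "b x = \<beta> (p x)" for x
  define S where "S i = (\<Sum>P<m. real (s P) * w i P)" for i
  \<comment> \<open>Rounded weights guarantee only a sum of at least 1. Dividing by
    \<open>S i\<close> makes it exactly 1 and, since \<open>S i\<close> is at least 1 for every
    occurring blob, raises no load.\<close>
  define \<alpha> where "\<alpha> i y = (if y \<in> X then w i (p y) / S i else 0)" for i y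
  define nb where "nb x \<longleftrightarrow> x \<in> X \<and> {x, u} \<in> E" for x
  define \<xi> where "\<xi> x y = (if nb x \<and> nb y then M (p x) (p y) / (real (d (p x)) * real (d (p y))) else 0)" for x y
  define \<zeta> where "\<zeta> y = (if y \<in> X \<and> p y = F then z else 0)" for y
  have S0: "0 \<le> S i" for i by (simp add: S_def sum_nonneg w0)
  have a0: "0 \<le> \<alpha> i y" for i y by (simp add: \<alpha>_def w0 S0)
  have \<alpha>_le: "\<alpha> (b x) y \<le> w (b x) (p y)" if "x \<in> X" for x y
  proof -
    have "1 \<le> S (b x)" using wsum[of "p x"] pm that by (simp add: S_def b_def)
    then show ?thesis using w0[of "b x" "p y"] mult_right_mono[of 1 "S (b x)" "w (b x) (p y)"]
      by (auto simp: \<alpha>_def field_simps)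
  qed
  have asupp: "y \<in> X \<and> b y \<noteq> i \<and> (\<forall>x\<in>X. b x = i \<longrightarrow> {x, y} \<in> E)" if "\<alpha> i y \<noteq> 0" for i y
  proof -
    from that have y: "y \<in> X" "w i (p y) \<noteq> 0" by (auto simp: \<alpha>_def split: if_splits)
    have *: "ok (p x) (p y)" if "x \<in> X" "b x = i" for x
      using wsupp[OF y(2) pm[OF y(1)] pm[OF that(1)]] that by (simp add: b_def)
    then show ?thesis using ok_ne[of "p y" "p y"] ok_E y by blast
  qed
  have asum: "(\<Sum>y\<in>X. \<alpha> (b x) y) = 1" if "x \<in> X" for x
  proof -
    have "(\<Sum>y\<in>X. \<alpha> (b x) y) = (\<Sum>y\<in>X. w (b x) (p y)) / S (b x)"
      by (simp add: \<alpha>_def sum_divide_distrib)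
    also have "(\<Sum>y\<in>X. w (b x) (p y)) = S (b x)"
      using sum_over_fibres[where f="w (b x)", OF finX pm] by (simp add: S_def s)
    finally show ?thesis using wsum[of "p x"] pm that by (simp add: S_def b_def)
  qed
  have x0: "0 \<le> \<xi> x y" for x y by (simp add: \<xi>_def M0)
  have xsym: "\<xi> x y = \<xi> y x" for x y by (simp add: \<xi>_def Msym mult.commute)
  have xsupp: "x \<in> X \<and> y \<in> X \<and> b x \<noteq> b y \<and> {x, y} \<in> E \<and> {x, u} \<in> E \<and> {y, u} \<in> E" if "\<xi> x y \<noteq> 0" for x y
  proof -
    from that have "nb x" "nb y" "M (p x) (p y) \<noteq> 0" by (auto simp: \<xi>_def split: if_splits)
    then show ?thesis using Msupp[of "p x" "p y"] ok_ne ok_E by (auto simp: nb_def b_def)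
  qed
  have dpos: "0 < d (p x)" if "nb x" for x
    using that finX by (auto simp: d nb_def card_gt_0_iff)
  have \<xi>_le: "\<xi> x y \<le> c (p x) (p y)" if "x \<in> X" "y \<in> X" for x y
  proof (cases "nb x \<and> nb y")
    case True
    then have "0 < real (d (p x)) * real (d (p y))" using dpos by simp
    then show ?thesis using Mcap[OF pm[OF that(1)] pm[OF that(2)]] True
      by (simp add: \<xi>_def field_simps)
  qed (auto simp: \<xi>_def c0)
  have xsum: "(\<Sum>y\<in>X. \<xi> x y) = (if nb x then (\<Sum>Q<m. M (p x) Q) / real (d (p x)) else 0)" for x
  proof (cases "nb x")
    case True
    have "(\<Sum>y\<in>X. \<xi> x y) = (\<Sum>y\<in>{y \<in> X. nb y}. M (p x) (p y) / (real (d (p x)) * real (d (p y))))"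
      unfolding \<xi>_def using True finX by (simp add: sum.inter_filter)
    also have "\<dots> = (\<Sum>Q<m. real (card {y \<in> {y \<in> X. nb y}. p y = Q}) * (M (p x) Q / (real (d (p x)) * real (d Q))))"
      by (rule sum_over_fibres) (use finX pm in auto)
    also have "\<dots> = (\<Sum>Q<m. M (p x) Q / real (d (p x)))"
    proof (rule sum.cong[OF refl])
      fix Q assume "Q \<in> {..<m}"
      moreover have "{y \<in> {y \<in> X. nb y}. p y = Q} = {y \<in> X. p y = Q \<and> {y, u} \<in> E}" by (auto simp: nb_def)
      \<comment> \<open>If \<open>u\<close> has no neighbour in part \<open>Q\<close>, the division
        by 0 gives 0, so the other side must vanish too; \<open>Mcap\<close> forces this.\<close>
      moreover have "M (p x) Q = 0" if "d Q = 0"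
        using Mcap[of "p x" Q] M0[of "p x" Q] that pm True calculation(1) by (simp add: nb_def)
      ultimately show "real (card {y \<in> {y \<in> X. nb y}. p y = Q}) * (M (p x) Q / (real (d (p x)) * real (d Q)))
          = M (p x) Q / real (d (p x))"
        by (cases "d Q = 0") (simp_all add: d[symmetric])
    qed
    finally show ?thesis using True by (simp add: sum_divide_distrib)
  qed (simp add: \<xi>_def)
  have deg: "(\<Sum>y\<in>X. \<xi> x y) \<le> 1" if "x \<in> X" "{x, u} \<in> E" for x
    using Mdeg[OF pm[OF that(1)]] dpos[of x] that by (simp add: xsum nb_def)
  have xtotal: "(\<Sum>x\<in>X. \<Sum>y\<in>X. \<xi> x y) = (\<Sum>P<m. \<Sum>Q<m. M P Q)"
  proof -
    have "(\<Sum>x\<in>X. \<Sum>y\<in>X. \<xi> x y) = (\<Sum>x\<in>{x \<in> X. nb x}. (\<Sum>Q<m. M (p x) Q) / real (d (p x)))"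
      unfolding xsum using finX by (simp add: sum.inter_filter)
    also have "\<dots> = (\<Sum>P<m. real (card {y \<in> {y \<in> X. nb y}. p y = P}) * ((\<Sum>Q<m. M P Q) / real (d P)))"
      by (rule sum_over_fibres) (use finX pm in auto)
    also have "\<dots> = (\<Sum>P<m. \<Sum>Q<m. M P Q)"
    proof (rule sum.cong[OF refl])
      fix P assume P: "P \<in> {..<m}"
      moreover have "{y \<in> {y \<in> X. nb y}. p y = P} = {y \<in> X. p y = P \<and> {y, u} \<in> E}" by (auto simp: nb_def)
      moreover have "(\<Sum>Q<m. M P Q) = 0" if "d P = 0"
        using Mdeg[of P] that P sum_nonneg[of "{..<m}" "M P"] M0 by fastforce
      ultimately show "real (card {y \<in> {y \<in> X. nb y}. p y = P}) * ((\<Sum>Q<m. M P Q) / real (d P)) = (\<Sum>Q<m. M P Q)"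
        by (cases "d P = 0") (simp_all add: d[symmetric])
    qed
    finally show ?thesis .
  qed
  have zsum: "(\<Sum>y\<in>X. \<zeta> y) = z * real (s F)"
  proof -
    have "(\<Sum>y\<in>X. \<zeta> y) = (\<Sum>y\<in>{y \<in> X. p y = F}. z)"
      unfolding \<zeta>_def sum.inter_filter[OF finX] by (intro sum.cong) auto
    then show ?thesis by (simp add: s)
  qed
  have zz0: "0 \<le> \<zeta> y" for y by (simp add: \<zeta>_def z0)
  have zzsupp: "y \<in> X \<and> b y \<noteq> b v\<^sub>1 \<and> b y \<noteq> b v\<^sub>2 \<and> {v\<^sub>1, v\<^sub>2} \<in> E \<and> {v\<^sub>1, y} \<in> E \<and> {v\<^sub>2, y} \<in> E"
    if "\<zeta> y \<noteq> 0" for y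
  proof -
    from that have y: "y \<in> X" "p y = F" and "z \<noteq> 0" by (auto simp: \<zeta>_def split: if_splits)
    then show ?thesis using zsupp ok_ne[of "p v\<^sub>1" F] ok_ne[of "p v\<^sub>2" F] ok_E[of v\<^sub>1 y] ok_E[of v\<^sub>2 y] v
      by (auto simp: b_def)
  qed
  have capx: "(real (card {x' \<in> X. b x' = b x}) - 1) * \<alpha> (b x) y + (real (card {x' \<in> X. b x' = b y}) - 1) * \<alpha> (b y) x
        + \<xi> x y + ((if x = v\<^sub>1 \<or> x = v\<^sub>2 then \<zeta> y else 0) + (if y = v\<^sub>1 \<or> y = v\<^sub>2 then \<zeta> x else 0)
      + (if {x, y} = {v\<^sub>1, v\<^sub>2} then \<Sum>w\<in>X. \<zeta> w else 0)) \<le> 1"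
    if xy: "x \<in> X" "y \<in> X" "b x \<noteq> b y" "{x, y} \<in> E" for x y
  proof (cases "ok (p x) (p y)")
    case True
    have ab: "card {x' \<in> X. b x' = i} = a i" for i by (simp add: a b_def)
    have a1: "1 \<le> real (a (b x))" if "x \<in> X" for x
    proof -
      have "0 < a (b x)" unfolding a b_def card_gt_0_iff using that finX by auto
      then show ?thesis by linarith
    qed
    have t1: "(real (a (b x)) - 1) * \<alpha> (b x) y \<le> (real (a (b x)) - 1) * w (b x) (p y)"
      "(real (a (b y)) - 1) * \<alpha> (b y) x \<le> (real (a (b y)) - 1) * w (b y) (p x)"
      using a1[OF xy(1)] a1[OF xy(2)] \<alpha>_le[OF xy(1), of y] \<alpha>_le[OF xy(2), of x]
      by (auto intro!: mult_left_mono)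
    have t2: "(if x = v\<^sub>1 \<or> x = v\<^sub>2 then \<zeta> y else 0) \<le> (if (p x = p v\<^sub>1 \<or> p x = p v\<^sub>2) \<and> p y = F then z else 0)"
      "(if y = v\<^sub>1 \<or> y = v\<^sub>2 then \<zeta> x else 0) \<le> (if (p y = p v\<^sub>1 \<or> p y = p v\<^sub>2) \<and> p x = F then z else 0)"
      using z0 by (auto simp: \<zeta>_def)
    have t3: "(if {x, y} = {v\<^sub>1, v\<^sub>2} then \<Sum>w\<in>X. \<zeta> w else 0) = 0"
      using True zsupp ok_sym by (auto simp: zsum doubleton_eq_iff)
    show ?thesis
      using cap[OF pm[OF xy(1)] pm[OF xy(2)] True, folded b_def] t1 t2 t3 \<xi>_le[OF xy(1,2)]
      unfolding ab by linarith
  next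
    case False
    \<comment> \<open>The edge can only be the flipped one. Among the three kinds of triangles just
      those based on \<open>{v\<^sub>1, v\<^sub>2}\<close> contain it, with total weight
      \<open>z * s F\<close>, which \<open>zs\<close> bounds.\<close>
    then have e: "{x, y} = {v\<^sub>1, v\<^sub>2}" using not_ok xy by (simp add: b_def)
    have "\<not> ok (p y) (p x)" using False ok_sym by blast
    then have "w (b x) (p y) = 0" "w (b y) (p x) = 0"
      using wsupp[of "b x" "p y" "p x"] wsupp[of "b y" "p x" "p y"] False pm[OF xy(1)] pm[OF xy(2)]
      unfolding b_def by blast+
    then have "\<alpha> (b x) y = 0" "\<alpha> (b y) x = 0" by (auto simp: \<alpha>_def)
    moreover have "\<xi> x y = 0" using Msupp[of "p x" "p y"] False by (auto simp: \<xi>_def)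
    moreover have "\<zeta> x = 0" "\<zeta> y = 0"
      using zzsupp[of x] zzsupp[of y] e by (metis doubleton_eq_iff)+
    ultimately show ?thesis using e zs by (auto simp: zsum)
  qed
  have "real (card {(x, y). x \<in> X \<and> y \<in> X \<and> b x = b y \<and> {x, y} \<in> E}) / 2
      + (\<Sum>x\<in>X. \<Sum>y\<in>X. \<xi> x y) / 2 + (\<Sum>w\<in>X. \<zeta> w) \<le> nu_star E"
    by (rule nu_star_ge_blob_weights[OF fin EV u X a0 asupp asum x0 xsym xsupp zz0 zzsupp v(1,2) _ capx deg])
      (use v in \<open>auto simp: b_def\<close>)
  then show ?thesis unfolding xtotal zsum b_def .
qed

section \<open>Certificates\<close>

text \<open>An entry \<open>(P, Q, c)\<close> allows weight \<open>c\<close> on each triangle formed by \<open>u\<close> and one of its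
\<open>l ! P\<close> neighbours in part \<open>P\<close> and one of its \<open>l ! Q\<close> neighbours in part \<open>Q\<close>; \<open>r\<close> is the unused
capacity of the edges between \<open>u\<close> and the parts. All weights are multiplied by a common
denominator. The chosen weight \<open>x\<close> is an argument of \<open>push\<close> so that rewriting evaluates it only once.\<close>

definition push :: "(int list \<Rightarrow> int) \<Rightarrow> nat \<Rightarrow> nat \<Rightarrow> int list \<Rightarrow> int \<Rightarrow> int" where
  "push f P Q r x = x + f (r[P := r ! P - x, Q := r ! Q - x])"

fun greedy :: "(nat \<times> nat \<times> int) list \<Rightarrow> int list \<Rightarrow> int list \<Rightarrow> int" where
  "greedy [] l r = 0"
| "greedy ((P, Q, c) # es) l r = push (greedy es l) P Q r (min (c * l ! P * l ! Q) (min (r ! P) (r ! Q)))"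

text \<open>Parts 0 to 4 are the blobs. If an edge between the blobs 0 and 1 is flipped from red to blue, its ends are
taken out of these blobs and form the parts 5 and 6.\<close>

definition blob :: "nat \<Rightarrow> nat" where
  "blob P = (if P < 5 then P else P - 5)"

text \<open>For \<open>i, j < 5\<close> this says that i - j is k or -k modulo 5. In a pentagon
  blow-up, distance 1 means red and distance 2 means blue.\<close>

definition near :: "nat \<Rightarrow> nat \<Rightarrow> nat \<Rightarrow> bool" where
  "near k i j \<longleftrightarrow> i + k = j \<or> i + k = j + 5 \<or> j + k = i \<or> j + k = i + 5"

text \<open>The condition \<open>P < 5 \<or> Q < 5\<close> takes out the pair of parts 5 and 6, that
  is, the flipped edge: it lacks the colour that its blobs prescribe. It is used only by the
  triangles that \<open>Z\<close> bounds.\<close>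

definition adj :: "nat \<Rightarrow> nat \<Rightarrow> nat \<Rightarrow> bool" where
  "adj k P Q \<longleftrightarrow> near k (blob P) (blob Q) \<and> (P < 5 \<or> Q < 5)"

text \<open>A pair may be listed several times, so that \<open>greedy\<close> returns to it after
  serving other pairs; the capacities of its entries add up.\<close>

definition capsum :: "(nat \<times> nat \<times> int) list \<Rightarrow> nat \<Rightarrow> nat \<Rightarrow> int" where
  "capsum es P Q = (\<Sum>(p, q, c)\<leftarrow>es. if p = P \<and> q = Q \<or> p = Q \<and> q = P then c else 0)"

definition bsize :: "int list \<Rightarrow> nat \<Rightarrow> int" where
  "bsize s i = (\<Sum>P\<leftarrow>[0..<length s]. if blob P = i then s ! P else 0)"

text \<open>For colour \<open>k\<close> (1 for red, 2 for blue), \<open>W ! i ! P / N\<close> is the weight of a triangle with base inside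
blob \<open>i\<close> and apex in part \<open>P\<close>, and \<open>Z / N\<close> bounds the weight of a triangle consisting of the flipped edge
and an apex in blob 3.\<close>

definition static_ok :: "nat \<Rightarrow> int list \<Rightarrow> int \<Rightarrow> int \<Rightarrow> int list list \<Rightarrow> (nat \<times> nat \<times> int) list \<Rightarrow> bool" where
  "static_ok k s N Z W es \<longleftrightarrow>
    list_all (\<lambda>i. N \<le> (\<Sum>P\<leftarrow>[0..<length s]. s ! P * W ! i ! P)) [0..<5] \<and>
    list_all (\<lambda>i. list_all (\<lambda>P. 0 \<le> W ! i ! P \<and>
      (W ! i ! P = 0 \<or> list_all (\<lambda>Q. blob Q = i \<longrightarrow> adj k Q P) [0..<length s])) [0..<length s]) [0..<5] \<and>
    list_all (\<lambda>(P, Q, c). P < length s \<and> Q < length s \<and> adj k P Q \<and> 0 \<le> c) es \<and>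
    list_all (\<lambda>P. list_all (\<lambda>Q. adj k P Q \<longrightarrow>
      (bsize s (blob P) - 1) * W ! blob P ! Q + (bsize s (blob Q) - 1) * W ! blob Q ! P + capsum es P Q
        + (if P \<ge> 5 \<and> Q = 3 \<or> Q \<ge> 5 \<and> P = 3 then Z else 0) \<le> N) [0..<length s]) [0..<length s]"

fun widest :: "int list \<Rightarrow> int list \<Rightarrow> nat \<Rightarrow> nat \<Rightarrow> int \<Rightarrow> nat" where
  "widest (x # l) (y # h) j best w = (if w < y - x then widest l h (Suc j) j (y - x) else widest l h (Suc j) best w)"
| "widest _ _ _ best _ = best"

text \<open>An upper bound for the number of wrongly coloured edges after adding \<open>u\<close> to blob \<open>i\<close>, if the
numbers of red neighbours of \<open>u\<close> in the parts lie between \<open>l\<close> and \<open>h\<close>.\<close>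

definition misfit :: "int list \<Rightarrow> int list \<Rightarrow> int list \<Rightarrow> nat \<Rightarrow> int" where
  "misfit s l h i = (\<Sum>P\<leftarrow>[0..<length s]. if blob P = i then 0 else if near 1 (blob P) i
     then s ! P - l ! P else h ! P)"

fun fits :: "int list \<Rightarrow> int list \<Rightarrow> int list \<Rightarrow> nat \<Rightarrow> int list \<Rightarrow> bool" where
  "fits s l h i [] = False"
| "fits s l h i (t # ts) = (if t < 0 then fits s l h (Suc i) ts
     else if misfit s l h i \<le> t then True else fits s l h (Suc i) ts)"

text \<open>This equals \<open>w div 2\<close> for widths from 0 to 5, which are all that occur for
  blobs of at most 5 vertices.\<close>

definition half :: "int \<Rightarrow> int" where
  "half w = (if w \<le> 1 then 0 else if w \<le> 3 then 1 else 2)"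

definition split_at :: "(int list \<Rightarrow> int list \<Rightarrow> bool) \<Rightarrow> int list \<Rightarrow> int list \<Rightarrow> nat \<Rightarrow> int \<Rightarrow> bool" where
  "split_at f l h j m = (if f l (h[j := m]) then f (l[j := m + 1]) h else False)"

definition split_box :: "(int list \<Rightarrow> int list \<Rightarrow> bool) \<Rightarrow> int list \<Rightarrow> int list \<Rightarrow> nat \<Rightarrow> bool" where
  "split_box f l h j = split_at f l h j (l ! j + half (h ! j - l ! j))"

text \<open>In the box between \<open>l\<close> and \<open>h\<close> there are at least \<open>l\<close> red and at least \<open>s - h\<close> blue
neighbours of \<open>u\<close> in the parts, so the two greedy matchings at these corners are available in the whole box.\<close>

primrec check :: "nat \<Rightarrow> int list \<Rightarrow> int list \<Rightarrow> int \<Rightarrow> int \<Rightarrow> (nat \<times> nat \<times> int) list \<Rightarrow> (nat \<times> nat \<times> int) list \<Rightarrow>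
   int list \<Rightarrow> int list \<Rightarrow> bool" where
  "check 0 s ts N T es1 es2 l h = False"
| "check (Suc n) s ts N T es1 es2 l h =
    (if T < greedy es1 l (map (\<lambda>x. N * x) l) + greedy es2 (map2 (-) s h) (map2 (\<lambda>x y. N * (x - y)) s h) then True
     else if fits s l h 0 ts then True
     else split_box (check n s ts N T es1 es2) l h (widest l h 0 0 0))"

section \<open>Soundness of the greedy matching and of the box search\<close>

lemma sum_delta_pair:
  fixes A P Q n :: nat
  assumes "P \<noteq> Q" "P < n" "Q < n"
  shows "(\<Sum>B<n. if A = P \<and> B = Q \<or> A = Q \<and> B = P then x else 0) = (if A = P \<or> A = Q then x else (0::int))"
proof (cases "A = P \<or> A = Q")
  case True
  then obtain C where C: "C < n" "\<And>B. (A = P \<and> B = Q \<or> A = Q \<and> B = P) \<longleftrightarrow> B = C"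
    using assms by metis
  have "(\<Sum>B<n. if B = C then x else 0) = x" using C(1) by simp
  then show ?thesis unfolding C(2) using True by simp
qed simp

text \<open>Induction along the list: the pair at the head receives the amount that
  \<open>push\<close> subtracts at both of its ends, and the reduced capacities bound the matching
  built from the tail. \<open>M\<close> counts ordered pairs of parts, hence the factor 2.\<close>

lemma greedy_matching:
  assumes "\<forall>(P, Q, c)\<in>set es. P < n \<and> Q < n \<and> P \<noteq> Q \<and> 0 \<le> c"
    and "length l = n" "length r = n" "\<forall>i<n. 0 \<le> l ! i" "\<forall>i<n. 0 \<le> r ! i"
  shows "\<exists>M. (\<forall>P Q. 0 \<le> M P Q \<and> M P Q = M Q P \<and> (M P Q \<noteq> 0 \<longrightarrow> (\<exists>c. (P, Q, c) \<in> set es \<or> (Q, P, c) \<in> set es))) \<and>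
    (\<forall>P<n. \<forall>Q<n. M P Q \<le> capsum es P Q * l ! P * l ! Q) \<and>
    (\<forall>P<n. (\<Sum>Q<n. M P Q) \<le> r ! P) \<and> (\<Sum>P<n. \<Sum>Q<n. M P Q) = 2 * greedy es l r"
  using assms
proof (induction es arbitrary: r)
  case Nil
  then show ?case by (intro exI[of _ "\<lambda>_ _. 0"]) (auto simp: capsum_def)
next
  case (Cons e es)
  obtain P Q c where e: "e = (P, Q, c)" by (cases e)
  define x where "x = min (c * l ! P * l ! Q) (min (r ! P) (r ! Q))"
  define r' where "r' = r[P := r ! P - x, Q := r ! Q - x]"
  from Cons.prems have PQ: "P < n" "Q < n" "P \<noteq> Q" "0 \<le> c" by (auto simp: e)
  have x: "0 \<le> x" "x \<le> c * l ! P * l ! Q" "x \<le> r ! P" "x \<le> r ! Q"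
    using PQ Cons.prems by (auto simp: x_def)
  have r'A: "r' ! A = r ! A - (if A = P \<or> A = Q then x else 0)" if "A < n" for A
    using that PQ Cons.prems by (auto simp: r'_def nth_list_update)
  have "length r' = n" "\<forall>i<n. 0 \<le> r' ! i" using Cons.prems x r'A by (auto simp: r'_def)
  with Cons.IH[of r'] Cons.prems obtain M where M:
    "\<forall>P Q. 0 \<le> M P Q \<and> M P Q = M Q P \<and> (M P Q \<noteq> 0 \<longrightarrow> (\<exists>c. (P, Q, c) \<in> set es \<or> (Q, P, c) \<in> set es))"
    "\<forall>P<n. \<forall>Q<n. M P Q \<le> capsum es P Q * l ! P * l ! Q"
    "\<forall>P<n. (\<Sum>Q<n. M P Q) \<le> r' ! P" "(\<Sum>P<n. \<Sum>Q<n. M P Q) = 2 * greedy es l r'"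
    by auto
  define D where "D A B = (if A = P \<and> B = Q \<or> A = Q \<and> B = P then x else 0)" for A B
  have Dsum: "(\<Sum>B<n. D A B) = (if A = P \<or> A = Q then x else 0)" for A
    unfolding D_def using sum_delta_pair[OF PQ(3,1,2)] .
  have Dtot: "(\<Sum>A<n. \<Sum>B<n. D A B) = 2 * x"
  proof -
    have "(\<Sum>A<n. \<Sum>B<n. D A B) = (\<Sum>A\<in>{A \<in> {..<n}. A = P \<or> A = Q}. x)"
      unfolding Dsum by (rule sum.inter_filter[symmetric]) simp
    also have "{A \<in> {..<n}. A = P \<or> A = Q} = {P, Q}" using PQ by auto
    finally show ?thesis using PQ by simp
  qed
  have csum: "capsum (e # es) A B = capsum es A B + (if A = P \<and> B = Q \<or> A = Q \<and> B = P then c else 0)" for A B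
    by (auto simp: capsum_def e)
  show ?case
  proof (intro exI[of _ "\<lambda>A B. M A B + D A B"] conjI allI impI)
    fix A B
    show "0 \<le> M A B + D A B" using M(1) x by (simp add: D_def)
    show "M A B + D A B = M B A + D B A" using M(1) by (auto simp: D_def)
    show "\<exists>c. (A, B, c) \<in> set (e # es) \<or> (B, A, c) \<in> set (e # es)" if "M A B + D A B \<noteq> 0"
    proof (cases "M A B = 0")
      case True
      then have "D A B \<noteq> 0" using that by simp
      then show ?thesis by (auto simp: D_def e split: if_splits)
    next
      case False
      then show ?thesis using M(1) by auto
    qed
  next
    fix A B assume AB: "A < n" "B < n"
    have "D A B \<le> (if A = P \<and> B = Q \<or> A = Q \<and> B = P then c else 0) * l ! A * l ! B"
      using x by (auto simp: D_def mult_ac)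
    moreover have "M A B \<le> capsum es A B * l ! A * l ! B" using M(2) AB by blast
    ultimately show "M A B + D A B \<le> capsum (e # es) A B * l ! A * l ! B"
      unfolding csum distrib_right by linarith
  next
    fix A assume "A < n"
    then show "(\<Sum>B<n. M A B + D A B) \<le> r ! A"
      using M(3) r'A by (fastforce simp: sum.distrib Dsum)
  next
    have "greedy (e # es) l r = x + greedy es l r'"
      by (simp add: e push_def x_def r'_def)
    then show "(\<Sum>A<n. \<Sum>B<n. M A B + D A B) = 2 * greedy (e # es) l r"
      using M(4) by (simp add: sum.distrib Dtot)
  qed
qed

lemma fits_sound:
  assumes "fits s l h i ts"
  shows "\<exists>j<length ts. misfit s l h (i + j) \<le> ts ! j \<and> 0 \<le> ts ! j"
  using assms
proof (induction ts arbitrary: i)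
  case (Cons t ts)
  show ?case
  proof (cases "0 \<le> t \<and> misfit s l h i \<le> t")
    case True
    then show ?thesis by (intro exI[of _ 0]) auto
  next
    case False
    then have "fits s l h (Suc i) ts" using Cons.prems by (auto split: if_splits)
    from Cons.IH[OF this] obtain j where "j < length ts" "misfit s l h (Suc i + j) \<le> ts ! j" "0 \<le> ts ! j" by auto
    then show ?thesis by (intro exI[of _ "Suc j"]) auto
  qed
qed simp

lemma misfit_mono:
  assumes "\<forall>j<length s. l ! j \<le> d ! j \<and> d ! j \<le> h ! j"
  shows "misfit s d d i \<le> misfit s l h i"
  unfolding misfit_def by (rule sum_list_mono) (use assms in auto)

definition in_box :: "int list \<Rightarrow> int list \<Rightarrow> int list \<Rightarrow> int list \<Rightarrow> bool" where
  "in_box s l h d \<longleftrightarrow> length l = length s \<and> length h = length s \<and>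
     (\<forall>j<length s. 0 \<le> l ! j \<and> l ! j \<le> d ! j \<and> d ! j \<le> h ! j \<and> h ! j \<le> s ! j)"

text \<open>Since \<open>d\<close> is integral, cutting at \<open>m\<close> leaves it in one of the
  two halves, so following \<open>d\<close> leads to a box in which a test succeeded. A fit of the
  box is inherited by \<open>d\<close> through \<open>misfit_mono\<close>. For the greedy test the
  box is returned, because the matchings are computed at its corners and not at
  \<open>d\<close>.\<close>

lemma check_sound:
  assumes "check n s ts N T es1 es2 l h" "in_box s l h d"
  shows "(\<exists>i<length ts. misfit s d d i \<le> ts ! i) \<or>
    (\<exists>l h. in_box s l h d \<and>
      T < greedy es1 l (map (\<lambda>x. N * x) l) + greedy es2 (map2 (-) s h) (map2 (\<lambda>x y. N * (x - y)) s h))"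
  using assms
proof (induction n arbitrary: l h)
  case (Suc n)
  consider "T < greedy es1 l (map (\<lambda>x. N * x) l) + greedy es2 (map2 (-) s h) (map2 (\<lambda>x y. N * (x - y)) s h)"
    | "fits s l h 0 ts"
    | "split_box (check n s ts N T es1 es2) l h (widest l h 0 0 0)"
    using Suc.prems(1) by (auto split: if_splits)
  then show ?case
  proof cases
    case 1
    then show ?thesis using Suc.prems by blast
  next
    case 2
    from fits_sound[OF this] obtain j where "j < length ts" "misfit s l h j \<le> ts ! j" by auto
    moreover have "misfit s d d j \<le> misfit s l h j"
      using Suc.prems(2) by (intro misfit_mono) (auto simp: in_box_def)
    ultimately show ?thesis by (intro disjI1 exI[of _ j]) auto
  next
    case 3
    define j where "j = widest l h 0 0 0"
    define m where "m = l ! j + half (h ! j - l ! j)"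
    have c: "check n s ts N T es1 es2 l (h[j := m])" "check n s ts N T es1 es2 (l[j := m + 1]) h"
      using 3 by (auto simp: split_box_def split_at_def j_def m_def split: if_splits)
    have box: "in_box s l (h[j := m]) d \<or> in_box s (l[j := m + 1]) h d"
    proof (cases "j < length s")
      case True
      then have "0 \<le> l ! j" "l ! j \<le> d ! j" "d ! j \<le> h ! j" "h ! j \<le> s ! j"
        using Suc.prems(2) by (auto simp: in_box_def)
      moreover from this have "0 \<le> m + 1" "d ! j \<le> m \<Longrightarrow> m \<le> s ! j" by (auto simp: m_def half_def)
      ultimately show ?thesis using Suc.prems(2) True
        by (cases "d ! j \<le> m") (auto simp: in_box_def nth_list_update)
    next
      \<comment> \<open>Out of range both list updates are void, so the bisection is sound for every
        index that \<open>widest\<close> may return.\<close>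
      case False
      then show ?thesis using Suc.prems(2) by (auto simp: in_box_def)
    qed
    then show ?thesis using Suc.IH c by blast
  qed
qed simp

section \<open>From certificates to packings\<close>

lemma near_sym: "near k i j \<longleftrightarrow> near k j i"
  by (auto simp: near_def)

lemma adj_sym: "adj k P Q \<longleftrightarrow> adj k Q P"
  by (auto simp: adj_def near_sym)

lemma adj_blob_neq: "adj k P Q \<Longrightarrow> k \<noteq> 0 \<Longrightarrow> k \<noteq> 5 \<Longrightarrow> blob P \<noteq> blob Q"
  by (auto simp: adj_def near_def)

lemma bsize_eq_card:
  assumes "finite X" "\<And>x. x \<in> X \<Longrightarrow> p x < length s"
    and "\<And>P. P < length s \<Longrightarrow> s ! P = int (card {x \<in> X. p x = P})"
  shows "bsize s i = int (card {x \<in> X. blob (p x) = i})"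
proof -
  have "real (card {x \<in> X. blob (p x) = i}) = (\<Sum>x\<in>X. if blob (p x) = i then 1 else 0)"
    using assms(1) by (simp add: sum.If_cases Int_def)
  also have "\<dots> = (\<Sum>P<length s. real (card {x \<in> X. p x = P}) * (if blob P = i then 1 else 0))"
    by (rule sum_over_fibres[where f="\<lambda>P. if blob P = i then 1 else 0"]) (use assms in auto)
  also have "\<dots> = real_of_int (\<Sum>P<length s. if blob P = i then s ! P else 0)"
    unfolding of_int_sum by (intro sum.cong) (auto simp: assms(3))
  also have "(\<Sum>P<length s. if blob P = i then s ! P else 0) = bsize s i"
    by (simp add: bsize_def interv_sum_list_conv_sum_set_nat lessThan_atLeast0)
  finally show ?thesis by linarith
qed

lemma of_int_divide_le_one: "a \<le> N \<Longrightarrow> 0 < N \<Longrightarrow> real_of_int a / real_of_int N \<le> 1"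
  and one_le_of_int_divide: "N \<le> a \<Longrightarrow> 0 < N \<Longrightarrow> 1 \<le> real_of_int a / real_of_int N"
  by simp_all

text \<open>The integer data are divided by \<open>N\<close>. It is enough that \<open>l\<close> is
  a lower bound for the numbers of neighbours: the matching computed from \<open>l\<close> respects
  \<open>capsum es P Q * l ! P * l ! Q\<close> and \<open>N * l ! P\<close>, and both limits only
  grow when \<open>l\<close> is replaced by the true numbers.\<close>

lemma nu_star_ge_greedy:
  fixes p :: "'a \<Rightarrow> nat"
  assumes fin: "finite V" and EV: "E \<subseteq> pairs V" and u: "u \<in> V" and X: "X = V - {u}"
    and pm: "\<And>x. x \<in> X \<Longrightarrow> p x < length s"
    and s: "\<And>P. P < length s \<Longrightarrow> s ! P = int (card {x \<in> X. p x = P})"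
    and len: "5 \<le> length s" "length s \<le> 7" and k: "k = 1 \<or> k = 2"
    and static: "static_ok k s N Z W es" and N: "0 < N"
    and ok_E: "\<And>x y. x \<in> X \<Longrightarrow> y \<in> X \<Longrightarrow> adj k (p x) (p y) \<Longrightarrow> {x, y} \<in> E"
    and not_ok: "\<And>x y. x \<in> X \<Longrightarrow> y \<in> X \<Longrightarrow> {x, y} \<in> E \<Longrightarrow> blob (p x) \<noteq> blob (p y) \<Longrightarrow>
      \<not> adj k (p x) (p y) \<Longrightarrow> {x, y} = {v\<^sub>1, v\<^sub>2}"
    and v: "v\<^sub>1 \<in> X" "v\<^sub>2 \<in> X" "blob (p v\<^sub>1) \<noteq> blob (p v\<^sub>2)"
    and z: "0 \<le> z" "z * real_of_int (s ! 3) \<le> 1" "z * real_of_int N \<le> real_of_int Z"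
    and zsupp: "z \<noteq> 0 \<Longrightarrow> 5 \<le> p v\<^sub>1 \<and> 5 \<le> p v\<^sub>2 \<and> adj k (p v\<^sub>1) 3 \<and> adj k (p v\<^sub>2) 3 \<and> {v\<^sub>1, v\<^sub>2} \<in> E"
    and l: "length l = length s"
      "\<And>P. P < length s \<Longrightarrow> 0 \<le> l ! P \<and> l ! P \<le> int (card {x \<in> X. p x = P \<and> {x, u} \<in> E})"
  shows "real (card {(x, y). x \<in> X \<and> y \<in> X \<and> blob (p x) = blob (p y) \<and> {x, y} \<in> E}) / 2
      + real_of_int (greedy es l (map (\<lambda>x. N * x) l)) / real_of_int N + z * real_of_int (s ! 3) \<le> nu_star E"
proof -
  define m where "m = length s"
  define d where "d P = card {x \<in> X. p x = P \<and> {x, u} \<in> E}" for P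
  define a where "a i = card {x \<in> X. blob (p x) = i}" for i
  \<comment> \<open>Outside the table \<open>W ! i ! P\<close> is unspecified; the value 0 there
    keeps the weights nonnegative for all arguments.\<close>
  define w where "w i P = (if i < 5 \<and> P < m then real_of_int (W ! i ! P) / N else 0)" for i P
  define c where "c P Q = real_of_int (capsum es P Q) / N" for P Q
  have finX: "finite X" using fin X by simp
  have k05: "k \<noteq> 0" "k \<noteq> 5" using k by auto
  have blob5: "blob P < 5" if "P < m" for P using that len by (auto simp: blob_def m_def)
  have bs: "bsize s i = int (a i)" for i unfolding a_def by (rule bsize_eq_card[OF finX pm s])
  have st1: "N \<le> (\<Sum>P<m. s ! P * W ! i ! P)" if "i < 5" for i
    using static that unfolding static_ok_def list_all_iff m_def
    by (simp add: interv_sum_list_conv_sum_set_nat lessThan_atLeast0)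
  have st2': "\<forall>i<5. \<forall>P<m. 0 \<le> W ! i ! P \<and> (W ! i ! P = 0 \<or> (\<forall>Q<m. blob Q = i \<longrightarrow> adj k Q P))"
    using static unfolding static_ok_def list_all_iff set_upt Ball_def atLeastLessThan_iff m_def by simp
  have st2: "0 \<le> W ! i ! P" "W ! i ! P \<noteq> 0 \<Longrightarrow> Q < m \<Longrightarrow> blob Q = i \<Longrightarrow> adj k Q P" if "i < 5" "P < m" for i P Q
    using st2' that by blast+
  have st3: "P < m \<and> Q < m \<and> adj k P Q \<and> 0 \<le> e" if "(P, Q, e) \<in> set es" for P Q e
    using static that unfolding static_ok_def list_all_iff m_def by auto
  have st4: "(bsize s (blob P) - 1) * W ! blob P ! Q + (bsize s (blob Q) - 1) * W ! blob Q ! P + capsum es P Q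
        + (if P \<ge> 5 \<and> Q = 3 \<or> Q \<ge> 5 \<and> P = 3 then Z else 0) \<le> N" if "P < m" "Q < m" "adj k P Q" for P Q
    using static that unfolding static_ok_def list_all_iff m_def by auto
  have l0: "\<forall>i<m. 0 \<le> l ! i" using l by (simp add: m_def)
  have "\<forall>(P, Q, c)\<in>set es. P < m \<and> Q < m \<and> P \<noteq> Q \<and> 0 \<le> c"
    using st3 adj_blob_neq[OF _ k05] by fastforce
  moreover have "\<forall>i<m. 0 \<le> map (\<lambda>x. N * x) l ! i" using l0 l N by (simp add: m_def)
  ultimately obtain M where M':
    "\<forall>P Q. 0 \<le> M P Q \<and> M P Q = M Q P \<and> (M P Q \<noteq> 0 \<longrightarrow> (\<exists>c. (P, Q, c) \<in> set es \<or> (Q, P, c) \<in> set es))"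
    "\<forall>P<m. \<forall>Q<m. M P Q \<le> capsum es P Q * l ! P * l ! Q"
    "\<forall>P<m. (\<Sum>Q<m. M P Q) \<le> map (\<lambda>x. N * x) l ! P"
    "(\<Sum>P<m. \<Sum>Q<m. M P Q) = 2 * greedy es l (map (\<lambda>x. N * x) l)"
    using greedy_matching[of es m l "map (\<lambda>x. N * x) l"] l(1) l0 unfolding m_def length_map by blast
  have M: "\<And>P Q. 0 \<le> M P Q" "\<And>P Q. M P Q = M Q P"
    "\<And>P Q. M P Q \<noteq> 0 \<Longrightarrow> \<exists>c. (P, Q, c) \<in> set es \<or> (Q, P, c) \<in> set es"
    "\<And>P Q. P < m \<Longrightarrow> Q < m \<Longrightarrow> M P Q \<le> capsum es P Q * l ! P * l ! Q"
    "\<And>P. P < m \<Longrightarrow> (\<Sum>Q<m. M P Q) \<le> map (\<lambda>x. N * x) l ! P"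
    "(\<Sum>P<m. \<Sum>Q<m. M P Q) = 2 * greedy es l (map (\<lambda>x. N * x) l)"
    using M' by blast+
  have cap0: "0 \<le> capsum es P Q" for P Q
    unfolding capsum_def by (rule sum_list_nonneg) (use st3 in auto)
  have ld: "real_of_int (l ! P) \<le> real (d P)" "0 \<le> real_of_int (l ! P)" if "P < m" for P
    using l(2)[of P] that unfolding d_def m_def by linarith+
  have "real (card {(x, y). x \<in> X \<and> y \<in> X \<and> blob (p x) = blob (p y) \<and> {x, y} \<in> E}) / 2
      + (\<Sum>P<m. \<Sum>Q<m. real_of_int (M P Q) / N) / 2 + z * real (card {x \<in> X. p x = 3}) \<le> nu_star E"
  proof (rule nu_star_ge_part_weights[where ok="adj k" and w=w and c=c and d=d and a=a
        and s="\<lambda>P. card {x \<in> X. p x = P}" and m=m and p=p and \<beta>=blob and F=3 and z=z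
        and M="\<lambda>P Q. real_of_int (M P Q) / real_of_int N" and v\<^sub>1=v\<^sub>1 and v\<^sub>2=v\<^sub>2, OF fin EV u X])
    show "p x < m" if "x \<in> X" for x using pm that by (simp add: m_def)
    show "adj k Q P" if "adj k P Q" for P Q using that adj_sym by blast
    show "blob P \<noteq> blob Q" if "adj k P Q" for P Q using adj_blob_neq[OF that k05] .
    show "0 \<le> w i P" for i P using st2(1) N by (simp add: w_def)
    show "adj k Q P" if "w i P \<noteq> 0" "P < m" "Q < m" "blob Q = i" for i P Q
      using that st2(2)[of i P Q] by (auto simp: w_def split: if_splits)
    show "1 \<le> (\<Sum>Q<m. real (card {x \<in> X. p x = Q}) * w (blob P) Q)" if "P < m" for P
    proof -
      have "(\<Sum>Q<m. real (card {x \<in> X. p x = Q}) * w (blob P) Q)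
          = real_of_int (\<Sum>Q<m. s ! Q * W ! blob P ! Q) / N"
        unfolding of_int_sum sum_divide_distrib
        by (intro sum.cong) (auto simp: w_def blob5[OF that] s m_def)
      then show ?thesis using one_le_of_int_divide[OF st1[OF blob5[OF that]] N] by simp
    qed
    show "0 \<le> real_of_int (M P Q) / N" "real_of_int (M P Q) / N = real_of_int (M Q P) / N" for P Q
      using M(1,2) N by auto
    show "adj k P Q" if "real_of_int (M P Q) / N \<noteq> 0" for P Q
    proof -
      from that have "M P Q \<noteq> 0" by auto
      then show ?thesis using M(3) st3 adj_sym by blast
    qed
    show "real_of_int (M P Q) / N \<le> c P Q * real (d P) * real (d Q)" if PQ: "P < m" "Q < m" for P Q
    proof -
      have "real_of_int (M P Q) \<le> real_of_int (capsum es P Q * l ! P * l ! Q)"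
        using M(4)[OF PQ] of_int_le_iff by blast
      also have "\<dots> = real_of_int (capsum es P Q) * (real_of_int (l ! P) * real_of_int (l ! Q))" by simp
      also have "\<dots> \<le> real_of_int (capsum es P Q) * (real (d P) * real (d Q))"
        by (intro mult_left_mono mult_mono ld PQ) (use cap0 ld PQ in auto)
      finally show ?thesis using N by (simp add: c_def divide_right_mono mult.assoc)
    qed
    show "(\<Sum>Q<m. real_of_int (M P Q) / N) \<le> real (d P)" if "P < m" for P
    proof -
      have "(\<Sum>Q<m. real_of_int (M P Q)) = real_of_int (\<Sum>Q<m. M P Q)" by simp
      also have "\<dots> \<le> real_of_int (N * l ! P)"
        using M(5)[OF that] that l unfolding of_int_le_iff by (simp add: m_def)
      finally have "(\<Sum>Q<m. real_of_int (M P Q)) / N \<le> real_of_int (l ! P)" using N by (simp add: field_simps)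
      then show ?thesis using ld[OF that] by (simp add: sum_divide_distrib)
    qed
    show "0 \<le> c P Q" for P Q using cap0 N by (simp add: c_def)
    show "z * real (card {x \<in> X. p x = 3}) \<le> 1" using z(2) s[of 3] len by simp
    show "adj k (p v\<^sub>1) 3 \<and> adj k (p v\<^sub>2) 3 \<and> {v\<^sub>1, v\<^sub>2} \<in> E \<and> \<not> adj k (p v\<^sub>1) (p v\<^sub>2)" if "z \<noteq> 0"
      using zsupp[OF that] by (auto simp: adj_def)
    show "(real (a (blob P)) - 1) * w (blob P) Q + (real (a (blob Q)) - 1) * w (blob Q) P + c P Q +
        (if (P = p v\<^sub>1 \<or> P = p v\<^sub>2) \<and> Q = 3 then z else 0) +
        (if (Q = p v\<^sub>1 \<or> Q = p v\<^sub>2) \<and> P = 3 then z else 0) \<le> 1" if PQ: "P < m" "Q < m" "adj k P Q" for P Q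
    proof -
      let ?Z = "if P \<ge> 5 \<and> Q = 3 \<or> Q \<ge> 5 \<and> P = 3 then Z else 0"
      have "0 \<le> real_of_int Z" using z(1,3) N mult_nonneg_nonneg[of z "real_of_int N"] by linarith
      then have Z0: "0 \<le> Z" by simp
      have zz: "z \<le> real_of_int Z / N" using z(3) N by (simp add: field_simps)
      have "(if (P = p v\<^sub>1 \<or> P = p v\<^sub>2) \<and> Q = 3 then z else 0) + (if (Q = p v\<^sub>1 \<or> Q = p v\<^sub>2) \<and> P = 3 then z else 0)
          \<le> real_of_int ?Z / N" (is "?lhs \<le> _")
      proof (cases "z = 0")
        case True
        then show ?thesis using Z0 N by simp
      next
        case False
        then show ?thesis using zsupp zz Z0 N by auto
      qed
      moreover have "(real (a (blob P)) - 1) * w (blob P) Q + (real (a (blob Q)) - 1) * w (blob Q) P + c P Q + real_of_int ?Z / N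
          = real_of_int ((bsize s (blob P) - 1) * W ! blob P ! Q + (bsize s (blob Q) - 1) * W ! blob Q ! P + capsum es P Q + ?Z) / N"
        unfolding bs w_def c_def using blob5 PQ by (simp add: add_divide_distrib)
      moreover have "\<dots> \<le> 1" by (rule of_int_divide_le_one[OF st4[OF PQ] N])
      ultimately show ?thesis by linarith
    qed
  qed (use ok_E not_ok v z d_def a_def in auto)
  moreover have "(\<Sum>P<m. \<Sum>Q<m. real_of_int (M P Q) / N) = 2 * (real_of_int (greedy es l (map (\<lambda>x. N * x) l)) / N)"
  proof -
    have "(\<Sum>P<m. \<Sum>Q<m. real_of_int (M P Q) / N) = real_of_int (\<Sum>P<m. \<Sum>Q<m. M P Q) / N"
      by (simp add: sum_divide_distrib)
    then show ?thesis unfolding M(6) by simp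
  qed
  ultimately show ?thesis using s[of 3] len by simp
qed

text \<open>The number of wrongly coloured edges for which adding \<open>u\<close> to blob \<open>i\<close> leads to a member of the
family, or \<open>-1\<close>.\<close>

definition tolerance :: "int list \<Rightarrow> nat \<Rightarrow> int" where
  "tolerance s i = (let b = sort (map (\<lambda>j. nat (bsize s j) + (if j = i then 1 else 0)) [0..<5]) in
     if b \<in> B2 then (if length s = 5 then 1 else 0) else if length s = 5 \<and> b \<in> B1 then 0 else -1)"

text \<open>Let n be \<open>sum_list s + 1\<close>, I the number of ordered pairs inside blobs, f =
  1 if an edge is flipped and f = 0 otherwise, and g the greedy total. The packings have total
  weight I/2 + g/N + f, and n(n-1)/4 < 3(I/2 + g/N + f), multiplied by 4N, reads N(n(n-1) - 6I -
  12f) < 12g. The inequality for \<open>T\<close> guarantees this once g exceeds \<open>T\<close>;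
  the certificates use the least such \<open>T\<close>. \<open>N \<le> Z * s ! 3\<close> lets the
  flipped edge be filled evenly from blob 3. Depth 50 is ample: each cut of a side of positive
  length lowers the total width, which is at most 25 at the start.\<close>

definition cert_ok :: "int list \<Rightarrow> int \<Rightarrow> int \<Rightarrow> int \<Rightarrow> int list list \<Rightarrow> int list list \<Rightarrow>
   (nat \<times> nat \<times> int) list \<Rightarrow> (nat \<times> nat \<times> int) list \<Rightarrow> bool" where
  "cert_ok s N Z T W1 W2 es1 es2 \<longleftrightarrow>
     (length s = 5 \<or> length s = 7 \<and> s ! 5 = 1 \<and> s ! 6 = 1) \<and> 0 < N \<and> 0 < s ! 3 \<and> N \<le> Z * s ! 3 \<and>
     N * ((sum_list s + 1) * sum_list s - 6 * (\<Sum>i\<leftarrow>[0..<5]. bsize s i * (bsize s i - 1)) -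
       (if length s = 5 then 0 else 12)) < 12 * (T + 1) \<and>
     static_ok 1 s N Z W1 es1 \<and> static_ok 2 s N Z W2 es2 \<and>
     check 50 s (map (tolerance s) [0..<5]) N T es1 es2 (map (\<lambda>_. 0) s) s"

text \<open>\<open>F\<close> is the set of flipped edges.\<close>

definition config :: "'a set \<Rightarrow> 'a set set \<Rightarrow> 'a set set \<Rightarrow> 'a \<Rightarrow> (nat \<Rightarrow> 'a set) \<Rightarrow> 'a set set \<Rightarrow> bool" where
  "config V E1 E2 u A F \<longleftrightarrow> finite V \<and> u \<in> V \<and> E1 \<inter> E2 = {} \<and> E1 \<union> E2 = pairs V \<and>
     (\<Union>i<5. A i) = V - {u} \<and> (\<forall>i<5. \<forall>j<5. i \<noteq> j \<longrightarrow> A i \<inter> A j = {}) \<and>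
     (\<forall>i<5. \<forall>j<5. \<forall>x\<in>A i. \<forall>y\<in>A j.
       (near 1 i j \<longrightarrow> {x, y} \<in> (if {x, y} \<in> F then E2 else E1)) \<and>
       (near 2 i j \<longrightarrow> {x, y} \<in> (if {x, y} \<in> F then E1 else E2)))"

definition misfits :: "'a set set \<Rightarrow> 'a set set \<Rightarrow> 'a \<Rightarrow> (nat \<Rightarrow> 'a set) \<Rightarrow> nat \<Rightarrow> 'a set" where
  "misfits E1 E2 u A i = {x. \<exists>j<5. x \<in> A j \<and> (near 1 i j \<and> {x, u} \<in> E2 \<or> near 2 i j \<and> {x, u} \<in> E1)}"

definition grown :: "(nat \<Rightarrow> 'a set) \<Rightarrow> nat \<Rightarrow> nat multiset" where
  "grown A i = image_mset (\<lambda>j. card (A j) + (if j = i then 1 else 0)) (mset_set {0..<5})"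

text \<open>Membership in the family allows a single flip. If \<open>H\<close> has already used it
  (\<open>fl\<close>), every edge from \<open>u\<close> to the other blobs must be right; otherwise
  one wrong edge at \<open>u\<close> can serve as the flip, provided the new sizes are in
  \<open>B2\<close>.\<close>

definition absorbs :: "'a set set \<Rightarrow> 'a set set \<Rightarrow> 'a \<Rightarrow> (nat \<Rightarrow> 'a set) \<Rightarrow> bool \<Rightarrow> nat \<Rightarrow> bool" where
  "absorbs E1 E2 u A fl i \<longleftrightarrow>
     misfits E1 E2 u A i = {} \<and> grown A i \<in> mset ` (if fl then B2 else B1) \<or>
     \<not> fl \<and> card (misfits E1 E2 u A i) \<le> 1 \<and> grown A i \<in> mset ` B2"

definition large_pack :: "'a set \<Rightarrow> 'a set set \<Rightarrow> 'a set set \<Rightarrow> bool" where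
  "large_pack V E1 E2 \<longleftrightarrow> real (card V) * (real (card V) - 1) / 4 < 3 * (nu_star E1 + nu_star E2)"

lemma near_cases: "i < 5 \<Longrightarrow> j < 5 \<Longrightarrow> i \<noteq> j \<Longrightarrow> near 1 i j \<or> near 2 i j"
  unfolding near_def by presburger

lemma near_1_2: "i < 5 \<Longrightarrow> j < 5 \<Longrightarrow> near 1 i j \<Longrightarrow> \<not> near 2 i j"
  unfolding near_def by presburger

lemma B2_subset_B1: "B2 \<subseteq> B1"
  by (auto simp: B1_def B2_def)

lemma card_same_blob_pairs:
  fixes b :: "'a \<Rightarrow> nat"
  assumes fin: "finite X" and b: "\<And>x. x \<in> X \<Longrightarrow> b x < m"
  shows "real (card {(x, y). x \<in> X \<and> y \<in> X \<and> b x = b y \<and> x \<noteq> y})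
    = (\<Sum>i<m. real (card {x \<in> X. b x = i}) * (real (card {x \<in> X. b x = i}) - 1))"
proof -
  have "{(x, y). x \<in> X \<and> y \<in> X \<and> b x = b y \<and> x \<noteq> y} = (SIGMA x:X. {y \<in> X. b y = b x} - {x})"
    by auto
  then have "card {(x, y). x \<in> X \<and> y \<in> X \<and> b x = b y \<and> x \<noteq> y} = (\<Sum>x\<in>X. card ({y \<in> X. b y = b x} - {x}))"
    using fin by (simp add: card_SigmaI)
  then have "real (card {(x, y). x \<in> X \<and> y \<in> X \<and> b x = b y \<and> x \<noteq> y})
      = (\<Sum>x\<in>X. real (card ({y \<in> X. b y = b x} - {x})))"
    by simp
  also have "\<dots> = (\<Sum>x\<in>X. real (card {y \<in> X. b y = b x}) - 1)"
  proof (rule sum.cong[OF refl])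
    fix x assume x: "x \<in> X"
    then have "0 < card {y \<in> X. b y = b x}" using fin by (auto simp: card_gt_0_iff)
    then show "real (card ({y \<in> X. b y = b x} - {x})) = real (card {y \<in> X. b y = b x}) - 1"
      using x fin by (simp add: card_Diff_singleton)
  qed
  also have "\<dots> = (\<Sum>i<m. real (card {x \<in> X. b x = i}) * (real (card {x \<in> X. b x = i}) - 1))"
    by (rule sum_over_fibres[where f="\<lambda>i. real (card {y \<in> X. b y = i}) - 1"]) (use fin b in auto)
  finally show ?thesis .
qed

text \<open>The vector \<open>ds\<close> of red degrees of \<open>u\<close> into the parts lies in
  the box from 0 to \<open>s\<close>, so \<open>check_sound\<close> applies: a fit becomes
  \<open>absorbs\<close>, a large greedy total becomes \<open>large_pack\<close>. If
  \<open>F\<close> is empty, \<open>v\<^sub>1\<close> and \<open>v\<^sub>2\<close> are arbitrary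
  vertices of blobs 0 and 1.\<close>

lemma cert_sound:
  assumes cert: "cert_ok s N Z T W1 W2 es1 es2"
    and conf: "config V E1 E2 u A F"
    and F: "F = {} \<and> length s = 5 \<or> F = {{v\<^sub>1, v\<^sub>2}} \<and> length s = 7"
    and v: "v\<^sub>1 \<in> A 0" "v\<^sub>2 \<in> A 1"
    and sizes: "\<And>i. i < 5 \<Longrightarrow> bsize s i = int (card (A i))"
  shows "large_pack V E1 E2 \<or> (\<exists>i<5. absorbs E1 E2 u A (F \<noteq> {}) i)"
proof -
  define X where "X = V - {u}"
  define m where "m = length s"
  define p where "p x = (if F \<noteq> {} \<and> x = v\<^sub>1 then 5 else if F \<noteq> {} \<and> x = v\<^sub>2 then 6 else THE i. i < 5 \<and> x \<in> A i)" for x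
  have c: "finite V" "u \<in> V" "E1 \<inter> E2 = {}" "E1 \<union> E2 = pairs V" "(\<Union>i<5. A i) = X"
    and disj: "\<And>i j. i < 5 \<Longrightarrow> j < 5 \<Longrightarrow> i \<noteq> j \<Longrightarrow> A i \<inter> A j = {}"
    and cross: "\<And>i j x y. i < 5 \<Longrightarrow> j < 5 \<Longrightarrow> x \<in> A i \<Longrightarrow> y \<in> A j \<Longrightarrow>
       (near 1 i j \<longrightarrow> {x, y} \<in> (if {x, y} \<in> F then E2 else E1)) \<and>
       (near 2 i j \<longrightarrow> {x, y} \<in> (if {x, y} \<in> F then E1 else E2))"
    using conf unfolding config_def X_def by blast+
  have finX: "finite X" and uX: "u \<notin> X" using c by (auto simp: X_def)
  have EV: "E1 \<subseteq> pairs V" "E2 \<subseteq> pairs V" using c by auto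
  have the: "(THE i. i < 5 \<and> x \<in> A i) = i" if "i < 5" "x \<in> A i" for i x
    using that disj by blast
  have m57: "m = 5 \<and> F = {} \<or> m = 7 \<and> F = {{v\<^sub>1, v\<^sub>2}}" using F by (auto simp: m_def)
  have v12: "v\<^sub>1 \<noteq> v\<^sub>2" using v disj[of 0 1] by auto
  have bp: "blob (p x) = i" and pm: "p x < m" and p5: "5 \<le> p x \<Longrightarrow> F = {{v\<^sub>1, v\<^sub>2}} \<and> (x = v\<^sub>1 \<or> x = v\<^sub>2)"
    if "i < 5" "x \<in> A i" for i x
    using the[OF that] the[of 0 v\<^sub>1] the[of 1 v\<^sub>2] v m57 that by (auto simp: p_def blob_def split: if_splits)
  have inA: "\<exists>i<5. x \<in> A i" if "x \<in> X" for x using that c(5) by auto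
  have AX: "x \<in> X" if "i < 5" "x \<in> A i" for i x using that c(5) by auto
  have bpX: "x \<in> A (blob (p x))" "blob (p x) < 5" "p x < m" if "x \<in> X" for x
    using inA[OF that] bp pm by auto
  have Ab: "{x \<in> X. blob (p x) = i} = A i" if "i < 5" for i
    using bpX bp[OF that] AX[OF that] by auto
  have vX: "v\<^sub>1 \<in> X" "v\<^sub>2 \<in> X" "blob (p v\<^sub>1) = 0" "blob (p v\<^sub>2) = 1"
    using AX[of 0] AX[of 1] bp[of 0] bp[of 1] v by auto
  have p_flip: "p v\<^sub>1 = 5" "p v\<^sub>2 = 6" if "F \<noteq> {}" using that v12 by (auto simp: p_def)
  have ne: "x \<noteq> y" if "{x, y} \<in> E1 \<union> E2" for x y using that c(4) pairs_iff[of x y V] by simp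
  have near_E: "near 1 (blob (p x)) (blob (p y)) \<Longrightarrow> {x, y} \<in> (if {x, y} \<in> F then E2 else E1)"
    "near 2 (blob (p x)) (blob (p y)) \<Longrightarrow> {x, y} \<in> (if {x, y} \<in> F then E1 else E2)"
    if "x \<in> X" "y \<in> X" for x y
    using cross[OF bpX(2)[OF that(1)] bpX(2)[OF that(2)] bpX(1)[OF that(1)] bpX(1)[OF that(2)]] by blast+
  have flip_far: "\<not> (p x < 5 \<or> p y < 5)" "near 1 (blob (p x)) (blob (p y))" if "{x, y} \<in> F" for x y
    using that m57 p_flip vX v12 by (auto simp: doubleton_eq_iff near_def)
  have ok1: "{x, y} \<in> E1" if "x \<in> X" "y \<in> X" "adj 1 (p x) (p y)" for x y
    using near_E(1)[OF that(1,2)] flip_far(1)[of x y] that(3) unfolding adj_def by (auto split: if_splits)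
  have ok2: "{x, y} \<in> E2" if "x \<in> X" "y \<in> X" "adj 2 (p x) (p y)" for x y
    using near_E(2)[OF that(1,2)] flip_far(1)[of x y] that(3) unfolding adj_def by (auto split: if_splits)
  have both5: "{x, y} = {v\<^sub>1, v\<^sub>2}" if "x \<in> X" "y \<in> X" "x \<noteq> y" "\<not> (p x < 5 \<or> p y < 5)" for x y
    using p5[OF bpX(2,1), of x] p5[OF bpX(2,1), of y] that by auto
  have not1: "{x, y} = {v\<^sub>1, v\<^sub>2}" if "x \<in> X" "y \<in> X" "{x, y} \<in> E1" "blob (p x) \<noteq> blob (p y)" "\<not> adj 1 (p x) (p y)" for x y
  proof (cases "near 1 (blob (p x)) (blob (p y))")
    case True
    then show ?thesis using that both5[of x y] ne by (auto simp: adj_def)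
  next
    case False
    then have "near 2 (blob (p x)) (blob (p y))" using near_cases bpX(2) that by blast
    then have "{x, y} \<in> F" using near_E(2)[of x y] that c(3) by (auto split: if_splits)
    then show ?thesis using m57 by auto
  qed
  have not2: "{x, y} = {v\<^sub>1, v\<^sub>2}" if "x \<in> X" "y \<in> X" "{x, y} \<in> E2" "blob (p x) \<noteq> blob (p y)" "\<not> adj 2 (p x) (p y)" for x y
  proof (cases "near 2 (blob (p x)) (blob (p y))")
    case True
    then show ?thesis using that both5[of x y] ne by (auto simp: adj_def)
  next
    case False
    then have "near 1 (blob (p x)) (blob (p y))" using near_cases bpX(2) that by blast
    then have "{x, y} \<in> F" using near_E(1)[of x y] that c(3) by (auto split: if_splits)
    then show ?thesis using m57 by auto
  qed
  have cert1: "0 < N" "0 < s ! 3" "N \<le> Z * s ! 3" "static_ok 1 s N Z W1 es1" "static_ok 2 s N Z W2 es2"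
    "check 50 s (map (tolerance s) [0..<5]) N T es1 es2 (map (\<lambda>_. 0) s) s"
    "m = 7 \<Longrightarrow> s ! 5 = 1 \<and> s ! 6 = 1"
    using cert by (auto simp: cert_ok_def m_def)
  have bsz: "bsize t i = t ! i + (if length t = 7 then if i = 0 then t ! 5 else if i = 1 then t ! 6 else 0 else 0)"
    if "i < 5" "length t = 5 \<or> length t = 7" for i t
  proof -
    have "i = 0 \<or> i = 1 \<or> i = 2 \<or> i = 3 \<or> i = 4" using that by auto
    then show ?thesis using that(2) by (elim disjE) (simp_all add: bsize_def blob_def upt_rec numeral_eq_Suc)
  qed
  have s: "s ! P = int (card {x \<in> X. p x = P})" if P: "P < m" for P
  proof -
    \<comment> \<open>\<open>t\<close> lists the true part sizes. It has the same blob sizes as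
      \<open>s\<close>, and with a flipped edge both lists have entry 1 at positions 5 and 6, so
      they agree everywhere.\<close>
    define t where "t = map (\<lambda>P. int (card {x \<in> X. p x = P})) [0..<m]"
    have t: "length t = m" "\<And>P. P < m \<Longrightarrow> t ! P = int (card {x \<in> X. p x = P})" by (auto simp: t_def)
    have bt: "bsize t i = int (card (A i))" if "i < 5" for i
    proof -
      have "bsize t i = int (card {x \<in> X. blob (p x) = i})"
        by (rule bsize_eq_card) (use finX bpX t in auto)
      then show ?thesis using Ab[OF that] by simp
    qed
    have t56: "t ! 5 = 1 \<and> t ! 6 = 1" if "m = 7"
    proof -
      have Fn: "F \<noteq> {}" using that m57 by auto
      have "x = v\<^sub>1 \<or> x = v\<^sub>2" if "x \<in> X" "5 \<le> p x" for x
        using p5[OF bpX(2)[OF that(1)] bpX(1)[OF that(1)] that(2)] by blast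
      then have "x \<in> X \<and> p x = 5 \<longleftrightarrow> x = v\<^sub>1" "x \<in> X \<and> p x = 6 \<longleftrightarrow> x = v\<^sub>2" for x
        using p_flip[OF Fn] vX(1,2) by fastforce+
      then have "{x \<in> X. p x = 5} = {v\<^sub>1}" "{x \<in> X. p x = 6} = {v\<^sub>2}" by auto
      then show ?thesis using t that by simp
    qed
    have "t ! P = s ! P"
    proof (cases "P < 5")
      case True
      then show ?thesis using bt[OF True] sizes[OF True] bsz[OF True, of t] bsz[OF True, of s] t(1) m57 t56 cert1(7)
        by (auto simp: m_def split: if_splits)
    next
      case False
      then have "m = 7" "P = 5 \<or> P = 6" using P m57 by auto
      then show ?thesis using t56 cert1(7) by auto
    qed
    then show ?thesis using t P by simp
  qed
  define d where "d P = card {x \<in> X. p x = P \<and> {x, u} \<in> E1}" for P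
  define e where "e P = card {x \<in> X. p x = P \<and> {x, u} \<in> E2}" for P
  define ds where "ds = map (\<lambda>P. int (d P)) [0..<m]"
  have xu: "{x, u} \<in> E1 \<longleftrightarrow> {x, u} \<notin> E2" if "x \<in> X" for x
  proof -
    have "{x, u} \<in> pairs V" using that c(2) by (auto simp: pairs_iff X_def)
    then show ?thesis using c(3,4) by blast
  qed
  \<comment> \<open>Blue degrees are the complements of red ones, so an upper bound \<open>h\<close>
    on the red degrees is the lower bound \<open>s - h\<close> on the blue ones.\<close>
  have de: "int (e P) = s ! P - int (d P)" if "P < m" for P
  proof -
    have "{x \<in> X. p x = P} = {x \<in> X. p x = P \<and> {x, u} \<in> E1} \<union> {x \<in> X. p x = P \<and> {x, u} \<in> E2}"
      using xu by auto
    moreover have "{x \<in> X. p x = P \<and> {x, u} \<in> E1} \<inter> {x \<in> X. p x = P \<and> {x, u} \<in> E2} = {}" using xu by auto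
    ultimately have "card {x \<in> X. p x = P} = d P + e P"
      unfolding d_def e_def using finX by (simp add: card_Un_disjoint)
    then show ?thesis using s[OF that] by simp
  qed
  have "in_box s (map (\<lambda>_. 0) s) s ds"
    using de by (fastforce simp: in_box_def ds_def m_def)
  from check_sound[OF cert1(6) this] consider
    (fit) i where "i < 5" "misfit s ds ds i \<le> tolerance s i"
    | (big) l h where "in_box s l h ds"
      "T < greedy es1 l (map (\<lambda>x. N * x) l) + greedy es2 (map2 (-) s h) (map2 (\<lambda>x y. N * (x - y)) s h)"
    by auto
  then show ?thesis
  proof cases
    case fit
    let ?M = "misfits E1 E2 u A i"
    have M: "?M = {x \<in> X. near 1 i (blob (p x)) \<and> {x, u} \<in> E2 \<or> near 2 i (blob (p x)) \<and> {x, u} \<in> E1}"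
    proof -
      have "x \<in> ?M \<longleftrightarrow> x \<in> X \<and> (near 1 i (blob (p x)) \<and> {x, u} \<in> E2 \<or> near 2 i (blob (p x)) \<and> {x, u} \<in> E1)" for x
        unfolding misfits_def using bp AX bpX by blast
      then show ?thesis by blast
    qed
    have finM: "finite ?M" unfolding M using finX by simp
    have "int (card ?M) = misfit s ds ds i"
    proof -
      have "real (card ?M) = (\<Sum>x\<in>?M. 1)" by simp
      also have "\<dots> = (\<Sum>P<m. real (card {x \<in> ?M. p x = P}) * 1)"
        by (rule sum_over_fibres) (use finM M bpX in auto)
      also have "\<dots> = (\<Sum>P<m. real_of_int (if blob P = i then 0 else if near 1 (blob P) i then s ! P - ds ! P else ds ! P))"
      proof (rule sum.cong[OF refl])
        fix P assume "P \<in> {..<m}"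
        then have P: "P < m" and bP: "blob P < 5" using m57 by (auto simp: blob_def)
        consider "blob P = i" | "near 1 i (blob P)" "\<not> near 2 i (blob P)" "blob P \<noteq> i"
          | "near 2 i (blob P)" "\<not> near 1 i (blob P)" "blob P \<noteq> i"
          using near_cases[OF fit(1) bP] near_1_2[OF fit(1) bP] by blast
        then show "real (card {x \<in> ?M. p x = P}) * 1
            = real_of_int (if blob P = i then 0 else if near 1 (blob P) i then s ! P - ds ! P else ds ! P)"
        proof cases
          case 1
          then have "{x \<in> ?M. p x = P} = {}" unfolding M by (auto simp: near_def)
          then have "card {x \<in> ?M. p x = P} = 0" by (simp only: card.empty)
          then show ?thesis using 1 by simp
        next
          case 2
          then have "{x \<in> ?M. p x = P} = {x \<in> X. p x = P \<and> {x, u} \<in> E2}" unfolding M by auto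
          then have "card {x \<in> ?M. p x = P} = e P" by (simp only: e_def)
          then show ?thesis using 2 de[OF P] near_sym[of 1 i "blob P"] P by (simp add: ds_def)
        next
          case 3
          then have "{x \<in> ?M. p x = P} = {x \<in> X. p x = P \<and> {x, u} \<in> E1}" unfolding M by auto
          then have "card {x \<in> ?M. p x = P} = d P" by (simp only: d_def)
          then show ?thesis using 3 near_sym[of 1 i "blob P"] P by (simp add: ds_def)
        qed
      qed
      also have "\<dots> = real_of_int (misfit s ds ds i)"
        unfolding misfit_def by (simp add: interv_sum_list_conv_sum_set_nat lessThan_atLeast0 m_def)
      finally show ?thesis by linarith
    qed
    then have tol: "int (card ?M) \<le> tolerance s i" using fit by simp
    define g where "g = map (\<lambda>j. nat (bsize s j) + (if j = i then 1 else 0)) [0..<5]"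
    \<comment> \<open>\<open>tolerance\<close> compares a sorted list with the tuples of
      \<open>B1\<close> and \<open>B2\<close>, which are ascending; as a multiset it is
      \<open>grown A i\<close>.\<close>
    have "mset (sort g) = grown A i"
      unfolding g_def grown_def mset_sort mset_map mset_upt
      by (rule image_mset_cong) (simp add: sizes)
    then have gB: "grown A i \<in> mset ` B" if "sort g \<in> B" for B using that by force
    have "absorbs E1 E2 u A (F \<noteq> {}) i"
    proof (cases "sort g \<in> B2")
      case True
      then show ?thesis
        using tol gB[of B2] gB[of B1] B2_subset_B1 finM m57
        by (auto simp: absorbs_def tolerance_def Let_def g_def[symmetric] m_def split: if_splits)
    next
      case False
      then show ?thesis
        using tol gB[of B1] finM m57
        by (auto simp: absorbs_def tolerance_def Let_def g_def[symmetric] m_def split: if_splits)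
    qed
    then show ?thesis using fit(1) by blast
  next
    case big
    define g1 where "g1 = greedy es1 l (map (\<lambda>x. N * x) l)"
    define l2 where "l2 = map2 (-) s h"
    define g2 where "g2 = greedy es2 l2 (map (\<lambda>x. N * x) l2)"
    \<comment> \<open>The flipped edge is filled completely, evenly from all apexes in blob 3. This
      gives total weight 1, the 12 subtracted in \<open>cert_ok\<close>.\<close>
    define z where "z = (if F = {} then 0 else 1 / real_of_int (s ! 3))"
    have bx: "length l = m" "length h = m" "\<And>P. P < m \<Longrightarrow> 0 \<le> l ! P \<and> l ! P \<le> int (d P) \<and> int (d P) \<le> h ! P \<and> h ! P \<le> s ! P"
      using big(1) by (auto simp: in_box_def m_def ds_def)
    have l2: "length l2 = length s" "\<And>P. P < length s \<Longrightarrow> 0 \<le> l2 ! P \<and> l2 ! P \<le> int (card {x \<in> X. p x = P \<and> {x, u} \<in> E2})"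
      using bx de by (auto simp: l2_def m_def e_def[symmetric])
    have l1: "length l = length s" "\<And>P. P < length s \<Longrightarrow> 0 \<le> l ! P \<and> l ! P \<le> int (card {x \<in> X. p x = P \<and> {x, u} \<in> E1})"
      using bx by (auto simp: m_def d_def[symmetric])
    have len: "5 \<le> length s" "length s \<le> 7" using m57 by (auto simp: m_def)
    have s3: "0 < real_of_int (s ! 3)" using cert1 by simp
    have zN: "z * real_of_int N \<le> real_of_int Z"
    proof -
      have "real_of_int N \<le> real_of_int (Z * s ! 3)" using cert1(3) of_int_le_iff by blast
      then have "real_of_int N / real_of_int (s ! 3) \<le> real_of_int Z" using s3 by (simp add: field_simps)
      moreover have "0 \<le> real_of_int N / real_of_int (s ! 3)" using cert1 s3 by simp
      ultimately show ?thesis by (auto simp: z_def)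
    qed
    have Z0: "0 \<le> real_of_int Z"
    proof -
      have "0 < Z * s ! 3" using cert1 by linarith
      then show ?thesis using cert1(2) by (simp add: zero_less_mult_iff)
    qed
    \<comment> \<open>The flipped edge belongs to \<open>E2\<close>, so the bound for
      \<open>E1\<close> takes weight 0 on it.\<close>
    have n1: "real (card {(x, y). x \<in> X \<and> y \<in> X \<and> blob (p x) = blob (p y) \<and> {x, y} \<in> E1}) / 2
        + real_of_int g1 / real_of_int N + 0 * real_of_int (s ! 3) \<le> nu_star E1"
      unfolding g1_def
      by (rule nu_star_ge_greedy[OF c(1) EV(1) c(2) X_def _ _ len _ cert1(4) cert1(1) ok1 not1 vX(1,2) _ _ _ _ _ l1])
        (use vX bpX s Z0 in \<open>auto simp: m_def\<close>)
    have n2: "real (card {(x, y). x \<in> X \<and> y \<in> X \<and> blob (p x) = blob (p y) \<and> {x, y} \<in> E2}) / 2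
        + real_of_int g2 / real_of_int N + z * real_of_int (s ! 3) \<le> nu_star E2"
      unfolding g2_def
    proof (rule nu_star_ge_greedy[OF c(1) EV(2) c(2) X_def _ _ len _ cert1(5) cert1(1) ok2 not2 vX(1,2) _ _ _ zN _ l2])
      show "0 \<le> z" "z * real_of_int (s ! 3) \<le> 1" using s3 by (auto simp: z_def)
      \<comment> \<open>Blob 3 is the only one at distance 2 from both blob 0 and blob 1, so its
        vertices complete the flipped edge to triangles in \<open>E2\<close>.\<close>
      show "5 \<le> p v\<^sub>1 \<and> 5 \<le> p v\<^sub>2 \<and> adj 2 (p v\<^sub>1) 3 \<and> adj 2 (p v\<^sub>2) 3 \<and> {v\<^sub>1, v\<^sub>2} \<in> E2" if "z \<noteq> 0"
      proof -
        have Fn: "F = {{v\<^sub>1, v\<^sub>2}}" using that m57 by (auto simp: z_def)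
        then have "{v\<^sub>1, v\<^sub>2} \<in> E2" using cross[of 0 1 v\<^sub>1 v\<^sub>2] v by (simp add: near_def)
        then show ?thesis using Fn p_flip by (simp add: adj_def near_def blob_def)
      qed
    qed (use vX bpX s in \<open>auto simp: m_def\<close>)
    have g12: "T < g1 + g2"
    proof -
      have eq: "map2 (\<lambda>x y. N * (x - y)) s h = map (\<lambda>x. N * x) l2"
        unfolding l2_def by (rule nth_equalityI) auto
      show ?thesis using big(2) unfolding eq g1_def g2_def l2_def[symmetric] .
    qed
    define I where "I = (\<Sum>i\<leftarrow>[0..<5]. bsize s i * (bsize s i - 1))"
    \<comment> \<open>This is where the colours inside the blobs cancel out: every inner pair
      belongs to exactly one of the two classes.\<close>
    have inner: "real (card {(x, y). x \<in> X \<and> y \<in> X \<and> blob (p x) = blob (p y) \<and> {x, y} \<in> E1})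
        + real (card {(x, y). x \<in> X \<and> y \<in> X \<and> blob (p x) = blob (p y) \<and> {x, y} \<in> E2}) = real_of_int I"
    proof -
      let ?I = "\<lambda>E. {(x, y). x \<in> X \<and> y \<in> X \<and> blob (p x) = blob (p y) \<and> {x, y} \<in> E}"
      have fI: "finite (?I E)" for E by (rule finite_subset[of _ "X \<times> X"]) (use finX in auto)
      have "?I E1 \<union> ?I E2 = ?I (pairs V)" using c(4) by blast
      also have "\<dots> = {(x, y). x \<in> X \<and> y \<in> X \<and> blob (p x) = blob (p y) \<and> x \<noteq> y}"
        by (auto simp: pairs_iff X_def)
      finally have un: "?I E1 \<union> ?I E2 = {(x, y). x \<in> X \<and> y \<in> X \<and> blob (p x) = blob (p y) \<and> x \<noteq> y}" .
      have "?I E1 \<inter> ?I E2 = {}" using c(3) by blast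
      then have "card (?I E1) + card (?I E2) = card {(x, y). x \<in> X \<and> y \<in> X \<and> blob (p x) = blob (p y) \<and> x \<noteq> y}"
        using card_Un_disjoint[OF fI[of E1] fI[of E2]] unfolding un by simp
      then have "real (card (?I E1)) + real (card (?I E2))
          = real (card {(x, y). x \<in> X \<and> y \<in> X \<and> blob (p x) = blob (p y) \<and> x \<noteq> y})" by linarith
      also have "\<dots> = (\<Sum>i<5. real (card {x \<in> X. blob (p x) = i}) * (real (card {x \<in> X. blob (p x) = i}) - 1))"
        by (rule card_same_blob_pairs) (use finX bpX in auto)
      also have "\<dots> = (\<Sum>i<5. real_of_int (bsize s i * (bsize s i - 1)))"
        by (rule sum.cong) (auto simp: Ab sizes)
      also have "\<dots> = real_of_int I" unfolding I_def
        by (simp add: interv_sum_list_conv_sum_set_nat lessThan_atLeast0)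
      finally show ?thesis .
    qed
    have cV: "int (card V) = sum_list s + 1"
    proof -
      have "real (card X) = (\<Sum>x\<in>X. 1)" by simp
      also have "\<dots> = (\<Sum>P<m. real (card {x \<in> X. p x = P}) * 1)"
        by (rule sum_over_fibres) (use finX bpX in auto)
      also have "\<dots> = real_of_int (\<Sum>P<m. s ! P)" by (simp add: s)
      also have "(\<Sum>P<m. s ! P) = sum_list s" by (simp add: sum_list_sum_nth m_def lessThan_atLeast0)
      finally have "int (card X) = sum_list s" by linarith
      moreover have "card V = card X + 1" using card_Suc_Diff1[OF c(1,2)] by (simp add: X_def)
      ultimately show ?thesis by simp
    qed
    define f :: int where "f = (if F = {} then 0 else 1)"
    have zf: "z * real_of_int (s ! 3) = real_of_int f" using s3 by (simp add: z_def f_def)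
    have "N * ((sum_list s + 1) * sum_list s - 6 * I - 12 * f) < 12 * (T + 1)"
      using cert m57 unfolding cert_ok_def I_def f_def m_def by auto
    also have "12 * (T + 1) \<le> 12 * (g1 + g2)" using g12 by simp
    finally have "N * ((sum_list s + 1) * sum_list s - 6 * I - 12 * f) < 12 * (g1 + g2)" .
    then have "real_of_int (N * ((sum_list s + 1) * sum_list s - 6 * I - 12 * f)) < real_of_int (12 * (g1 + g2))"
      using of_int_less_iff by blast
    then have a1: "real_of_int ((sum_list s + 1) * sum_list s)
        < 6 * real_of_int I + 12 * real_of_int f + 12 * (real_of_int (g1 + g2) / N)"
      using cert1(1) by (simp add: field_simps)
    have a2: "real (card V) * (real (card V) - 1) = real_of_int ((sum_list s + 1) * sum_list s)"
    proof -
      have "real (card V) = real_of_int (sum_list s + 1)" using cV by (metis of_int_of_nat_eq)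
      then show ?thesis by simp
    qed
    have a3: "real_of_int I / 2 + real_of_int (g1 + g2) / N + real_of_int f \<le> nu_star E1 + nu_star E2"
      using n1 n2 inner zf by (simp add: add_divide_distrib)
    have "real (card V) * (real (card V) - 1)
        < 12 * (real_of_int I / 2 + real_of_int (g1 + g2) / N + real_of_int f)"
      unfolding a2 using a1 by (simp add: distrib_left)
    also have "\<dots> \<le> 12 * (nu_star E1 + nu_star E2)" by (intro mult_left_mono a3) simp
    finally have "large_pack V E1 E2" by (simp add: large_pack_def)
    then show ?thesis ..
  qed
qed

section \<open>Explicit certificates for all orders of the blob sizes\<close>

definition certified :: "int list \<Rightarrow> bool" where
  "certified s \<longleftrightarrow> (\<exists>N Z T W1 W2 es1 es2. cert_ok s N Z T W1 W2 es1 es2)"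

lemma certifiedI: "cert_ok s N Z T W1 W2 es1 es2 \<Longrightarrow> certified s"
  unfolding certified_def by blast

text \<open>Representatives of the cyclic orders of the blob sizes up to the maps \<open>i \<mapsto> k i + t\<close>
modulo 5, where \<open>k \<in> {2, 3}\<close> exchanges the colours.\<close>

definition blowup_orders :: "nat list list" where
  "blowup_orders = [[3, 3, 3, 4, 4], [2, 3, 4, 4, 4], [3, 3, 3, 3, 5], [3, 3, 4, 4, 4], [2, 4, 4, 4, 4], [3, 3, 3, 4, 5], [3, 4, 4, 4, 4], [3, 3, 4, 4, 5], [3, 3, 4, 5, 4], [4, 4, 4, 4, 4], [3, 4, 4, 4, 5], [4, 4, 4, 4, 5], [3, 4, 4, 5, 5], [3, 4, 5, 5, 4], [4, 4, 4, 5, 5], [4, 4, 5, 5, 5], [4, 5, 5, 5, 5], [5, 5, 5, 5, 5]]"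

text \<open>The flipped edge is a red one between the first two blobs, which leaves the reflection exchanging
these two as the only symmetry.\<close>

definition flip_orders :: "nat list list" where
  "flip_orders = [[3, 3, 3, 4, 4], [3, 3, 4, 3, 4], [3, 4, 3, 3, 4], [3, 4, 3, 4, 3], [3, 4, 4, 3, 3], [4, 4, 3, 3, 3], [3, 3, 4, 4, 4], [3, 4, 3, 4, 4], [3, 4, 4, 3, 4], [3, 4, 4, 4, 3], [4, 4, 3, 3, 4], [4, 4, 3, 4, 3], [3, 4, 4, 4, 4], [4, 4, 3, 4, 4], [4, 4, 4, 3, 4], [4, 4, 4, 4, 4], [4, 4, 4, 4, 5], [4, 4, 4, 5, 4], [4, 5, 4, 4, 4]]"

definition flip_parts :: "nat list \<Rightarrow> int list" where
  "flip_parts a = [int (a ! 0) - 1, int (a ! 1) - 1, int (a ! 2), int (a ! 3), int (a ! 4), 1, 1]"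

text \<open>The weights below come from a linear program that maximises the smallest surplus over all numbers
of red neighbours.\<close>

lemma certified_3_3_3_4_4: "certified [3, 3, 3, 4, 4]"
  by (rule certifiedI[of "[3, 3, 3, 4, 4]" 180 45 810
    "[[0, 3, 0, 0, 43], [57, 0, 3, 0, 0], [0, 59, 0, 1, 0], [0, 0, 44, 0, 12], [16, 0, 0, 33, 0]]"
    "[[0, 0, 56, 3, 0], [0, 0, 0, 38, 7], [11, 0, 0, 0, 37], [41, 19, 0, 0, 0], [0, 42, 18, 0, 0]]"
    "[(1, 2, 28), (2, 3, 23), (4, 0, 23), (3, 4, 23), (2, 3, 23), (1, 2, 28), (3, 4, 22), (0, 1, 30), (0, 1, 30), (4, 0, 23)]"
    "[(1, 3, 23), (2, 4, 26), (4, 1, 20), (4, 1, 20), (2, 4, 26), (1, 3, 24), (0, 2, 23), (3, 0, 26), (3, 0, 25), (0, 2, 23)]"]) code_simp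

lemma certified_2_3_4_4_4: "certified [2, 3, 4, 4, 4]"
  by (rule certifiedI[of "[2, 3, 4, 4, 4]" 84 21 294
    "[[0, 0, 0, 0, 21], [42, 0, 0, 0, 0], [0, 19, 0, 7, 0], [0, 0, 16, 0, 5], [10, 0, 0, 16, 0]]"
    "[[0, 0, 20, 1, 0], [0, 0, 0, 13, 8], [14, 0, 0, 0, 14], [24, 12, 0, 0, 0], [0, 20, 6, 0, 0]]"
    "[(2, 3, 15), (1, 2, 27), (3, 4, 21), (4, 0, 33)]"
    "[(4, 1, 8), (3, 0, 11), (1, 3, 22), (0, 2, 22), (2, 4, 24)]"]) code_simp

lemma certified_3_3_3_3_5: "certified [3, 3, 3, 3, 5]"
  by (rule certifiedI[of "[3, 3, 3, 3, 5]" 30 10 105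
    "[[0, 10, 0, 0, 0], [2, 0, 8, 0, 0], [0, 2, 0, 8, 0], [0, 0, 4, 0, 4], [6, 0, 0, 4, 0]]"
    "[[0, 0, 7, 3, 0], [0, 0, 0, 10, 0], [4, 0, 0, 0, 4], [8, 2, 0, 0, 0], [0, 6, 4, 0, 0]]"
    "[(4, 0, 6), (0, 1, 6), (1, 2, 10), (3, 4, 6), (2, 3, 6)]"
    "[(4, 1, 6), (1, 3, 6), (2, 4, 6), (3, 0, 8), (0, 2, 8)]"]) code_simp

lemma certified_3_3_4_4_4: "certified [3, 3, 4, 4, 4]"
  by (rule certifiedI[of "[3, 3, 4, 4, 4]" 60 15 270
    "[[0, 3, 0, 0, 13], [19, 0, 1, 0, 0], [0, 14, 0, 5, 0], [0, 0, 11, 0, 4], [6, 0, 0, 11, 0]]"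
    "[[0, 0, 15, 0, 0], [0, 0, 0, 15, 0], [6, 0, 0, 0, 11], [15, 5, 0, 0, 0], [0, 16, 3, 0, 0]]"
    "[(2, 3, 12), (3, 4, 15), (4, 0, 16), (1, 2, 16), (0, 1, 16)]"
    "[(0, 2, 12), (3, 0, 15), (2, 4, 18), (1, 3, 15), (4, 1, 12)]"]) code_simp

lemma certified_2_4_4_4_4: "certified [2, 4, 4, 4, 4]"
  by (rule certifiedI[of "[2, 4, 4, 4, 4]" 96 24 336
    "[[0, 23, 0, 0, 1], [16, 0, 16, 0, 0], [0, 7, 0, 17, 0], [0, 0, 12, 0, 12], [26, 0, 0, 11, 0]]"
    "[[0, 0, 24, 0, 0], [0, 0, 0, 12, 12], [18, 0, 0, 0, 15], [26, 11, 0, 0, 0], [0, 14, 10, 0, 0]]"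
    "[(4, 0, 17), (0, 1, 25), (2, 3, 9), (3, 4, 27), (1, 2, 27)]"
    "[(0, 2, 18), (3, 0, 18), (2, 4, 21), (4, 1, 18), (1, 3, 27)]"]) code_simp

lemma certified_3_3_3_4_5: "certified [3, 3, 3, 4, 5]"
  by (rule certifiedI[of "[3, 3, 3, 4, 5]" 180 45 630
    "[[0, 14, 0, 0, 28], [53, 0, 7, 0, 0], [0, 58, 0, 2, 0], [0, 0, 45, 0, 9], [23, 0, 0, 28, 0]]"
    "[[0, 0, 52, 6, 0], [0, 0, 0, 44, 1], [29, 0, 0, 0, 19], [40, 20, 0, 0, 0], [0, 36, 24, 0, 0]]"
    "[(4, 0, 32), (0, 1, 46), (1, 2, 50), (3, 4, 41), (2, 3, 41)]"
    "[(4, 1, 34), (3, 0, 48), (2, 4, 46), (0, 2, 18), (1, 3, 32)]"]) code_simp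

lemma certified_3_4_4_4_4: "certified [3, 4, 4, 4, 4]"
  by (rule certifiedI[of "[3, 4, 4, 4, 4]" 96 24 448
    "[[0, 24, 0, 0, 0], [8, 0, 18, 0, 0], [0, 5, 0, 19, 0], [0, 0, 7, 0, 17], [24, 0, 0, 6, 0]]"
    "[[0, 0, 24, 0, 0], [0, 0, 0, 17, 7], [8, 0, 0, 0, 18], [24, 6, 0, 0, 0], [0, 19, 5, 0, 0]]"
    "[(2, 3, 18), (3, 4, 27), (4, 0, 24), (1, 2, 27), (0, 1, 24)]"
    "[(4, 1, 18), (1, 3, 27), (3, 0, 24), (2, 4, 27), (0, 2, 24)]"]) code_simp

lemma certified_3_3_4_4_5: "certified [3, 3, 4, 4, 5]"
  by (rule certifiedI[of "[3, 3, 4, 4, 5]" 180 45 660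
    "[[0, 30, 0, 0, 18], [60, 0, 0, 0, 0], [0, 40, 0, 15, 0], [0, 0, 34, 0, 9], [20, 0, 0, 30, 0]]"
    "[[0, 0, 40, 5, 0], [0, 0, 0, 43, 2], [24, 0, 0, 0, 22], [39, 21, 0, 0, 0], [0, 36, 18, 0, 0]]"
    "[(3, 4, 33), (2, 3, 33), (4, 0, 64), (1, 2, 60)]"
    "[(2, 4, 42), (0, 2, 28), (4, 1, 32), (3, 0, 53), (1, 3, 31)]"]) code_simp

lemma certified_3_3_4_5_4: "certified [3, 3, 4, 5, 4]"
  by (rule certifiedI[of "[3, 3, 4, 5, 4]" 180 36 660
    "[[0, 20, 0, 0, 30], [48, 0, 9, 0, 0], [0, 40, 0, 12, 0], [0, 0, 26, 0, 19], [25, 0, 0, 21, 0]]"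
    "[[0, 0, 13, 26, 0], [0, 0, 0, 0, 45], [44, 0, 0, 0, 12], [23, 37, 0, 0, 0], [0, 20, 30, 0, 0]]"
    "[(3, 4, 41), (2, 3, 40), (1, 2, 42), (0, 1, 44), (4, 0, 45)]"
    "[(0, 2, 22), (2, 4, 54), (3, 0, 36), (4, 1, 30), (1, 3, 32)]"]) code_simp

lemma certified_4_4_4_4_4: "certified [4, 4, 4, 4, 4]"
  by (rule certifiedI[of "[4, 4, 4, 4, 4]" 84 21 420
    "[[0, 2, 0, 0, 19], [19, 0, 2, 0, 0], [0, 21, 0, 0, 0], [0, 0, 20, 0, 1], [2, 0, 0, 19, 0]]"
    "[[0, 0, 1, 20, 0], [0, 0, 0, 1, 20], [19, 0, 0, 0, 2], [1, 20, 0, 0, 0], [0, 0, 21, 0, 0]]"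
    "[(1, 2, 15), (0, 1, 21), (4, 0, 21), (3, 4, 24), (2, 3, 24)]"
    "[(2, 4, 15), (4, 1, 24), (1, 3, 21), (3, 0, 21), (0, 2, 24)]"]) code_simp

lemma certified_3_4_4_4_5: "certified [3, 4, 4, 4, 5]"
  by (rule certifiedI[of "[3, 4, 4, 4, 5]" 180 45 720
    "[[0, 3, 0, 0, 34], [47, 0, 10, 0, 0], [0, 33, 0, 12, 0], [0, 0, 37, 0, 7], [20, 0, 0, 30, 0]]"
    "[[0, 0, 44, 1, 0], [0, 0, 0, 34, 9], [20, 0, 0, 0, 24], [44, 12, 0, 0, 0], [0, 29, 16, 0, 0]]"
    "[(4, 0, 32), (0, 1, 33), (2, 3, 33), (3, 4, 39), (1, 2, 51)]"
    "[(4, 1, 37), (2, 4, 44), (0, 2, 32), (3, 0, 46), (1, 3, 42)]"]) code_simp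

lemma certified_4_4_4_4_5: "certified [4, 4, 4, 4, 5]"
  by (rule certifiedI[of "[4, 4, 4, 4, 5]" 120 30 540
    "[[0, 15, 0, 0, 12], [14, 0, 16, 0, 0], [0, 13, 0, 17, 0], [0, 0, 15, 0, 12], [15, 0, 0, 15, 0]]"
    "[[0, 0, 14, 16, 0], [0, 0, 0, 15, 12], [17, 0, 0, 0, 11], [13, 17, 0, 0, 0], [0, 14, 16, 0, 0]]"
    "[(3, 4, 24), (2, 3, 24), (4, 0, 24), (1, 2, 33), (0, 1, 33)]"
    "[(2, 4, 23), (4, 1, 28), (0, 2, 27), (3, 0, 33), (1, 3, 24)]"]) code_simp

lemma certified_3_4_4_5_5: "certified [3, 4, 4, 5, 5]"
  by (rule certifiedI[of "[3, 4, 4, 5, 5]" 240 48 840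
    "[[0, 0, 0, 0, 48], [63, 0, 13, 0, 0], [0, 45, 0, 12, 0], [0, 0, 40, 0, 16], [25, 0, 0, 33, 0]]"
    "[[0, 0, 5, 44, 0], [0, 0, 0, 5, 43], [65, 0, 0, 0, 9], [27, 40, 0, 0, 0], [0, 22, 38, 0, 0]]"
    "[(2, 3, 44), (0, 1, 51), (1, 2, 66), (4, 0, 44), (3, 4, 44)]"
    "[(0, 2, 35), (1, 3, 65), (3, 0, 44), (4, 1, 23), (2, 4, 61)]"]) code_simp

lemma certified_3_4_5_5_4: "certified [3, 4, 5, 5, 4]"
  by (rule certifiedI[of "[3, 4, 5, 5, 4]" 120 24 420
    "[[0, 27, 0, 0, 3], [9, 0, 19, 0, 0], [0, 10, 0, 16, 0], [0, 0, 8, 0, 20], [30, 0, 0, 6, 0]]"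
    "[[0, 0, 18, 6, 0], [0, 0, 0, 12, 15], [15, 0, 0, 0, 19], [23, 13, 0, 0, 0], [0, 25, 4, 0, 0]]"
    "[(2, 3, 24), (1, 2, 23), (3, 4, 22), (0, 1, 39), (4, 0, 24)]"
    "[(2, 4, 32), (0, 2, 24), (3, 0, 16), (1, 3, 32)]"]) code_simp

lemma certified_4_4_4_5_5: "certified [4, 4, 4, 5, 5]"
  by (rule certifiedI[of "[4, 4, 4, 5, 5]" 40 8 166
    "[[0, 5, 0, 0, 4], [5, 0, 5, 0, 0], [0, 5, 0, 4, 0], [0, 0, 5, 0, 4], [5, 0, 0, 4, 0]]"
    "[[0, 0, 5, 4, 0], [0, 0, 0, 4, 4], [5, 0, 0, 0, 4], [5, 5, 0, 0, 0], [0, 5, 5, 0, 0]]"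
    "[(2, 3, 8), (1, 2, 10), (4, 0, 8), (0, 1, 10), (3, 4, 8)]"
    "[(1, 3, 8), (2, 4, 8), (0, 2, 10), (3, 0, 8), (4, 1, 8)]"]) code_simp

lemma certified_4_4_5_5_5: "certified [4, 4, 5, 5, 5]"
  by (rule certifiedI[of "[4, 4, 5, 5, 5]" 40 8 160
    "[[0, 5, 0, 0, 4], [5, 0, 4, 0, 0], [0, 5, 0, 4, 0], [0, 0, 4, 0, 4], [5, 0, 0, 4, 0]]"
    "[[0, 0, 4, 4, 0], [0, 0, 0, 4, 4], [5, 0, 0, 0, 4], [5, 5, 0, 0, 0], [0, 5, 4, 0, 0]]"
    "[(1, 2, 8), (0, 1, 10), (4, 0, 8), (3, 4, 8), (2, 3, 8)]"
    "[(3, 0, 8), (4, 1, 8), (0, 2, 8), (2, 4, 8), (1, 3, 8)]"]) code_simp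

lemma certified_4_5_5_5_5: "certified [4, 5, 5, 5, 5]"
  by (rule certifiedI[of "[4, 5, 5, 5, 5]" 40 8 160
    "[[0, 4, 0, 0, 4], [5, 0, 4, 0, 0], [0, 4, 0, 4, 0], [0, 0, 4, 0, 4], [5, 0, 0, 4, 0]]"
    "[[0, 0, 4, 4, 0], [0, 0, 0, 4, 4], [5, 0, 0, 0, 4], [5, 4, 0, 0, 0], [0, 4, 4, 0, 0]]"
    "[(4, 0, 8), (0, 1, 8), (1, 2, 8), (3, 4, 8), (2, 3, 8)]"
    "[(0, 2, 8), (4, 1, 8), (1, 3, 8), (3, 0, 8), (2, 4, 8)]"]) code_simp

lemma certified_5_5_5_5_5: "certified [5, 5, 5, 5, 5]"
  by (rule certifiedI[of "[5, 5, 5, 5, 5]" 240 48 1000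
    "[[0, 24, 0, 0, 24], [24, 0, 24, 0, 0], [0, 28, 0, 20, 0], [0, 0, 20, 0, 28], [24, 0, 0, 24, 0]]"
    "[[0, 0, 23, 25, 0], [0, 0, 0, 21, 27], [22, 0, 0, 0, 26], [20, 28, 0, 0, 0], [0, 25, 23, 0, 0]]"
    "[(3, 4, 32), (1, 2, 32), (2, 3, 80), (0, 1, 48), (4, 0, 48)]"
    "[(1, 3, 44), (3, 0, 60), (2, 4, 44), (4, 1, 32), (0, 2, 60)]"]) code_simp

section \<open>Certificates with a flipped edge, named after the blob sizes before its ends are
  split off\<close>

lemma certified_flip_3_3_3_4_4: "certified [2, 2, 3, 4, 4, 1, 1]"
  by (rule certifiedI[of "[2, 2, 3, 4, 4, 1, 1]" 180 45 630
    "[[0, 54, 0, 0, 18, 0, 0], [21, 0, 46, 0, 0, 0, 0], [0, 10, 0, 29, 0, 0, 44], [0, 0, 24, 0, 27, 0, 0], [25, 0, 0, 21, 0, 46, 0]]"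
    "[[0, 0, 60, 0, 0, 0, 0], [0, 0, 0, 30, 15, 0, 0], [13, 0, 0, 0, 31, 30, 0], [43, 24, 0, 0, 0, 30, 16], [0, 39, 20, 0, 0, 0, 42]]"
    "[(3, 4, 36), (4, 5, 6), (2, 3, 50), (5, 1, 72), (1, 2, 68), (0, 6, 138), (0, 1, 30), (4, 0, 69)]"
    "[(6, 3, 27), (4, 1, 33), (3, 5, 45), (4, 6, 24), (1, 3, 48), (3, 0, 51), (0, 2, 34), (2, 4, 58)]"]) code_simp

lemma certified_flip_3_3_4_3_4: "certified [2, 2, 4, 3, 4, 1, 1]"
  by (rule certifiedI[of "[2, 2, 4, 3, 4, 1, 1]" 240 80 840
    "[[0, 2, 0, 0, 59, 0, 0], [102, 0, 9, 0, 0, 0, 0], [0, 48, 0, 27, 0, 0, 63], [0, 0, 52, 0, 8, 0, 0], [15, 0, 0, 60, 0, 30, 0]]"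
    "[[0, 0, 27, 44, 0, 0, 0], [0, 0, 0, 23, 43, 0, 0], [43, 0, 0, 0, 24, 58, 0], [40, 62, 0, 0, 0, 1, 35], [0, 31, 33, 0, 0, 0, 46]]"
    "[(4, 5, 32), (2, 3, 55), (6, 2, 33), (3, 4, 44), (4, 0, 77), (0, 6, 36), (5, 1, 236), (1, 2, 78), (0, 1, 32)]"
    "[(0, 2, 57), (2, 4, 69), (3, 0, 72), (3, 5, 70), (4, 6, 16), (5, 2, 12), (6, 3, 44), (4, 1, 61), (1, 3, 70)]"]) code_simp

lemma certified_flip_3_4_3_3_4: "certified [2, 3, 3, 3, 4, 1, 1]"
  by (rule certifiedI[of "[2, 3, 3, 3, 4, 1, 1]" 180 60 630
    "[[0, 12, 0, 0, 36, 0, 0], [41, 0, 33, 0, 0, 0, 0], [0, 16, 0, 36, 0, 0, 24], [0, 0, 38, 0, 17, 0, 0], [22, 0, 0, 36, 0, 28, 0]]"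
    "[[0, 0, 34, 26, 0, 0, 0], [0, 0, 0, 23, 28, 0, 0], [30, 0, 0, 0, 16, 56, 0], [40, 29, 0, 0, 0, 4, 9], [0, 19, 33, 0, 0, 0, 24]]"
    "[(4, 5, 24), (2, 3, 32), (0, 6, 57), (4, 0, 42), (1, 2, 49), (3, 4, 38), (0, 1, 33), (6, 2, 33), (5, 1, 156)]"
    "[(3, 5, 60), (6, 3, 33), (4, 1, 39), (1, 3, 53), (3, 0, 48), (2, 4, 49), (0, 2, 52), (4, 6, 24)]"]) code_simp

lemma certified_flip_3_4_3_4_3: "certified [2, 3, 3, 4, 3, 1, 1]"
  by (rule certifiedI[of "[2, 3, 3, 4, 3, 1, 1]" 60 15 210
    "[[0, 6, 0, 0, 14, 0, 0], [12, 0, 12, 0, 0, 0, 0], [0, 4, 0, 9, 0, 0, 12], [0, 0, 10, 0, 10, 0, 0], [8, 0, 0, 7, 0, 16, 0]]"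
    "[[0, 0, 19, 1, 0, 0, 0], [0, 0, 0, 9, 8, 0, 0], [5, 0, 0, 0, 15, 5, 0], [15, 5, 0, 0, 0, 12, 3], [0, 12, 4, 0, 0, 0, 12]]"
    "[(0, 6, 24), (0, 1, 12), (5, 1, 48), (1, 2, 16), (2, 3, 12), (3, 4, 16), (4, 0, 16)]"
    "[(3, 5, 7), (3, 0, 13), (0, 2, 12), (6, 3, 9), (4, 6, 12), (5, 2, 12), (2, 4, 22), (4, 1, 12), (1, 3, 18)]"]) code_simp

lemma certified_flip_3_4_4_3_3: "certified [2, 3, 4, 3, 3, 1, 1]"
  by (rule certifiedI[of "[2, 3, 4, 3, 3, 1, 1]" 84 28 294
    "[[0, 13, 0, 0, 15, 0, 0], [14, 0, 14, 0, 0, 0, 0], [0, 6, 0, 19, 0, 0, 9], [0, 0, 6, 0, 20, 0, 0], [16, 0, 0, 11, 0, 19, 0]]"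
    "[[0, 0, 6, 20, 0, 0, 0], [0, 0, 0, 10, 18, 0, 0], [16, 0, 0, 0, 12, 16, 0], [13, 15, 0, 0, 0, 8, 5], [0, 6, 13, 0, 0, 0, 15]]"
    "[(5, 1, 58), (0, 1, 16), (2, 3, 15), (3, 4, 22), (4, 5, 16), (6, 2, 15), (1, 2, 24), (4, 0, 22), (0, 6, 42)]"
    "[(4, 1, 18), (6, 3, 16), (2, 4, 22), (0, 2, 24), (3, 0, 18), (5, 2, 24), (1, 3, 24)]"]) code_simp

lemma certified_flip_4_4_3_3_3: "certified [3, 3, 3, 3, 3, 1, 1]"
  by (rule certifiedI[of "[3, 3, 3, 3, 3, 1, 1]" 180 60 630
    "[[0, 23, 0, 0, 37, 0, 0], [23, 0, 37, 0, 0, 0, 0], [0, 18, 0, 36, 0, 0, 18], [0, 0, 31, 0, 29, 0, 0], [11, 0, 0, 43, 0, 18, 0]]"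
    "[[0, 0, 44, 16, 0, 0, 0], [0, 0, 0, 40, 20, 0, 0], [0, 0, 0, 0, 58, 6, 0], [43, 5, 0, 0, 0, 36, 0], [0, 37, 9, 0, 0, 0, 42]]"
    "[(4, 5, 33), (0, 1, 42), (5, 1, 111), (1, 2, 33), (4, 0, 47), (0, 6, 111), (6, 2, 33), (2, 3, 46), (3, 4, 36)]"
    "[(4, 6, 36), (0, 2, 48), (5, 2, 36), (2, 4, 46), (4, 1, 46), (3, 0, 46), (1, 3, 50)]"]) code_simp

lemma certified_flip_3_3_4_4_4: "certified [2, 2, 4, 4, 4, 1, 1]"
  by (rule certifiedI[of "[2, 2, 4, 4, 4, 1, 1]" 120 30 420
    "[[0, 18, 0, 0, 21, 0, 0], [42, 0, 9, 0, 0, 0, 0], [0, 18, 0, 14, 0, 0, 28], [0, 0, 18, 0, 12, 0, 0], [13, 0, 0, 17, 0, 26, 0]]"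
    "[[0, 0, 30, 0, 0, 0, 0], [0, 0, 0, 15, 15, 0, 0], [20, 0, 0, 0, 15, 20, 0], [26, 19, 0, 0, 0, 20, 10], [0, 21, 12, 0, 0, 0, 30]]"
    "[(4, 0, 39), (6, 2, 18), (0, 6, 36), (2, 3, 24), (3, 4, 33), (5, 1, 84), (1, 2, 48)]"
    "[(3, 0, 42), (2, 4, 39), (6, 3, 30), (3, 5, 30), (1, 3, 33), (4, 1, 27)]"]) code_simp

lemma certified_flip_3_4_3_4_4: "certified [2, 3, 3, 4, 4, 1, 1]"
  by (rule certifiedI[of "[2, 3, 3, 4, 4, 1, 1]" 96 24 336
    "[[0, 0, 0, 0, 24, 0, 0], [26, 0, 15, 0, 0, 0, 0], [0, 13, 0, 9, 0, 0, 21], [0, 0, 20, 0, 9, 0, 0], [8, 0, 0, 16, 0, 16, 0]]"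
    "[[0, 0, 32, 0, 0, 0, 0], [0, 0, 0, 13, 11, 0, 0], [6, 0, 0, 0, 17, 16, 0], [22, 10, 0, 0, 0, 16, 6], [0, 15, 12, 0, 0, 0, 15]]"
    "[(1, 2, 25), (3, 4, 21), (0, 6, 18), (4, 0, 24), (0, 1, 18), (5, 1, 96), (6, 2, 9), (2, 3, 18)]"
    "[(4, 1, 18), (1, 3, 27), (3, 5, 24), (6, 3, 15), (2, 4, 26), (3, 0, 30), (4, 6, 18), (0, 2, 20)]"]) code_simp

lemma certified_flip_3_4_4_3_4: "certified [2, 3, 4, 3, 4, 1, 1]"
  by (rule certifiedI[of "[2, 3, 4, 3, 4, 1, 1]" 120 40 420
    "[[0, 18, 0, 0, 17, 0, 0], [28, 0, 16, 0, 0, 0, 0], [0, 12, 0, 22, 0, 0, 18], [0, 0, 19, 0, 11, 0, 0], [16, 0, 0, 22, 0, 23, 0]]"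
    "[[0, 0, 3, 36, 0, 0, 0], [0, 0, 0, 11, 22, 0, 0], [25, 0, 0, 0, 10, 30, 0], [13, 27, 0, 0, 0, 4, 9], [0, 10, 18, 0, 0, 0, 18]]"
    "[(0, 6, 36), (5, 1, 84), (2, 3, 16), (3, 4, 32), (4, 5, 17), (4, 0, 38), (1, 2, 36), (6, 2, 18)]"
    "[(1, 3, 33), (3, 0, 22), (5, 2, 24), (0, 2, 39), (2, 4, 36), (4, 1, 24), (6, 3, 29)]"]) code_simp

lemma certified_flip_3_4_4_4_3: "certified [2, 3, 4, 4, 3, 1, 1]"
  by (rule certifiedI[of "[2, 3, 4, 4, 3, 1, 1]" 96 24 336
    "[[0, 13, 0, 0, 19, 0, 0], [14, 0, 17, 0, 0, 0, 0], [0, 9, 0, 14, 0, 0, 13], [0, 0, 10, 0, 19, 0, 0], [20, 0, 0, 7, 0, 29, 0]]"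
    "[[0, 0, 8, 16, 0, 0, 0], [0, 0, 0, 6, 24, 0, 0], [16, 0, 0, 0, 14, 22, 0], [15, 15, 0, 0, 0, 9, 13], [0, 12, 12, 0, 0, 0, 12]]"
    "[(0, 6, 54), (2, 3, 24), (3, 4, 25), (5, 1, 70), (1, 2, 18), (6, 2, 6), (4, 0, 18), (0, 1, 28)]"
    "[(5, 2, 14), (6, 3, 15), (3, 0, 19), (2, 4, 30), (1, 3, 33), (3, 5, 13), (0, 2, 32)]"]) code_simp

lemma certified_flip_4_4_3_3_4: "certified [3, 3, 3, 3, 4, 1, 1]"
  by (rule certifiedI[of "[3, 3, 3, 3, 4, 1, 1]" 240 80 840
    "[[0, 44, 0, 0, 27, 0, 0], [22, 0, 58, 0, 0, 0, 0], [0, 1, 0, 75, 0, 0, 12], [0, 0, 24, 0, 42, 0, 0], [31, 0, 0, 35, 0, 42, 0]]"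
    "[[0, 0, 52, 28, 0, 0, 0], [0, 0, 0, 48, 24, 0, 0], [10, 0, 0, 0, 42, 42, 0], [45, 27, 0, 0, 0, 16, 8], [0, 31, 34, 0, 0, 0, 45]]"
    "[(5, 1, 108), (6, 2, 42), (2, 3, 42), (0, 6, 174), (4, 0, 66), (3, 4, 51), (1, 2, 64), (0, 1, 42), (4, 5, 33)]"
    "[(2, 4, 54), (4, 1, 75), (4, 6, 33), (3, 5, 44), (0, 2, 64), (3, 0, 66), (1, 3, 42)]"]) code_simp

lemma certified_flip_4_4_3_4_3: "certified [3, 3, 3, 4, 3, 1, 1]"
  by (rule certifiedI[of "[3, 3, 3, 4, 3, 1, 1]" 84 21 294
    "[[0, 10, 0, 0, 18, 0, 0], [9, 0, 19, 0, 0, 0, 0], [0, 5, 0, 14, 0, 0, 13], [0, 0, 13, 0, 15, 0, 0], [7, 0, 0, 12, 0, 15, 0]]"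
    "[[0, 0, 12, 12, 0, 0, 0], [0, 0, 0, 9, 16, 0, 0], [11, 0, 0, 0, 12, 15, 0], [10, 11, 0, 0, 0, 9, 12], [0, 6, 19, 0, 0, 0, 9]]"
    "[(5, 1, 54), (2, 3, 17), (1, 2, 17), (6, 2, 1), (0, 1, 27), (3, 4, 15), (0, 6, 57), (4, 0, 16)]"
    "[(3, 0, 18), (5, 2, 18), (0, 2, 26), (2, 4, 22), (1, 3, 24), (4, 6, 18), (4, 1, 24)]"]) code_simp

lemma certified_flip_3_4_4_4_4: "certified [2, 3, 4, 4, 4, 1, 1]"
  by (rule certifiedI[of "[2, 3, 4, 4, 4, 1, 1]" 180 45 660
    "[[0, 0, 0, 0, 45, 0, 0], [60, 0, 15, 0, 0, 0, 0], [0, 26, 0, 17, 0, 0, 34], [0, 0, 32, 0, 13, 0, 0], [9, 0, 0, 33, 0, 30, 0]]"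
    "[[0, 0, 39, 6, 0, 0, 0], [0, 0, 0, 28, 17, 0, 0], [18, 0, 0, 0, 31, 20, 0], [45, 15, 0, 0, 0, 41, 4], [0, 31, 11, 0, 0, 0, 43]]"
    "[(5, 1, 180), (1, 2, 57), (2, 3, 33), (4, 0, 63), (6, 2, 33), (3, 4, 42)]"
    "[(3, 0, 33), (1, 3, 51), (0, 2, 48), (5, 2, 42), (2, 4, 54), (6, 3, 39), (4, 1, 36)]"]) code_simp

lemma certified_flip_4_4_3_4_4: "certified [3, 3, 3, 4, 4, 1, 1]"
  by (rule certifiedI[of "[3, 3, 3, 4, 4, 1, 1]" 180 45 660
    "[[0, 28, 0, 0, 24, 0, 0], [12, 0, 48, 0, 0, 0, 0], [0, 2, 0, 39, 0, 0, 18], [0, 0, 20, 0, 30, 0, 0], [27, 0, 0, 16, 0, 36, 0]]"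
    "[[0, 0, 52, 6, 0, 0, 0], [0, 0, 0, 34, 11, 0, 0], [0, 0, 0, 0, 42, 12, 0], [37, 10, 0, 0, 0, 28, 11], [0, 33, 15, 0, 0, 0, 36]]"
    "[(1, 2, 32), (5, 1, 96), (4, 0, 27), (0, 6, 144), (2, 3, 42), (0, 1, 60), (3, 4, 42)]"
    "[(4, 6, 39), (0, 2, 24), (2, 4, 51), (3, 0, 51), (3, 5, 33), (1, 3, 48), (4, 1, 48)]"]) code_simp

lemma certified_flip_4_4_4_3_4: "certified [3, 3, 4, 3, 4, 1, 1]"
  by (rule certifiedI[of "[3, 3, 4, 3, 4, 1, 1]" 180 60 660
    "[[0, 16, 0, 0, 33, 0, 0], [36, 0, 18, 0, 0, 0, 0], [0, 28, 0, 22, 0, 0, 30], [0, 0, 40, 0, 5, 0, 0], [10, 0, 0, 45, 0, 15, 0]]"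
    "[[0, 0, 33, 16, 0, 0, 0], [0, 0, 0, 40, 15, 0, 0], [10, 0, 0, 0, 31, 27, 0], [42, 13, 0, 0, 0, 15, 0], [0, 29, 15, 0, 0, 0, 33]]"
    "[(4, 5, 36), (6, 2, 36), (0, 1, 24), (4, 0, 51), (5, 1, 132), (0, 6, 72), (1, 2, 42), (2, 3, 34), (3, 4, 35)]"
    "[(4, 6, 36), (3, 5, 42), (1, 3, 34), (3, 0, 48), (0, 2, 51), (4, 1, 48), (2, 4, 42)]"]) code_simp

lemma certified_flip_4_4_4_4_4: "certified [3, 3, 4, 4, 4, 1, 1]"
  by (rule certifiedI[of "[3, 3, 4, 4, 4, 1, 1]" 240 60 960
    "[[0, 16, 0, 0, 48, 0, 0], [48, 0, 24, 0, 0, 0, 0], [0, 35, 0, 20, 0, 0, 55], [0, 0, 41, 0, 19, 0, 0], [7, 0, 0, 47, 0, 31, 0]]"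
    "[[0, 0, 34, 26, 0, 0, 0], [0, 0, 0, 24, 36, 0, 0], [24, 0, 0, 0, 31, 44, 0], [30, 34, 0, 0, 0, 14, 34], [0, 27, 29, 0, 0, 0, 43]]"
    "[(3, 4, 42), (0, 6, 96), (2, 3, 57), (4, 0, 75), (0, 1, 48), (1, 2, 63), (4, 5, 3), (5, 1, 192), (6, 2, 3)]"
    "[(6, 3, 6), (4, 1, 51), (3, 5, 60), (4, 6, 3), (2, 4, 60), (1, 3, 66), (0, 2, 66), (5, 2, 6), (3, 0, 72)]"]) code_simp

lemma certified_flip_4_4_4_4_5: "certified [3, 3, 4, 4, 5, 1, 1]"
  by (rule certifiedI[of "[3, 3, 4, 4, 5, 1, 1]" 48 12 168
    "[[0, 6, 0, 0, 6, 0, 0], [7, 0, 7, 0, 0, 0, 0], [0, 5, 0, 6, 0, 0, 9], [0, 0, 7, 0, 4, 0, 0], [5, 0, 0, 7, 0, 5, 0]]"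
    "[[0, 0, 6, 6, 0, 0, 0], [0, 0, 0, 6, 5, 0, 0], [7, 0, 0, 0, 4, 7, 0], [5, 7, 0, 0, 0, 6, 6], [0, 6, 6, 0, 0, 0, 6]]"
    "[(0, 6, 27), (0, 1, 9), (5, 1, 30), (3, 4, 8), (4, 5, 10), (4, 0, 10), (2, 3, 9), (1, 2, 12)]"
    "[(4, 1, 9), (1, 3, 9), (0, 2, 9), (5, 2, 9), (2, 4, 12), (4, 6, 9), (3, 0, 15)]"]) code_simp

lemma certified_flip_4_4_4_5_4: "certified [3, 3, 4, 5, 4, 1, 1]"
  by (rule certifiedI[of "[3, 3, 4, 5, 4, 1, 1]" 240 48 840
    "[[0, 59, 0, 0, 16, 0, 0], [0, 0, 60, 0, 0, 0, 0], [0, 4, 0, 42, 0, 0, 20], [0, 0, 16, 0, 44, 0, 0], [47, 0, 0, 7, 0, 64, 0]]"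
    "[[0, 0, 8, 42, 0, 0, 0], [0, 0, 0, 0, 60, 0, 0], [51, 0, 0, 0, 4, 72, 0], [15, 48, 0, 0, 0, 10, 41], [0, 3, 53, 0, 0, 0, 20]]"
    "[(0, 6, 240), (1, 2, 48), (3, 4, 43), (4, 0, 51), (5, 1, 63), (2, 3, 50), (0, 1, 63)]"
    "[(1, 3, 48), (3, 5, 26), (6, 3, 28), (4, 1, 51), (2, 4, 69), (0, 2, 63), (3, 0, 54)]"]) code_simp

lemma certified_flip_4_5_4_4_4: "certified [3, 4, 4, 4, 4, 1, 1]"
  by (rule certifiedI[of "[3, 4, 4, 4, 4, 1, 1]" 180 45 630
    "[[0, 23, 0, 0, 22, 0, 0], [16, 0, 33, 0, 0, 0, 0], [0, 5, 0, 36, 0, 0, 16], [0, 0, 12, 0, 33, 0, 0], [26, 0, 0, 16, 0, 38, 0]]"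
    "[[0, 0, 12, 33, 0, 0, 0], [0, 0, 0, 9, 36, 0, 0], [32, 0, 0, 0, 9, 48, 0], [8, 30, 0, 0, 0, 3, 33], [0, 0, 42, 0, 0, 0, 12]]"
    "[(2, 3, 36), (3, 4, 33), (0, 6, 116), (1, 2, 33), (5, 1, 111), (4, 0, 36), (0, 1, 47)]"
    "[(4, 1, 36), (3, 5, 27), (2, 4, 27), (1, 3, 54), (0, 2, 48), (3, 0, 57)]"]) code_simp

lemma blowup_orders_certified: "r \<in> set blowup_orders \<Longrightarrow> certified (map int r)"
  using
    certified_3_3_3_4_4 certified_2_3_4_4_4 certified_3_3_3_3_5 certified_3_3_4_4_4
    certified_2_4_4_4_4 certified_3_3_3_4_5 certified_3_4_4_4_4 certified_3_3_4_4_5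
    certified_3_3_4_5_4 certified_4_4_4_4_4 certified_3_4_4_4_5 certified_4_4_4_4_5
    certified_3_4_4_5_5 certified_3_4_5_5_4 certified_4_4_4_5_5 certified_4_4_5_5_5
    certified_4_5_5_5_5 certified_5_5_5_5_5
  by (auto simp: blowup_orders_def)

lemma flip_orders_certified: "r \<in> set flip_orders \<Longrightarrow> certified (flip_parts r)"
  using
    certified_flip_3_3_3_4_4 certified_flip_3_3_4_3_4 certified_flip_3_4_3_3_4
    certified_flip_3_4_3_4_3 certified_flip_3_4_4_3_3 certified_flip_4_4_3_3_3
    certified_flip_3_3_4_4_4 certified_flip_3_4_3_4_4 certified_flip_3_4_4_3_4
    certified_flip_3_4_4_4_3 certified_flip_4_4_3_3_4 certified_flip_4_4_3_4_3
    certified_flip_3_4_4_4_4 certified_flip_4_4_3_4_4 certified_flip_4_4_4_3_4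
    certified_flip_4_4_4_4_4 certified_flip_4_4_4_4_5 certified_flip_4_4_4_5_4
    certified_flip_4_5_4_4_4
  by (auto simp: flip_orders_def flip_parts_def)

section \<open>Symmetries of the pentagon\<close>

definition shift :: "nat \<Rightarrow> nat \<Rightarrow> nat \<Rightarrow> nat" where
  "shift k t i = (k * i + t) mod 5"

lemma shift_less: "shift k t i < 5"
  by (simp add: shift_def)

text \<open>Multiplication by 1 and 4 = -1 modulo 5 keeps the distances 1 and 2; multiplication by 2
  and 3 = -2 exchanges them, as 2 times 2 is -1.\<close>

lemma shift_near_list:
  "list_all (\<lambda>t. list_all (\<lambda>i. list_all (\<lambda>j.
     near 1 (shift 1 t i) (shift 1 t j) = near 1 i j \<and> near 2 (shift 1 t i) (shift 1 t j) = near 2 i j \<and>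
     near 1 (shift 4 t i) (shift 4 t j) = near 1 i j \<and> near 2 (shift 4 t i) (shift 4 t j) = near 2 i j \<and>
     near 1 (shift 2 t i) (shift 2 t j) = near 2 i j \<and> near 2 (shift 2 t i) (shift 2 t j) = near 1 i j \<and>
     near 1 (shift 3 t i) (shift 3 t j) = near 2 i j \<and> near 2 (shift 3 t i) (shift 3 t j) = near 1 i j)
     [0..<5]) [0..<5]) [0..<5]"
  by code_simp

lemma shift_near:
  assumes "t < 5" "i < 5" "j < 5"
  shows "k = 1 \<or> k = 4 \<Longrightarrow> near 1 (shift k t i) (shift k t j) = near 1 i j \<and> near 2 (shift k t i) (shift k t j) = near 2 i j"
    and "k = 2 \<or> k = 3 \<Longrightarrow> near 1 (shift k t i) (shift k t j) = near 2 i j \<and> near 2 (shift k t i) (shift k t j) = near 1 i j"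
  using shift_near_list assms unfolding list_all_iff set_upt by auto

text \<open>Two different blobs are at distance 1 or 2, and so are their images, whereas no blob is
  at such a distance from itself; hence the map is injective on a finite set.\<close>

lemma shift_bij:
  assumes "k \<in> {1, 2, 3, 4}" "t < 5"
  shows "bij_betw (shift k t) {0..<5} {0..<5}"
proof -
  have inj: "inj_on (shift k t) {0..<5}"
  proof (rule inj_onI, rule ccontr)
    fix i j assume ij: "i \<in> {0..<5}" "j \<in> {0..<5}" "shift k t i = shift k t j" "i \<noteq> j"
    then have "near 1 i j \<or> near 2 i j" using near_cases by simp
    then have "near 1 (shift k t i) (shift k t j) \<or> near 2 (shift k t i) (shift k t j)"
      using shift_near[OF assms(2), of i j k] ij assms(1) by auto
    then show False using ij(3) by (simp add: near_def)
  qed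
  moreover have "shift k t ` {0..<5} \<subseteq> {0..<5}" using shift_less by auto
  ultimately have "shift k t ` {0..<5} = {0..<5}" by (intro card_subset_eq) (auto simp: card_image)
  with inj show ?thesis by (simp add: bij_betw_def)
qed

definition handled :: "'a set \<Rightarrow> 'a set set \<Rightarrow> 'a set set \<Rightarrow> 'a \<Rightarrow> (nat \<Rightarrow> 'a set) \<Rightarrow> bool \<Rightarrow> bool" where
  "handled V E1 E2 u A fl \<longleftrightarrow> large_pack V E1 E2 \<or> (\<exists>i<5. absorbs E1 E2 u A fl i)"

lemma grown_shift:
  assumes "k \<in> {1, 2, 3, 4}" "t < 5" "i < 5"
  shows "grown (\<lambda>i. A (shift k t i)) i = grown A (shift k t i)"
proof -
  note bij = shift_bij[OF assms(1,2)]
  have "(shift k t j = shift k t i) = (j = i)" if "j \<in> {0..<5}" for j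
    using bij that assms(3) by (auto simp: bij_betw_def inj_on_def)
  then have "grown (\<lambda>i. A (shift k t i)) i
      = image_mset ((\<lambda>j. card (A j) + (if j = shift k t i then 1 else 0)) \<circ> shift k t) (mset_set {0..<5})"
    unfolding grown_def by (intro image_mset_cong) auto
  also have "\<dots> = image_mset (\<lambda>j. card (A j) + (if j = shift k t i then 1 else 0)) (mset_set (shift k t ` {0..<5}))"
    using bij by (simp add: image_mset_mset_set bij_betw_def flip: multiset.map_comp)
  also have "shift k t ` {0..<5} = {0..<5}" using bij by (simp add: bij_betw_def)
  finally show ?thesis by (simp add: grown_def)
qed

text \<open>Only the labels of the blobs change, so the flipped edges \<open>F\<close> stay the
  same. When distances 1 and 2 are exchanged, \<open>E1\<close> and \<open>E2\<close> exchange their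
  roles.\<close>

lemma config_shift:
  assumes "config V E1 E2 u A F" "k \<in> {1, 2, 3, 4}" "t < 5"
  shows "if k = 1 \<or> k = 4 then config V E1 E2 u (\<lambda>i. A (shift k t i)) F
    else config V E2 E1 u (\<lambda>i. A (shift k t i)) F"
proof -
  note bij = shift_bij[OF assms(2,3)]
  have un: "(\<Union>i<5. A (shift k t i)) = (\<Union>i<5. A i)"
    using bij by (metis bij_betw_def image_image lessThan_atLeast0)
  have inj: "shift k t i \<noteq> shift k t j" if "i < 5" "j < 5" "i \<noteq> j" for i j
    using bij that by (auto simp: bij_betw_def inj_on_def)
  have base: "finite V" "u \<in> V" "E1 \<inter> E2 = {}" "E1 \<union> E2 = pairs V" "(\<Union>i<5. A (shift k t i)) = V - {u}"
    and cross: "\<And>i j x y. i < 5 \<Longrightarrow> j < 5 \<Longrightarrow> x \<in> A i \<Longrightarrow> y \<in> A j \<Longrightarrow>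
       (near 1 i j \<longrightarrow> {x, y} \<in> (if {x, y} \<in> F then E2 else E1)) \<and>
       (near 2 i j \<longrightarrow> {x, y} \<in> (if {x, y} \<in> F then E1 else E2))"
    and disj: "\<And>i j. i < 5 \<Longrightarrow> j < 5 \<Longrightarrow> i \<noteq> j \<Longrightarrow> A i \<inter> A j = {}"
    using assms(1) unfolding config_def un by blast+
  have disj': "\<forall>i<5. \<forall>j<5. i \<noteq> j \<longrightarrow> A (shift k t i) \<inter> A (shift k t j) = {}"
    using disj[OF shift_less shift_less] inj by blast
  note cross' = cross[OF shift_less[of k t] shift_less[of k t]]
  show ?thesis
  proof (cases "k = 1 \<or> k = 4")
    case True
    have "\<forall>i<5. \<forall>j<5. \<forall>x\<in>A (shift k t i). \<forall>y\<in>A (shift k t j).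
       (near 1 i j \<longrightarrow> {x, y} \<in> (if {x, y} \<in> F then E2 else E1)) \<and>
       (near 2 i j \<longrightarrow> {x, y} \<in> (if {x, y} \<in> F then E1 else E2))"
    proof (intro allI impI ballI)
      fix i j x y assume "i < 5" "j < 5" "x \<in> A (shift k t i)" "y \<in> A (shift k t j)"
      then show "(near 1 i j \<longrightarrow> {x, y} \<in> (if {x, y} \<in> F then E2 else E1)) \<and>
          (near 2 i j \<longrightarrow> {x, y} \<in> (if {x, y} \<in> F then E1 else E2))"
        using cross'[of x i y j] shift_near(1)[OF assms(3) _ _ True, of i j] by simp
    qed
    then have "config V E1 E2 u (\<lambda>i. A (shift k t i)) F"
      unfolding config_def by (intro conjI base(1,2,3,4,5) disj')
    then show ?thesis using True by simp
  next
    case False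
    then have k: "k = 2 \<or> k = 3" using assms(2) by auto
    have "\<forall>i<5. \<forall>j<5. \<forall>x\<in>A (shift k t i). \<forall>y\<in>A (shift k t j).
       (near 1 i j \<longrightarrow> {x, y} \<in> (if {x, y} \<in> F then E1 else E2)) \<and>
       (near 2 i j \<longrightarrow> {x, y} \<in> (if {x, y} \<in> F then E2 else E1))"
    proof (intro allI impI ballI)
      fix i j x y assume "i < 5" "j < 5" "x \<in> A (shift k t i)" "y \<in> A (shift k t j)"
      then show "(near 1 i j \<longrightarrow> {x, y} \<in> (if {x, y} \<in> F then E1 else E2)) \<and>
          (near 2 i j \<longrightarrow> {x, y} \<in> (if {x, y} \<in> F then E2 else E1))"
        using cross'[of x i y j] shift_near(2)[OF assms(3) _ _ k, of i j] by simp
    qed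
    moreover have "E2 \<inter> E1 = {}" "E2 \<union> E1 = pairs V" using base(3,4) by blast+
    ultimately have "config V E2 E1 u (\<lambda>i. A (shift k t i)) F"
      unfolding config_def by (intro conjI base(1,2,5) disj')
    then show ?thesis using False by simp
  qed
qed

text \<open>Both outcomes can be pulled back: \<open>large_pack\<close> is symmetric in the two
  colours, and joining blob \<open>i\<close> after relabelling is joining blob
  \<open>shift k t i\<close> before it.\<close>

lemma handled_shift:
  assumes k: "k \<in> {1, 2, 3, 4}" and t: "t < 5"
    and h: "if k = 1 \<or> k = 4 then handled V E1 E2 u (\<lambda>i. A (shift k t i)) fl
      else handled V E2 E1 u (\<lambda>i. A (shift k t i)) fl"
  shows "handled V E1 E2 u A fl"
proof -
  note bij = shift_bij[OF k t]
  have ex: "(\<exists>j<5. Q j) \<longleftrightarrow> (\<exists>j<5. Q (shift k t j))" for Q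
  proof -
    have "(\<exists>j\<in>{0..<5}. Q j) \<longleftrightarrow> (\<exists>j\<in>shift k t ` {0..<5}. Q j)" using bij by (simp add: bij_betw_def)
    then show ?thesis by auto
  qed
  have mis: "misfits E1 E2 u A (shift k t i) = (if k = 1 \<or> k = 4 then misfits E1 E2 u (\<lambda>i. A (shift k t i)) i
      else misfits E2 E1 u (\<lambda>i. A (shift k t i)) i)" if i: "i < 5" for i
  proof (cases "k = 1 \<or> k = 4")
    case True
    then show ?thesis unfolding misfits_def ex[of "\<lambda>j. _ \<in> A j \<and> _ j"]
      using shift_near(1)[OF t i _ True] by auto
  next
    case False
    then have k23: "k = 2 \<or> k = 3" using k by auto
    show ?thesis unfolding misfits_def ex[of "\<lambda>j. _ \<in> A j \<and> _ j"]
      using shift_near(2)[OF t i _ k23] False by auto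
  qed
  have lp: "large_pack V E2 E1 = large_pack V E1 E2" by (simp add: large_pack_def add.commute)
  show ?thesis
  proof (cases "k = 1 \<or> k = 4")
    case True
    then have "absorbs E1 E2 u A fl (shift k t i) = absorbs E1 E2 u (\<lambda>i. A (shift k t i)) fl i" if "i < 5" for i
      using mis[OF that] grown_shift[OF k t that, of A] by (simp add: absorbs_def)
    then show ?thesis using h True shift_less[of k t] unfolding handled_def by (auto simp del: One_nat_def)
  next
    case False
    then have "absorbs E1 E2 u A fl (shift k t i) = absorbs E2 E1 u (\<lambda>i. A (shift k t i)) fl i" if "i < 5" for i
      using mis[OF that] grown_shift[OF k t that, of A] by (simp add: absorbs_def)
    then show ?thesis using h False shift_less[of k t] lp unfolding handled_def by (auto simp del: One_nat_def)
  qed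
qed

section \<open>Reduction to the certified orders\<close>

lemma bsize_map_int: "length a = 5 \<Longrightarrow> i < 5 \<Longrightarrow> bsize (map int a) i = int (a ! i)"
proof -
  assume a: "length a = 5" "i < 5"
  then have "i = 0 \<or> i = 1 \<or> i = 2 \<or> i = 3 \<or> i = 4" by auto
  then show ?thesis using a by (elim disjE) (simp_all add: bsize_def blob_def upt_rec numeral_eq_Suc)
qed

lemma bsize_flip_parts: "length a = 5 \<Longrightarrow> i < 5 \<Longrightarrow> bsize (flip_parts a) i = int (a ! i)"
proof -
  assume a: "length a = 5" "i < 5"
  then have "i = 0 \<or> i = 1 \<or> i = 2 \<or> i = 3 \<or> i = 4" by auto
  then show ?thesis using a by (elim disjE) (simp_all add: bsize_def blob_def upt_rec numeral_eq_Suc flip_parts_def)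
qed

definition blob_sizes :: "(nat \<Rightarrow> 'a set) \<Rightarrow> nat list" where
  "blob_sizes A = map (\<lambda>i. card (A i)) [0..<5]"

lemma handled_certified:
  assumes "config V E1 E2 u A {}" "\<forall>i<5. A i \<noteq> {}" "certified (map int (blob_sizes A))"
  shows "handled V E1 E2 u A False"
proof -
  \<comment> \<open>No edge is flipped here; any vertices of blobs 0 and 1 can stand for the two
    ends in \<open>cert_sound\<close>.\<close>
  obtain v\<^sub>1 v\<^sub>2 where v: "v\<^sub>1 \<in> A 0" "v\<^sub>2 \<in> A 1" using assms(2) by fastforce
  obtain N Z T W1 W2 es1 es2 where c: "cert_ok (map int (blob_sizes A)) N Z T W1 W2 es1 es2"
    using assms(3) unfolding certified_def by blast
  have bs: "bsize (map int (blob_sizes A)) i = int (card (A i))" if "i < 5" for i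
    using bsize_map_int[of "blob_sizes A" i] that by (simp add: blob_sizes_def)
  have "large_pack V E1 E2 \<or> (\<exists>i<5. absorbs E1 E2 u A (({} :: 'a set set) \<noteq> {}) i)"
    by (rule cert_sound[OF c assms(1) _ v bs]) (auto simp: blob_sizes_def)
  then show ?thesis by (simp add: handled_def)
qed

lemma handled_certified_flip:
  assumes "config V E1 E2 u A {{x, y}}" "x \<in> A 0" "y \<in> A 1" "certified (flip_parts (blob_sizes A))"
  shows "handled V E1 E2 u A True"
proof -
  obtain N Z T W1 W2 es1 es2 where c: "cert_ok (flip_parts (blob_sizes A)) N Z T W1 W2 es1 es2"
    using assms(4) unfolding certified_def by blast
  have bs: "bsize (flip_parts (blob_sizes A)) i = int (card (A i))" if "i < 5" for i
    using bsize_flip_parts[of "blob_sizes A" i] that by (simp add: blob_sizes_def)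
  have "large_pack V E1 E2 \<or> (\<exists>i<5. absorbs E1 E2 u A ({{x, y}} \<noteq> {}) i)"
    by (rule cert_sound[OF c assms(1) _ assms(2,3) bs]) (auto simp: flip_parts_def)
  then show ?thesis by (simp add: handled_def)
qed

definition shift_list :: "nat \<Rightarrow> nat \<Rightarrow> nat list \<Rightarrow> nat list" where
  "shift_list k t a = map (\<lambda>i. a ! shift k t i) [0..<5]"

lemma blob_sizes_shift: "blob_sizes (\<lambda>i. A (shift k t i)) = shift_list k t (blob_sizes A)"
  unfolding blob_sizes_def shift_list_def using shift_less by (auto intro!: nth_equalityI)

primrec arrangements :: "nat \<Rightarrow> nat list \<Rightarrow> nat list list" where
  "arrangements 0 xs = [[]]"
| "arrangements (Suc n) xs = concat (map (\<lambda>x. map ((#) x) (arrangements n (remove1 x xs))) (remdups xs))"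

lemma mem_arrangements: "mset a = mset xs \<Longrightarrow> a \<in> set (arrangements (length xs) xs)"
proof (induction a arbitrary: xs)
  case Nil
  then show ?case by simp
next
  case (Cons x a)
  then have x: "x \<in> set xs" by (metis list.set_intros(1) set_mset_mset)
  have "mset a = mset (remove1 x xs)" using Cons.prems by (metis add_mset_remove_trivial mset.simps(2) mset_remove1)
  moreover obtain n where n: "length xs = Suc n" using x by (cases xs) auto
  ultimately have "a \<in> set (arrangements n (remove1 x xs))"
    using Cons.IH x by (fastforce simp: length_remove1)
  then show ?case unfolding n using x by auto
qed

lemma length_B1: "t \<in> B1 \<Longrightarrow> length t = 5"
  by (auto simp: B1_def)

text \<open>Each \<open>ix\<close> tabulates a relabelling of the five blobs. The same test thus
  serves the 20 affine maps for blow-ups and the two maps that respect a flipped edge.\<close>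

definition reaches :: "nat list list \<Rightarrow> nat list list \<Rightarrow> nat list \<Rightarrow> bool" where
  "reaches ixs os a \<longleftrightarrow> list_ex (\<lambda>ix. map ((!) a) ix \<in> set os) ixs"

lemma blowup_orders_cover:
  "\<forall>t\<in>B1. list_all (reaches (concat (map (\<lambda>k. map (\<lambda>t. map (shift k t) [0..<5]) [0..<5]) [1, 2, 3, 4])) blowup_orders)
     (arrangements 5 t)"
  by code_simp

text \<open>\<open>shift 1 0\<close> is the identity and \<open>shift 4 1\<close> the reflection
  sending i to 1 - i, which exchanges blobs 0 and 1 and keeps the colours.\<close>

lemma flip_orders_cover:
  "\<forall>t\<in>B2. list_all (reaches (map (\<lambda>f. map f [0..<5]) [shift 1 0, shift 4 1]) flip_orders) (arrangements 5 t)"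
  by code_simp

lemma handled_blowup:
  assumes conf: "config V E1 E2 u A {}" and ne: "\<forall>i<5. A i \<noteq> {}" and sz: "blob_sizes_in A B1"
  shows "handled V E1 E2 u A False"
proof -
  obtain b where b: "b \<in> B1" "mset (blob_sizes A) = mset b"
    using sz unfolding blob_sizes_in_def blob_sizes_def by blast
  have "blob_sizes A \<in> set (arrangements 5 b)"
    using mem_arrangements[OF b(2)] length_B1[OF b(1)] by simp
  then have "reaches (concat (map (\<lambda>k. map (\<lambda>t. map (shift k t) [0..<5]) [0..<5]) [1, 2, 3, 4])) blowup_orders (blob_sizes A)"
    using blowup_orders_cover b(1) unfolding list_all_iff by blast
  then obtain ix where ix: "ix \<in> set (concat (map (\<lambda>k. map (\<lambda>t. map (shift k t) [0..<5]) [0..<5]) [1, 2, 3, 4]))"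
    "map ((!) (blob_sizes A)) ix \<in> set blowup_orders"
    unfolding reaches_def list_ex_iff by blast
  from ix(1) have "\<exists>k\<in>{1, 2, 3, 4}. \<exists>t<5. ix = map (shift k t) [0..<5]" by auto
  then obtain k t where kt: "k \<in> {1, 2, 3, 4}" "t < 5" and "ix = map (shift k t) [0..<5]" by blast
  then have kt3: "shift_list k t (blob_sizes A) \<in> set blowup_orders"
    using ix(2) by (simp add: shift_list_def o_def)
  have cert: "certified (map int (blob_sizes (\<lambda>i. A (shift k t i))))"
    unfolding blob_sizes_shift using blowup_orders_certified[OF kt3] .
  have ne': "\<forall>i<5. A (shift k t i) \<noteq> {}" using ne shift_less by blast
  show ?thesis
    by (rule handled_shift[OF kt(1,2)])
      (use config_shift[OF conf kt(1,2)] handled_certified[OF _ ne' cert] in \<open>auto split: if_splits simp del: One_nat_def\<close>)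
qed

lemma handled_flip_01:
  assumes conf: "config V E1 E2 u A {{x, y}}" and xy: "x \<in> A 0" "y \<in> A 1" and sz: "blob_sizes_in A B2"
  shows "handled V E1 E2 u A True"
proof -
  obtain b where b: "b \<in> B2" "mset (blob_sizes A) = mset b"
    using sz unfolding blob_sizes_in_def blob_sizes_def by blast
  then have b1: "b \<in> B1" using B2_subset_B1 by blast
  have "blob_sizes A \<in> set (arrangements 5 b)"
    using mem_arrangements[OF b(2)] length_B1[OF b1] by simp
  then have "reaches (map (\<lambda>f. map f [0..<5]) [shift 1 0, shift 4 1]) flip_orders (blob_sizes A)"
    using flip_orders_cover b(1) unfolding list_all_iff by blast
  then have "shift_list 1 0 (blob_sizes A) \<in> set flip_orders \<or> shift_list 4 1 (blob_sizes A) \<in> set flip_orders"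
    by (simp add: reaches_def shift_list_def o_def)
  moreover have "shift_list 1 0 (blob_sizes A) = blob_sizes A"
    by (auto simp: shift_list_def shift_def blob_sizes_def intro!: nth_equalityI)
  ultimately consider "blob_sizes A \<in> set flip_orders" | "shift_list 4 1 (blob_sizes A) \<in> set flip_orders"
    by auto
  then show ?thesis
  proof cases
    case 1
    then show ?thesis using handled_certified_flip[OF conf xy flip_orders_certified] by blast
  next
    case 2
    have c: "config V E1 E2 u (\<lambda>i. A (shift 4 1 i)) {{y, x}}"
      using config_shift[OF conf, of 4 1] by (simp add: insert_commute)
    have "handled V E1 E2 u (\<lambda>i. A (shift 4 1 i)) True"
      by (rule handled_certified_flip[OF c])
        (use xy flip_orders_certified[OF 2] in \<open>simp_all only: blob_sizes_shift\<close>, simp_all add: shift_def)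
    then show ?thesis using handled_shift[of 4 1] by simp
  qed
qed

text \<open>The affine map with factor j - i sends 0 to i and 1 to j, so the flipped edge can be
  moved between blobs 0 and 1. If the blobs prescribe blue for it, the factor is 2 or 3 and the
  colours are exchanged as well; certificates for an edge flipped from red to blue therefore cover
  both kinds.\<close>

lemma handled_flip:
  assumes conf: "config V E1 E2 u A {{x, y}}" and sz: "blob_sizes_in A B2"
    and ij: "x \<in> A i" "y \<in> A j" "i < 5" "j < 5" "i \<noteq> j"
  shows "handled V E1 E2 u A True"
proof -
  define k where "k = (j + 5 - i) mod 5"
  have k: "k \<in> {1, 2, 3, 4}" and sh: "shift k i 0 = i" "shift k i 1 = j"
  proof -
    have "i = 0 \<or> i = 1 \<or> i = 2 \<or> i = 3 \<or> i = 4" "j = 0 \<or> j = 1 \<or> j = 2 \<or> j = 3 \<or> j = 4" using ij by auto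
    then show "k \<in> {1, 2, 3, 4}" "shift k i 0 = i" "shift k i 1 = j"
      using ij(5) by (elim disjE; simp add: k_def shift_def)+
  qed
  let ?A = "\<lambda>l. A (shift k i l)"
  have "mset (blob_sizes ?A) = mset (blob_sizes A)"
  proof -
    have "mset (blob_sizes ?A) = image_mset (\<lambda>l. card (A l)) (image_mset (shift k i) (mset_set {0..<5}))"
      by (simp add: blob_sizes_def multiset.map_comp o_def)
    also have "image_mset (shift k i) (mset_set {0..<5}) = mset_set {0..<5}"
      using shift_bij[OF k ij(3)] by (simp add: image_mset_mset_set bij_betw_def)
    finally show ?thesis by (simp add: blob_sizes_def)
  qed
  then have sz': "blob_sizes_in ?A B2" using sz by (simp add: blob_sizes_in_def blob_sizes_def)
  have xy: "x \<in> ?A 0" "y \<in> ?A 1" using ij sh by simp_all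
  show ?thesis
    by (rule handled_shift[OF k ij(3)])
      (use config_shift[OF conf k ij(3)] handled_flip_01[OF _ xy sz'] in \<open>auto split: if_splits simp del: One_nat_def\<close>)
qed

section \<open>One more vertex\<close>

lemma near_iff:
  assumes "i < 5" "j < 5"
  shows near_1_iff: "near 1 i j \<longleftrightarrow> j = (i + 1) mod 5 \<or> i = (j + 1) mod 5"
    and near_2_iff: "near 2 i j \<longleftrightarrow> j = (i + 2) mod 5 \<or> i = (j + 2) mod 5"
proof -
  have "i = 0 \<or> i = 1 \<or> i = 2 \<or> i = 3 \<or> i = 4" "j = 0 \<or> j = 1 \<or> j = 2 \<or> j = 3 \<or> j = 4"
    using assms by auto
  then show "near 1 i j \<longleftrightarrow> j = (i + 1) mod 5 \<or> i = (j + 1) mod 5"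
    "near 2 i j \<longleftrightarrow> j = (i + 2) mod 5 \<or> i = (j + 2) mod 5"
    by (elim disjE; simp add: near_def)+
qed

text \<open>The definition goes around the pentagon in one direction; \<open>near\<close> is
  symmetric, and the other direction comes from \<open>{x, y} = {y, x}\<close>.\<close>

lemma pentagon_blowup_iff:
  "pentagon_blowup V R A \<longleftrightarrow> (\<forall>i<5. A i \<noteq> {}) \<and> (\<Union>i<5. A i) = V \<and>
     (\<forall>i<5. \<forall>j<5. i \<noteq> j \<longrightarrow> A i \<inter> A j = {}) \<and>
     (\<forall>i<5. \<forall>j<5. \<forall>x\<in>A i. \<forall>y\<in>A j. (near 1 i j \<longrightarrow> {x, y} \<in> R) \<and> (near 2 i j \<longrightarrow> {x, y} \<notin> R))"
proof -
  have n1: "(\<forall>i<5. \<forall>j<5. \<forall>x\<in>A i. \<forall>y\<in>A j. near 1 i j \<longrightarrow> {x, y} \<in> R)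
      \<longleftrightarrow> (\<forall>i<5. \<forall>x\<in>A i. \<forall>y\<in>A ((i + 1) mod 5). {x, y} \<in> R)" (is "?L \<longleftrightarrow> ?R")
  proof
    assume L: ?L
    have "near 1 i ((i + 1) mod 5)" if "i < 5" for i using that near_1_iff[of i "(i + 1) mod 5"] by simp
    then show ?R using L by (metis mod_less_divisor zero_less_numeral)
  next
    assume R: ?R
    show ?L
    proof (intro allI impI ballI)
      fix i j x y assume a: "i < 5" "j < 5" "x \<in> A i" "y \<in> A j" "near 1 i j"
      then consider "j = (i + 1) mod 5" | "i = (j + 1) mod 5" using near_1_iff by blast
      then show "{x, y} \<in> R"
      proof cases
        case 1
        then show ?thesis using R a by blast
      next
        case 2
        then have "{y, x} \<in> R" using R a by blast
        then show ?thesis by (simp add: insert_commute)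
      qed
    qed
  qed
  have n2: "(\<forall>i<5. \<forall>j<5. \<forall>x\<in>A i. \<forall>y\<in>A j. near 2 i j \<longrightarrow> {x, y} \<notin> R)
      \<longleftrightarrow> (\<forall>i<5. \<forall>x\<in>A i. \<forall>y\<in>A ((i + 2) mod 5). {x, y} \<notin> R)" (is "?L \<longleftrightarrow> ?R")
  proof
    assume L: ?L
    have "near 2 i ((i + 2) mod 5)" if "i < 5" for i using that near_2_iff[of i "(i + 2) mod 5"] by simp
    then show ?R using L by (metis mod_less_divisor zero_less_numeral)
  next
    assume R: ?R
    show ?L
    proof (intro allI impI ballI)
      fix i j x y assume a: "i < 5" "j < 5" "x \<in> A i" "y \<in> A j" "near 2 i j"
      then consider "j = (i + 2) mod 5" | "i = (j + 2) mod 5" using near_2_iff by blast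
      then show "{x, y} \<notin> R"
      proof cases
        case 1
        then show ?thesis using R a by blast
      next
        case 2
        then have "{y, x} \<notin> R" using R a by blast
        then show ?thesis by (simp add: insert_commute)
      qed
    qed
  qed
  show ?thesis unfolding pentagon_blowup_def n1[symmetric] n2[symmetric] by blast
qed

text \<open>\<open>R2\<close> is kept apart from \<open>R0\<close> to serve three situations: the
  colouring itself, the colouring with one edge at \<open>u\<close> flipped, and the colouring with
  the edge flipped that repairs \<open>H\<close>.\<close>

lemma pentagon_blowup_insert:
  assumes bl: "pentagon_blowup (V - {u}) R0 A" and u: "u \<in> V" and i: "i < 5"
    and same: "\<And>f. u \<notin> f \<Longrightarrow> f \<in> R2 \<longleftrightarrow> f \<in> R0"
    and at_u: "\<And>j x. j < 5 \<Longrightarrow> x \<in> A j \<Longrightarrow> (near 1 i j \<longrightarrow> {x, u} \<in> R2) \<and> (near 2 i j \<longrightarrow> {x, u} \<notin> R2)"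
  shows "pentagon_blowup V R2 (A(i := insert u (A i)))"
proof -
  let ?A = "A(i := insert u (A i))"
  from bl have ne: "\<forall>i<5. A i \<noteq> {}" and un: "(\<Union>i<5. A i) = V - {u}"
    and disj: "\<forall>i<5. \<forall>j<5. i \<noteq> j \<longrightarrow> A i \<inter> A j = {}"
    and cross: "\<And>i j x y. i < 5 \<Longrightarrow> j < 5 \<Longrightarrow> x \<in> A i \<Longrightarrow> y \<in> A j \<Longrightarrow>
      (near 1 i j \<longrightarrow> {x, y} \<in> R0) \<and> (near 2 i j \<longrightarrow> {x, y} \<notin> R0)"
    unfolding pentagon_blowup_iff by blast+
  have uA: "u \<notin> A j" if "j < 5" for j using un that by blast
  have "(\<Union>j<5. ?A j) = insert u (\<Union>j<5. A j)" using i by (auto split: if_splits)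
  then have un': "(\<Union>j<5. ?A j) = V" using un u by auto
  have disj': "\<forall>i'<5. \<forall>j<5. i' \<noteq> j \<longrightarrow> ?A i' \<inter> ?A j = {}"
    using disj uA i by auto
  have cross': "(near 1 i' j \<longrightarrow> {x, y} \<in> R2) \<and> (near 2 i' j \<longrightarrow> {x, y} \<notin> R2)"
    if ij: "i' < 5" "j < 5" "x \<in> ?A i'" "y \<in> ?A j" for i' j x y
  proof -
    consider (a) "x = u" "i' = i" "y = u" "j = i" | (b) "x = u" "i' = i" "y \<in> A j" | (c) "y = u" "j = i" "x \<in> A i'"
      | (d) "x \<in> A i'" "y \<in> A j"
      using ij(3,4) by (auto split: if_splits)
    then show ?thesis
    proof cases
      case a
      then show ?thesis by (simp add: near_def)
    next
      case b
      then show ?thesis using at_u[OF ij(2), of y] by (simp add: insert_commute)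
    next
      case c
      then show ?thesis using at_u[OF ij(1), of x] near_sym[of _ i i'] by simp
    next
      case d
      have "u \<notin> {x, y}" using d uA ij(1,2) by auto
      then show ?thesis using cross[OF ij(1,2) d] same[of "{x, y}"] by simp
    qed
  qed
  have ne': "\<forall>j<5. ?A j \<noteq> {}" using ne by simp
  have "\<forall>i'<5. \<forall>j<5. \<forall>x\<in>?A i'. \<forall>y\<in>?A j. (near 1 i' j \<longrightarrow> {x, y} \<in> R2) \<and> (near 2 i' j \<longrightarrow> {x, y} \<notin> R2)"
    by (intro allI impI ballI) (rule cross')
  then show ?thesis unfolding pentagon_blowup_iff by (intro conjI ne' un' disj')
qed

lemma grown_update:
  assumes "\<forall>j<5. finite (A j) \<and> u \<notin> A j" "i < 5"
  shows "mset (map (\<lambda>j. card ((A(i := insert u (A i))) j)) [0..<5]) = grown A i"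
  unfolding grown_def mset_map mset_upt by (rule image_mset_cong) (use assms in auto)

text \<open>\<open>R0\<close> is an exact blow-up away from \<open>u\<close>, and \<open>F\<close>
  records where \<open>R\<close> deviates from it: nowhere for the first family, in one edge for the
  second.\<close>

lemma config_of_blowup:
  assumes col: "colouring V R" and u: "u \<in> V" and bl: "pentagon_blowup (V - {u}) R0 A"
    and F: "\<And>f. u \<notin> f \<Longrightarrow> f \<in> R0 \<longleftrightarrow> (if f \<in> F then f \<notin> R else f \<in> R)"
  shows "config V R (pairs V - R) u A F"
proof -
  from bl have un: "(\<Union>i<5. A i) = V - {u}" and disj: "\<forall>i<5. \<forall>j<5. i \<noteq> j \<longrightarrow> A i \<inter> A j = {}"
    and cross: "\<And>i j x y. i < 5 \<Longrightarrow> j < 5 \<Longrightarrow> x \<in> A i \<Longrightarrow> y \<in> A j \<Longrightarrow>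
      (near 1 i j \<longrightarrow> {x, y} \<in> R0) \<and> (near 2 i j \<longrightarrow> {x, y} \<notin> R0)"
    unfolding pentagon_blowup_iff by blast+
  have RV: "R \<subseteq> pairs V" "finite V" using col by (auto simp: colouring_def)
  have "(near 1 i j \<longrightarrow> {x, y} \<in> (if {x, y} \<in> F then pairs V - R else R)) \<and>
      (near 2 i j \<longrightarrow> {x, y} \<in> (if {x, y} \<in> F then R else pairs V - R))"
    if ij: "i < 5" "j < 5" "x \<in> A i" "y \<in> A j" for i j x y
  proof (cases "i = j")
    case True
    then show ?thesis by (simp add: near_def)
  next
    case False
    have xy: "x \<in> V - {u}" "y \<in> V - {u}" using ij un by blast+
    have "x \<noteq> y" using disj False ij by blast
    then have "{x, y} \<in> pairs V" using xy by (simp add: pairs_iff)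
    moreover have "u \<notin> {x, y}" using xy by auto
    ultimately show ?thesis using cross[OF ij] F[of "{x, y}"] by (cases "{x, y} \<in> F") simp_all
  qed
  then show ?thesis unfolding config_def using RV u un disj by (intro conjI) (auto simp: Un_absorb1)
qed

lemma in_C_if_absorbs:
  assumes col: "colouring V R" and u: "u \<in> V" and bl: "pentagon_blowup (V - {u}) (delete_vertex_red R u) A"
    and i: "i < 5" and ab: "absorbs R (pairs V - R) u A False i"
  shows "in_C V R"
proof -
  let ?A = "A(i := insert u (A i))" and ?M = "misfits R (pairs V - R) u A i"
  have un: "(\<Union>i<5. A i) = V - {u}" using bl by (simp add: pentagon_blowup_def)
  have fin: "finite V" using col by (simp add: colouring_def)
  have AV: "x \<in> V" "x \<noteq> u" if "j < 5" "x \<in> A j" for j x using un that by blast+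
  have finA: "\<forall>j<5. finite (A j) \<and> u \<notin> A j" using AV(1) AV(2)[of _ u] fin by (blast intro: finite_subset[of _ V])
  have szs: "blob_sizes_in ?A B" if "grown A i \<in> mset ` B" for B
    using that grown_update[OF finA i] unfolding blob_sizes_in_def by auto
  have mem: "x \<in> ?M \<longleftrightarrow> (near 1 i j \<and> {x, u} \<notin> R \<or> near 2 i j \<and> {x, u} \<in> R)" if "j < 5" "x \<in> A j" for j x
  proof -
    have "x \<notin> A j'" if "j' < 5" "j' \<noteq> j" for j'
      using bl that \<open>j < 5\<close> \<open>x \<in> A j\<close> unfolding pentagon_blowup_def by blast
    moreover have "{x, u} \<in> pairs V" using AV[OF that] u by (simp add: pairs_iff)
    ultimately show ?thesis using that unfolding misfits_def by auto
  qed
  have same: "f \<in> R \<longleftrightarrow> f \<in> delete_vertex_red R u" if "u \<notin> f" for f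
    using that by (simp add: delete_vertex_red_def)
  have C1: "in_C V R" if "?M = {}" "grown A i \<in> mset ` B1"
  proof -
    have "pentagon_blowup V R ?A"
      by (rule pentagon_blowup_insert[OF bl u i same]) (use mem that(1) in auto)
    then show ?thesis using szs[OF that(2)] unfolding in_C_def in_C1_def by blast
  qed
  from ab consider "?M = {}" "grown A i \<in> mset ` B1" | "?M \<noteq> {}" "card ?M \<le> 1" "grown A i \<in> mset ` B2"
    using B2_subset_B1 unfolding absorbs_def by auto
  then show ?thesis
  proof cases
    case 1
    then show ?thesis by (rule C1)
  next
    case 2
    have "finite ?M" using AV fin unfolding misfits_def by (auto intro: finite_subset[of _ V])
    then have "card ?M = 1" using 2 by (metis card_0_eq le_neq_implies_less less_one)
    \<comment> \<open>Exactly one edge at \<open>u\<close> is wrong, and flipping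
      \<open>{w, u}\<close> turns the whole colouring into a blow-up.\<close>
    then obtain w where w: "?M = {w}" by (auto simp: card_1_singleton_iff)
    then have "w \<in> V" "w \<noteq> u" using AV unfolding misfits_def by blast+
    then have wu: "{w, u} \<in> pairs V" using u by (simp add: pairs_iff)
    have fl: "{x, u} \<in> flip_edge R {w, u} \<longleftrightarrow> (if x = w then {x, u} \<notin> R else {x, u} \<in> R)" for x
      by (auto simp: flip_edge_def doubleton_eq_iff)
    have "pentagon_blowup V (flip_edge R {w, u}) ?A"
    proof (rule pentagon_blowup_insert[OF bl u i])
      show "f \<in> flip_edge R {w, u} \<longleftrightarrow> f \<in> delete_vertex_red R u" if "u \<notin> f" for f
        using same[OF that] that by (auto simp: flip_edge_def)
      fix j x assume jx: "j < 5" "x \<in> A j"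
      have "\<not> (near 1 i j \<and> near 2 i j)" using near_1_2[OF i jx(1)] by blast
      then show "(near 1 i j \<longrightarrow> {x, u} \<in> flip_edge R {w, u}) \<and> (near 2 i j \<longrightarrow> {x, u} \<notin> flip_edge R {w, u})"
        using mem[OF jx] unfolding w fl by auto
    qed
    then show ?thesis using szs[OF 2(3)] wu unfolding in_C_def in_C2_def by blast
  qed
qed

lemma in_C_if_absorbs_flip:
  assumes col: "colouring V R" and u: "u \<in> V"
    and bl: "pentagon_blowup (V - {u}) (flip_edge (delete_vertex_red R u) e) A" and e: "e \<in> pairs (V - {u})"
    and i: "i < 5" and ab: "absorbs R (pairs V - R) u A True i"
  shows "in_C V R"
proof -
  let ?A = "A(i := insert u (A i))" and ?M = "misfits R (pairs V - R) u A i"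
  have un: "(\<Union>i<5. A i) = V - {u}" using bl by (simp add: pentagon_blowup_def)
  have fin: "finite V" using col by (simp add: colouring_def)
  have AV: "x \<in> V" "x \<noteq> u" if "j < 5" "x \<in> A j" for j x using un that by blast+
  have finA: "\<forall>j<5. finite (A j) \<and> u \<notin> A j" using AV(1) AV(2)[of _ u] fin by (blast intro: finite_subset[of _ V])
  have ue: "u \<notin> e" and eV: "e \<in> pairs V" using e by (auto simp: pairs_def)
  have M: "?M = {}" and g: "grown A i \<in> mset ` B2" using ab by (auto simp: absorbs_def)
  have "blob_sizes_in ?A B2"
    using g grown_update[OF finA i] unfolding blob_sizes_in_def by auto
  \<comment> \<open>Since \<open>e\<close> avoids \<open>u\<close>, the flip that repairs
    \<open>H\<close> repairs the whole colouring.\<close>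
  moreover have "pentagon_blowup V (flip_edge R e) ?A"
  proof (rule pentagon_blowup_insert[OF bl u i])
    show "f \<in> flip_edge R e \<longleftrightarrow> f \<in> flip_edge (delete_vertex_red R u) e" if "u \<notin> f" for f
      using that ue by (auto simp: flip_edge_def delete_vertex_red_def)
    fix j x assume jx: "j < 5" "x \<in> A j"
    then have "{x, u} \<in> pairs V" using AV u by (auto simp: pairs_iff)
    moreover have "x \<notin> ?M" using M by simp
    moreover have "{x, u} \<in> flip_edge R e \<longleftrightarrow> {x, u} \<in> R" using ue by (auto simp: flip_edge_def)
    ultimately show "(near 1 i j \<longrightarrow> {x, u} \<in> flip_edge R e) \<and> (near 2 i j \<longrightarrow> {x, u} \<notin> flip_edge R e)"
      using jx unfolding misfits_def by blast
  qed
  ultimately show ?thesis using eV unfolding in_C_def in_C2_def by blast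
qed

theorem theorem7p1:
  fixes V :: "'a set" and R :: "'a set set" and u :: 'a
  assumes "colouring V R"
    and "u \<in> V"
    and "in_C (V - {u}) (delete_vertex_red R u)"
  shows "pack V R > real (card V) * (real (card V) - 1) / 4 \<or> in_C V R"
proof -
  let ?R = "delete_vertex_red R u"
  have lp: "pack V R > real (card V) * (real (card V) - 1) / 4" if "large_pack V R (pairs V - R)"
    using that by (simp add: large_pack_def pack_def red_edges_def blue_edges_def)
  have plain: ?thesis if bl: "pentagon_blowup (V - {u}) ?R A" and sz: "blob_sizes_in A B1" for A
  proof -
    have "config V R (pairs V - R) u A {}"
      by (rule config_of_blowup[OF assms(1,2) bl]) (simp add: delete_vertex_red_def)
    moreover have "\<forall>i<5. A i \<noteq> {}" using bl by (simp add: pentagon_blowup_def)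
    ultimately have "handled V R (pairs V - R) u A False" by (rule handled_blowup[OF _ _ sz])
    then show ?thesis using lp in_C_if_absorbs[OF assms(1,2) bl] unfolding handled_def by blast
  qed
  from assms(3) consider (C1) A where "pentagon_blowup (V - {u}) ?R A" "blob_sizes_in A B1"
    | (C2) e A where "e \<in> pairs (V - {u})" "pentagon_blowup (V - {u}) (flip_edge ?R e) A" "blob_sizes_in A B2"
    unfolding in_C_def in_C1_def in_C2_def by blast
  then show ?thesis
  proof cases
    case C1
    then show ?thesis by (rule plain)
  next
    case C2
    obtain x y where e: "e = {x, y}" and xy: "x \<in> V - {u}" "y \<in> V - {u}" "x \<noteq> y"
      using C2(1) unfolding pairs_def by blast
    have un: "(\<Union>i<5. A i) = V - {u}" and disj: "\<And>i j. i < 5 \<Longrightarrow> j < 5 \<Longrightarrow> i \<noteq> j \<Longrightarrow> A i \<inter> A j = {}"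
      using C2(2) unfolding pentagon_blowup_def by blast+
    obtain i j where ij: "i < 5" "j < 5" "x \<in> A i" "y \<in> A j"
      using xy(1,2) unfolding un[symmetric] by blast
    show ?thesis
    proof (cases "i = j")
      \<comment> \<open>An edge inside a blob may have any colour, so flipping it back leaves a
        blow-up, and its sizes are in \<open>B1\<close> because \<open>B2\<close> is contained in
        \<open>B1\<close>.\<close>
      case True
      have flip: "{x', y'} \<in> flip_edge ?R e \<longleftrightarrow> {x', y'} \<in> ?R"
        if "i' < 5" "j' < 5" "x' \<in> A i'" "y' \<in> A j'" "i' \<noteq> j'" for i' j' x' y'
      proof -
        have "{x', y'} \<noteq> e"
        proof
          assume "{x', y'} = e"
          then have "x' \<in> A i" "y' \<in> A i" using ij True unfolding e by (auto simp: doubleton_eq_iff)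
          then show False using disj[OF that(1) ij(1)] disj[OF that(2) ij(1)] that by blast
        qed
        then show ?thesis by (auto simp: flip_edge_def)
      qed
      have "\<forall>i'<5. \<forall>j'<5. \<forall>x'\<in>A i'. \<forall>y'\<in>A j'.
          (near 1 i' j' \<longrightarrow> {x', y'} \<in> ?R) \<and> (near 2 i' j' \<longrightarrow> {x', y'} \<notin> ?R)"
      proof (intro allI impI ballI)
        fix i' j' x' y' assume a: "i' < 5" "j' < 5" "x' \<in> A i'" "y' \<in> A j'"
        then have "(near 1 i' j' \<longrightarrow> {x', y'} \<in> flip_edge ?R e) \<and> (near 2 i' j' \<longrightarrow> {x', y'} \<notin> flip_edge ?R e)"
          using C2(2) unfolding pentagon_blowup_iff by blast
        then show "(near 1 i' j' \<longrightarrow> {x', y'} \<in> ?R) \<and> (near 2 i' j' \<longrightarrow> {x', y'} \<notin> ?R)"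
          using flip[OF a] by (cases "i' = j'") (simp_all add: near_def)
      qed
      moreover have "\<forall>i<5. A i \<noteq> {}" "\<forall>i<5. \<forall>j<5. i \<noteq> j \<longrightarrow> A i \<inter> A j = {}"
        using C2(2) unfolding pentagon_blowup_def by blast+
      ultimately have "pentagon_blowup (V - {u}) ?R A"
        unfolding pentagon_blowup_iff using un by (intro conjI)
      moreover have "blob_sizes_in A B1" using C2(3) B2_subset_B1 unfolding blob_sizes_in_def by blast
      ultimately show ?thesis by (rule plain)
    next
      case False
      have "config V R (pairs V - R) u A {{x, y}}"
        by (rule config_of_blowup[OF assms(1,2) C2(2)]) (use xy in \<open>auto simp: e flip_edge_def delete_vertex_red_def\<close>)
      from handled_flip[OF this C2(3) ij(3,4,1,2) False]
      show ?thesis using lp in_C_if_absorbs_flip[OF assms(1,2) C2(2,1)] unfolding handled_def by blast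
    qed
  qed
qed

end
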